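(* Fix $s_0>0$ and measurable sets $\Omega_1,\Omega_2\subset(0,\infty)\times\mathbb R^{2d}$ such that there is a nonempty bounded open set $B\subset\mathbb R^{2d+1}$ with $$\Omega_1\circ(\delta_sB)^{-1}\subset\Omega_2\qquad\text{for all }s\in[0,s_0].$$ Then, for any $g\in H^1_{\rm kin}(\Omega_2)$ and any $s\in(0,s_0]$, $$\|g\|_{L^2(\Omega_1)}^2\lesssim s\,[g]_{H^1_{\rm kin}(\Omega_2)}\,\|g\|_{L^2(\Omega_2)}+\frac{1}{s^{4d+2}}\,\|g\|_{L^1(\Omega_2)}^2,$$ where the implied constant depends only on the choice of $B$ and the dimension $d$.
   Context: Points of $\mathbb R^{2d+1}$ are $z=(t,x,v)$ with $t\in\mathbb R$, $x,v\in\mathbb R^d$. Dilations: $\delta_rz=(r^2t,r^3x,rv)$. Group law: $z\circ z'=(t+t',\,x+x'+t'v,\,v+v')$, with inverse $z^{-1}=(-t,-x+tv,-v)$. For sets, $A\circ B=\{a\circ b:a\in A,b\in B\}$, $B^{-1}=\{b^{-1}:b\in B\}$, $\delta_sB=\{\delta_sb:b\in B\}$. With $Y=\partial_t+v\cdot\nabla_x$, the kinetic seminorm on a domain $D\subset\mathbb R^{2d+1}$ is $$[g]_{H^1_{\rm kin}(D)}=\|\nabla_vg\|_{L^2(D)}+\sup\Big\{\int_D(Yg)\,h\,dz:\ h\in H^1_{\rm kin}(D),\ \|\nabla_vh\|_{L^2(D)}=1\Big\},$$ where the integral is understood as an $H^{-1}_v$-$H^1_v$ duality pairing in the $v$ variable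 (equal to the ordinary integral when $g,h$ are sufficiently smooth; smooth functions are dense). $H^1_{\rm kin}(D)$ is the space of functions with finite norm, the norm being obtained by adding $\|g\|_{L^2(D)}$ to the seminorm. $A\lesssim B$ means $A\le CB$. *)

theory Defs
  imports "HOL-Analysis.Analysis"
begin

text \<open>Points \<open>(t, x, v)\<close> of \<open>\<real>\<^sup>2\<^sup>d\<^sup>+\<^sup>1\<close>, where \<open>d = CARD('d)\<close>.\<close>

type_synonym 'd kpoint = "real \<times> (real ^ 'd) \<times> (real ^ 'd)"

fun dilation :: "real \<Rightarrow> 'd::finite kpoint \<Rightarrow> 'd kpoint" where
  "dilation r (t, x, v) = (r ^ 2 * t, r ^ 3 *\<^sub>R x, r *\<^sub>R v)"

fun kin_comp :: "'d::finite kpoint \<Rightarrow> 'd kpoint \<Rightarrow> 'd kpoint" where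
  "kin_comp (t, x, v) (t', x', v') = (t + t', x + x' + t' *\<^sub>R v, v + v')"

fun kin_inv :: "'d::finite kpoint \<Rightarrow> 'd kpoint" where
  "kin_inv (t, x, v) = (- t, - x + t *\<^sub>R v, - v)"

definition set_comp :: "'d::finite kpoint set \<Rightarrow> 'd kpoint set \<Rightarrow> 'd kpoint set" where
  "set_comp A B = {kin_comp a b | a b. a \<in> A \<and> b \<in> B}"


definition grad_v :: "('d::finite kpoint \<Rightarrow> real) \<Rightarrow> 'd kpoint \<Rightarrow> real ^ 'd" where
  "grad_v f z = (\<chi> i. frechet_derivative f (at z) (0, 0, axis i 1))"

text \<open>The transport operator \<open>\<partial>\<^sub>t + v \<cdot> \<nabla>\<^sub>x\<close>: the derivative at \<open>(t, x, v)\<close> in the direction \<open>(1, v, 0)\<close>.\<close>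

definition transport :: "('d::finite kpoint \<Rightarrow> real) \<Rightarrow> 'd kpoint \<Rightarrow> real" where
  "transport f z = frechet_derivative f (at z) (1, snd (snd z), 0)"

primrec Ck_on :: "nat \<Rightarrow> ('a::euclidean_space \<Rightarrow> real) \<Rightarrow> 'a set \<Rightarrow> bool" where
  "Ck_on 0 f U \<longleftrightarrow> continuous_on U f"
| "Ck_on (Suc k) f U \<longleftrightarrow>
     f differentiable_on U \<and> (\<forall>e. Ck_on k (\<lambda>z. frechet_derivative f (at z) e) U)"

text \<open>Smoothness on an arbitrary set is the existence of an open neighbourhood on which the
  function is \<open>C\<^sup>\<infinity>\<close>; for open \<open>D\<close> this is just \<open>C\<^sup>\<infinity>(D)\<close>.\<close>

definition smooth_on_set :: "('a::euclidean_space \<Rightarrow> real) \<Rightarrow> 'a set \<Rightarrow> bool" where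
  "smooth_on_set f D \<longleftrightarrow> (\<exists>U. open U \<and> D \<subseteq> U \<and> (\<forall>k. Ck_on k f U))"


definition in_L2 :: "'a::euclidean_space set \<Rightarrow> ('a \<Rightarrow> 'b::euclidean_space) \<Rightarrow> bool" where
  "in_L2 D f \<longleftrightarrow> f \<in> borel_measurable (lebesgue_on D) \<and>
     integrable (lebesgue_on D) (\<lambda>z. (norm (f z)) ^ 2)"

definition L2_norm :: "'a::euclidean_space set \<Rightarrow> ('a \<Rightarrow> 'b::euclidean_space) \<Rightarrow> real" where
  "L2_norm D f = sqrt (\<integral>z. (norm (f z)) ^ 2 \<partial>lebesgue_on D)"

text \<open>The \<open>L\<^sup>1\<close> norm may be infinite for the functions considered.\<close>

definition L1_norm :: "'a::euclidean_space set \<Rightarrow> ('a \<Rightarrow> real) \<Rightarrow> ennreal" where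
  "L1_norm D f = (\<integral>\<^sup>+z. ennreal \<bar>f z\<bar> \<partial>lebesgue_on D)"


text \<open>
  The space \<open>H\<^sup>1\<^sub>k\<^sub>i\<^sub>n(D)\<close> is realised as a completion. On smooth functions with \<open>g\<close>, \<open>\<nabla>\<^sub>v g\<close> and \<open>Y g\<close>
  in \<open>L\<^sup>2(D)\<close> the duality pairing of \<open>Y g\<close> with \<open>h\<close> is the ordinary integral. Since smooth
  functions are dense and, for such \<open>g\<close>, the pairing is continuous in \<open>h\<close>, the supremum is taken
  over smooth \<open>h\<close>; this also removes the circularity of a norm on \<open>H\<^sup>1\<^sub>k\<^sub>i\<^sub>n(D)\<close> whose definition
  refers to the elements of \<open>H\<^sup>1\<^sub>k\<^sub>i\<^sub>n(D)\<close>.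
\<close>

definition kin_smooth :: "'d::finite kpoint set \<Rightarrow> ('d kpoint \<Rightarrow> real) set" where
  "kin_smooth D = {g. smooth_on_set g D \<and> in_L2 D g \<and> in_L2 D (grad_v g) \<and> in_L2 D (transport g)}"

text \<open>The truncation of negative values by \<open>ennreal\<close> is harmless, as \<open>h\<close> may be replaced by \<open>-h\<close>.\<close>

definition transport_dual_norm :: "'d::finite kpoint set \<Rightarrow> ('d kpoint \<Rightarrow> real) \<Rightarrow> ennreal" where
  "transport_dual_norm D g =
     (SUP h \<in> {h \<in> kin_smooth D. L2_norm D (grad_v h) = 1}.
        ennreal (\<integral>z. transport g z * h z \<partial>lebesgue_on D))"

definition kin_seminorm_smooth :: "'d::finite kpoint set \<Rightarrow> ('d kpoint \<Rightarrow> real) \<Rightarrow> ennreal" where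
  "kin_seminorm_smooth D g = ennreal (L2_norm D (grad_v g)) + transport_dual_norm D g"

text \<open>\<open>kin_approx D g u\<close>: the smooth functions \<open>u n\<close> converge to \<open>g\<close> in \<open>L\<^sup>2(D)\<close> and are Cauchy
  in the kinetic seminorm.\<close>

definition kin_approx ::
    "'d::finite kpoint set \<Rightarrow> ('d kpoint \<Rightarrow> real) \<Rightarrow> (nat \<Rightarrow> 'd kpoint \<Rightarrow> real) \<Rightarrow> bool" where
  "kin_approx D g u \<longleftrightarrow>
     (\<forall>n. u n \<in> kin_smooth D) \<and>
     (\<lambda>n. L2_norm D (\<lambda>z. u n z - g z)) \<longlonglongrightarrow> 0 \<and>
     (\<forall>e>0. \<exists>N. \<forall>m\<ge>N. \<forall>n\<ge>N. kin_seminorm_smooth D (\<lambda>z. u m z - u n z) < e)"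

text \<open>The seminorm of \<open>g\<close> is the limit of the seminorms along an approximating sequence. The
  infimum yields the quotient norm of the completion should the limit depend on the sequence,
  and \<open>\<infinity>\<close> if there is no such sequence.\<close>

definition kin_seminorm :: "'d::finite kpoint set \<Rightarrow> ('d kpoint \<Rightarrow> real) \<Rightarrow> ennreal" where
  "kin_seminorm D g =
     Inf {l. \<exists>u. kin_approx D g u \<and> (\<lambda>n. kin_seminorm_smooth D (u n)) \<longlonglongrightarrow> l}"

definition kin_norm :: "'d::finite kpoint set \<Rightarrow> ('d kpoint \<Rightarrow> real) \<Rightarrow> ennreal" where
  "kin_norm D g = ennreal (L2_norm D g) + kin_seminorm D g"

definition H1_kin :: "'d::finite kpoint set \<Rightarrow> ('d kpoint \<Rightarrow> real) set" where
  "H1_kin D = {g. in_L2 D g \<and> kin_norm D g < \<infinity>}"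

end

theory Submission
  imports Defs
begin

text \<open>
  The estimate is an interpolation between \<open>L\<^sup>1\<close> and the kinetic seminorm through mollification along
  the kinetic group. Write \<open>Q = 4d + 2\<close>, fix a smooth \<open>\<phi> \<ge> 0\<close> of integral one supported in a compact
  set \<open>K\<close> inside \<open>B\<close>, and let \<open>g\<^sub>s(z)\<close> be the average of \<open>g(y)\<close> against the kernel
  \<open>k\<^sub>s(y, z) = s\<^sup>-\<^sup>Q \<phi>(\<delta>\<^bsub>1/s\<^esub>(y\<^sup>-\<^sup>1 \<circ> z))\<close>. The geometric hypothesis ensures that for \<open>z\<close> in \<open>\<Omega>1\<close> the
  average only sees points \<open>y\<close> of \<open>\<Omega>2\<close>. Three facts make up the proof.

  First, \<open>k\<^sub>s\<close> has mass one in each variable and height of order \<open>s\<^sup>-\<^sup>Q\<close>, so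
  \<open>\<parallel>g\<^sub>s\<parallel>\<^sup>2\<close> in \<open>L\<^sup>2(\<Omega>1)\<close> is at most a constant times \<open>s\<^sup>-\<^sup>Q \<parallel>g\<parallel>\<^sup>2\<close> with \<open>g\<close> measured in \<open>L\<^sup>1(\<Omega>2)\<close>.

  Second, the derivative of \<open>k\<^sub>s\<close> in \<open>s\<close> is a sum of derivatives in \<open>y\<close> along the fields \<open>Y\<close> and
  \<open>\<nabla>\<^sub>v\<close> only (\<open>scale_deriv_eq_divergence\<close>). The scaling generator also contains \<open>x\<close>-derivatives, but
  \<open>\<partial>\<^sub>x\<close> is the commutator of \<open>\<partial>\<^sub>t\<close> and \<open>\<partial>\<^sub>v + t \<partial>\<^sub>x\<close>, and these two are what \<open>Y\<close> and \<open>\<nabla>\<^sub>v\<close>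
  become in the variable \<open>y\<^sup>-\<^sup>1 \<circ> z\<close>. The fluxes keep their support in \<open>K\<close>. After integrating by parts,
  the derivative of \<open>\<parallel>g\<^sub>\<sigma>\<parallel>\<^sup>2\<close> in \<open>\<sigma>\<close> is a pairing of \<open>Y g\<close> with a smooth function \<open>h\<close> of compact
  support in \<open>\<Omega>2\<close> plus a pairing of \<open>\<nabla>\<^sub>v g\<close> with a function \<open>k\<close>. The function \<open>h\<close> is itself a kernel
  average of \<open>g\<^sub>\<sigma>\<close>, and the powers of \<open>\<sigma>\<close> cancel in \<open>\<parallel>\<nabla>\<^sub>v h\<parallel>\<close> and \<open>\<parallel>k\<parallel>\<close>, which by the Schur test
  are bounded by \<open>\<parallel>g\<parallel>\<close>. Hence \<open>\<parallel>g\<^sub>\<sigma>\<parallel>\<^sup>2\<close> decreases at most at the rate of a constant times \<open>[g] \<parallel>g\<parallel>\<close>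
  (\<open>dissipation_bound\<close>).

  Third, \<open>g\<^sub>\<sigma>\<close> tends to \<open>g\<close> as \<open>\<sigma>\<close> tends to zero. Integrating the rate from \<open>0\<close> to \<open>s\<close> bounds
  \<open>\<parallel>g\<parallel>\<^sup>2\<close> by \<open>\<parallel>g\<^sub>s\<parallel>\<^sup>2\<close> plus a constant times \<open>s [g] \<parallel>g\<parallel>\<close> (\<open>smooth_dissipation_estimate\<close>).

  All this is carried out for smooth \<open>g\<close> and a compact subset of \<open>\<Omega>1\<close>, where every function of
  interest is bounded with bounded support. The constant depends on \<open>\<phi>\<close> alone, so the result passes to
  the completion along approximating sequences and to \<open>\<Omega>1\<close> by inner regularity.
\<close>

section \<open>Explicit smooth functions\<close>

text \<open>The usual flat function \<open>e\<^bsup>-1/u\<^esup>\<close>, weighted by \<open>u\<^sup>-\<^sup>m\<close> so that the family is closed under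
differentiation up to linear combinations.\<close>

definition flat :: "nat \<Rightarrow> real \<Rightarrow> real" where
  "flat m u = (if u > 0 then exp (- 1 / u) / u ^ m else 0)"

lemma flat_tendsto_0: "(flat m \<longlongrightarrow> 0) (at 0)"
proof -
  have "((\<lambda>u::real. (inverse u) ^ m / exp (inverse u)) \<longlongrightarrow> 0) (at_right 0)"
    by (rule filterlim_compose[OF tendsto_power_div_exp_0 filterlim_inverse_at_top_right])
  moreover have "eventually (\<lambda>u::real. (inverse u) ^ m / exp (inverse u) = flat m u) (at_right 0)"
    unfolding flat_def eventually_at_filter
    by (auto simp: exp_minus field_simps intro!: always_eventually)
  ultimately have R: "(flat m \<longlongrightarrow> 0) (at_right 0)"
    by (rule Lim_transform_eventually)
  have L: "(flat m \<longlongrightarrow> 0) (at_left 0)"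
    by (rule Lim_transform_eventually[OF tendsto_const])
       (auto simp: flat_def eventually_at_filter intro!: always_eventually)
  show ?thesis using L R by (simp add: filterlim_split_at)
qed

lemma flat_has_real_derivative:
  "(flat m has_real_derivative (flat (m + 2) u - real m * flat (m + 1) u)) (at u)"
proof -
  consider "u > 0" | "u < 0" | "u = 0" by linarith
  then show ?thesis
  proof cases
    case 1
    have "((\<lambda>u. exp (- 1 / u) / u ^ m) has_real_derivative
             (flat (m + 2) u - real m * flat (m + 1) u)) (at u)"
    proof (cases m)
      case (Suc k)
      have num: "((\<lambda>u. exp (- 1 / u)) has_real_derivative exp (- 1 / u) / u\<^sup>2) (at u)"
        using 1 by (auto intro!: derivative_eq_intros simp: power2_eq_square)
      have den: "((\<lambda>u. u ^ Suc k) has_real_derivative real (Suc k) * u ^ k) (at u)"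
        using DERIV_pow[of "Suc k" u] by simp
      show ?thesis
        using DERIV_divide[OF num den] 1 unfolding Suc
        by (rule_tac DERIV_cong) (auto simp: flat_def field_simps power2_eq_square)
    qed (use 1 in \<open>auto intro!: derivative_eq_intros simp: flat_def field_simps power2_eq_square\<close>)
    then show ?thesis
      by (rule has_field_derivative_transform_within_open[where S="{0<..}"])
         (use 1 in \<open>auto simp: flat_def\<close>)
  next
    case 2
    have "((\<lambda>u. 0) has_real_derivative (flat (m + 2) u - real m * flat (m + 1) u)) (at u)"
      using 2 by (auto simp: flat_def)
    then show ?thesis
      by (rule has_field_derivative_transform_within_open[where S="{..<0}"])
         (use 2 in \<open>auto simp: flat_def\<close>)
  next
    case 3
    have "((\<lambda>h. (flat m (0 + h) - flat m 0) / h) \<longlongrightarrow> 0) (at 0)"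
      by (rule Lim_transform_eventually[OF flat_tendsto_0[of "Suc m"]])
         (auto simp: flat_def eventually_at_filter)
    then show ?thesis
      using 3 unfolding DERIV_def by (simp add: flat_def)
  qed
qed

text \<open>An algebra of explicit functions that contains the bumps and the linear functionals and is closed
under directional derivatives and under composition with maps whose coordinates belong to it.
Smoothness of all orders then follows from first-order differentiability, and the symmetry of second
derivatives by induction.\<close>

inductive elem_smooth :: "('a::euclidean_space \<Rightarrow> real) \<Rightarrow> bool" where
  const: "elem_smooth (\<lambda>z. c)"
| inner: "elem_smooth (\<lambda>z. z \<bullet> a)"
| add: "elem_smooth f \<Longrightarrow> elem_smooth g \<Longrightarrow> elem_smooth (\<lambda>z. f z + g z)"
| mult: "elem_smooth f \<Longrightarrow> elem_smooth g \<Longrightarrow> elem_smooth (\<lambda>z. f z * g z)"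
| flat: "elem_smooth f \<Longrightarrow> elem_smooth (\<lambda>z. flat m (f z))"

lemma elem_smooth_uminus: "elem_smooth f \<Longrightarrow> elem_smooth (\<lambda>z. - f z)"
  using elem_smooth.mult[OF elem_smooth.const[of "-1"], of f] by simp

lemma elem_smooth_diff:
  "elem_smooth f \<Longrightarrow> elem_smooth g \<Longrightarrow> elem_smooth (\<lambda>z. f z - g z)"
  using elem_smooth.add[of f "\<lambda>z. - g z"] elem_smooth_uminus[of g] by simp

lemma elem_smooth_sum:
  "(\<And>i. i \<in> I \<Longrightarrow> elem_smooth (f i)) \<Longrightarrow> elem_smooth (\<lambda>z. \<Sum>i\<in>I. f i z)"
  by (induction I rule: infinite_finite_induct) (auto intro: elem_smooth.intros)

lemmas elem_smooth_intros =
  elem_smooth.intros elem_smooth_uminus elem_smooth_diff elem_smooth_sum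

lemma elem_smooth_compose:
  assumes "elem_smooth f" and "\<And>a. elem_smooth (\<lambda>q. p q \<bullet> a)"
  shows "elem_smooth (\<lambda>q. f (p q))"
  using assms by (induction f rule: elem_smooth.induct) (auto intro: elem_smooth.intros)

abbreviation deriv_along :: "'a::euclidean_space \<Rightarrow> ('a \<Rightarrow> real) \<Rightarrow> 'a \<Rightarrow> real" where
  "deriv_along e f \<equiv> \<lambda>z. frechet_derivative f (at z) e"

lemma deriv_along_eqI: "(f has_derivative f') (at z) \<Longrightarrow> deriv_along e f z = f' e"
  by (metis frechet_derivative_at)

lemma elem_smooth_differentiable: "elem_smooth f \<Longrightarrow> f differentiable (at z)"
proof (induction f arbitrary: z rule: elem_smooth.induct)
  case (flat f m)
  have "flat m differentiable (at (f z))"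
    using flat_has_real_derivative[of m "f z"] unfolding differentiable_def has_field_derivative_def
    by blast
  then show ?case
    using flat differentiable_compose[of "flat m" f z] by blast
qed auto

lemma elem_smooth_has_derivative:
  "elem_smooth f \<Longrightarrow> (f has_derivative (\<lambda>e. deriv_along e f z)) (at z)"
  using elem_smooth_differentiable frechet_derivative_works by blast

lemma elem_smooth_continuous: "elem_smooth f \<Longrightarrow> continuous_on S f"
  using elem_smooth_differentiable
  by (metis continuous_at_imp_continuous_on differentiable_imp_continuous_within)

lemma elem_smooth_measurable: "elem_smooth f \<Longrightarrow> f \<in> borel_measurable borel"
  by (rule borel_measurable_continuous_onI[OF elem_smooth_continuous])

lemma deriv_along_const: "deriv_along e (\<lambda>z. c) z = 0"
  by auto

lemma deriv_along_inner: "deriv_along e (\<lambda>z. z \<bullet> a) z = e \<bullet> a"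
  by (rule deriv_along_eqI) (auto intro!: derivative_eq_intros)

lemma deriv_along_add:
  assumes "elem_smooth f" "elem_smooth g"
  shows "deriv_along e (\<lambda>z. f z + g z) z = deriv_along e f z + deriv_along e g z"
  by (rule deriv_along_eqI, rule derivative_eq_intros)
     (use assms in \<open>auto intro!: elem_smooth_has_derivative\<close>)

lemma deriv_along_mult:
  assumes "elem_smooth f" "elem_smooth g"
  shows "deriv_along e (\<lambda>z. f z * g z) z = f z * deriv_along e g z + deriv_along e f z * g z"
  by (rule deriv_along_eqI, rule derivative_eq_intros)
     (use assms in \<open>auto intro!: elem_smooth_has_derivative\<close>)

lemma deriv_along_flat:
  assumes "elem_smooth f"
  shows "deriv_along e (\<lambda>z. flat m (f z)) z =
    (flat (m + 2) (f z) + (- real m) * flat (m + 1) (f z)) * deriv_along e f z"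
proof (rule deriv_along_eqI)
  show "((\<lambda>z. flat m (f z)) has_derivative
     (\<lambda>e. (flat (m + 2) (f z) + (- real m) * flat (m + 1) (f z)) * deriv_along e f z)) (at z)"
    using DERIV_compose_FDERIV[OF flat_has_real_derivative elem_smooth_has_derivative[OF assms]]
    by (simp add: mult.commute)
qed

lemma elem_smooth_deriv_along: "elem_smooth f \<Longrightarrow> elem_smooth (deriv_along e f)"
proof (induction f rule: elem_smooth.induct)
  case (flat f m)
  show ?case unfolding deriv_along_flat[OF flat.hyps]
    by (intro elem_smooth.intros flat)
next
  case (mult f g)
  show ?case unfolding deriv_along_mult[OF mult.hyps]
    by (intro elem_smooth.intros mult)
next
  case (add f g)
  show ?case unfolding deriv_along_add[OF add.hyps]
    by (intro elem_smooth.intros add)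
qed (auto simp: deriv_along_const deriv_along_inner intro: elem_smooth.intros)

lemma deriv_along_diff:
  assumes "elem_smooth f" "elem_smooth g"
  shows "deriv_along e (\<lambda>z. f z - g z) z = deriv_along e f z - deriv_along e g z"
  by (rule deriv_along_eqI, rule derivative_eq_intros)
     (use assms in \<open>auto intro!: elem_smooth_has_derivative\<close>)

lemma deriv_along_sum:
  assumes "\<And>i. i \<in> I \<Longrightarrow> elem_smooth (f i)"
  shows "deriv_along e (\<lambda>z. \<Sum>i\<in>I. f i z) z = (\<Sum>i\<in>I. deriv_along e (f i) z)"
  by (rule deriv_along_eqI, rule has_derivative_sum)
     (use assms in \<open>auto intro!: elem_smooth_has_derivative\<close>)

lemma deriv_along_commute:
  "elem_smooth f \<Longrightarrow> deriv_along e (deriv_along e' f) z = deriv_along e' (deriv_along e f) z"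
proof (induction f arbitrary: z rule: elem_smooth.induct)
  case (add f g)
  then show ?case
    by (simp add: deriv_along_add elem_smooth_deriv_along)
next
  case (mult f g)
  have *: "deriv_along e (deriv_along e' (\<lambda>z. f z * g z)) z =
     f z * deriv_along e (deriv_along e' g) z + deriv_along e (deriv_along e' f) z * g z
       + (deriv_along e f z * deriv_along e' g z + deriv_along e' f z * deriv_along e g z)" for e e'
    using mult.hyps
    by (simp add: deriv_along_mult deriv_along_add elem_smooth_deriv_along elem_smooth.mult)
  show ?case
    unfolding * mult.IH by (simp add: algebra_simps)
next
  case (flat f m)
  have *: "deriv_along e (deriv_along e' (\<lambda>z. flat m (f z))) z =
      (flat (m + 2) (f z) + (- real m) * flat (m + 1) (f z)) * deriv_along e (deriv_along e' f) z
      + ((flat (m + 4) (f z) + (- real (m + 2)) * flat (m + 3) (f z))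
        + (- real m) * (flat (m + 3) (f z) + (- real (m + 1)) * flat (m + 2) (f z)))
        * (deriv_along e f z * deriv_along e' f z)" for e e'
    using flat.hyps
    by (simp add: deriv_along_flat deriv_along_mult deriv_along_add deriv_along_diff deriv_along_const
        elem_smooth_deriv_along elem_smooth_intros numeral_eq_Suc algebra_simps)
  show ?case unfolding * flat.IH by (simp add: mult.commute)
qed (auto simp: deriv_along_const deriv_along_inner)

text \<open>The complement of a closed support is open, so the function vanishes near each of its points. This
is what keeps every derivative of a bump inside the support of the bump.\<close>

lemma deriv_along_outside_support:
  assumes "closed K" "\<And>w. w \<notin> K \<Longrightarrow> f w = 0" "z \<notin> K"
  shows "deriv_along e f z = 0"
proof (rule deriv_along_eqI)
  have "((\<lambda>_. 0::real) has_derivative (\<lambda>_. 0)) (at z)" by simp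
  then show "(f has_derivative (\<lambda>_. 0)) (at z)"
    by (rule has_derivative_transform_within_open[of _ _ _ _ "- K"])
       (use assms in auto)
qed

text \<open>A class of differentiable functions closed under directional derivatives consists of smooth functions.\<close>

lemma Ck_on_coinduct:
  assumes "\<And>f. P f \<Longrightarrow> f differentiable_on U"
    and "\<And>f e. P f \<Longrightarrow> P (deriv_along e f)"
    and "P f"
  shows "Ck_on k f U"
  using assms(3)
proof (induction k arbitrary: f)
  case 0
  then show ?case using assms(1) differentiable_imp_continuous_on by auto
next
  case (Suc k)
  then show ?case using assms(1,2) by auto
qed

section \<open>Changes of variables, kernels and bounded functions of bounded support\<close>

lemma nn_integral_affine:
  fixes f :: "'a::euclidean_space \<Rightarrow> ennreal"
  assumes [measurable]: "f \<in> borel_measurable borel" and c: "c \<noteq> 0"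
  shows "(\<integral>\<^sup>+x. f (t + c *\<^sub>R x) \<partial>lborel) = ennreal (1 / \<bar>c\<bar> ^ DIM('a)) * (\<integral>\<^sup>+x. f x \<partial>lborel)"
proof -
  have "(\<integral>\<^sup>+x. f x \<partial>lborel) = ennreal (\<bar>c\<bar> ^ DIM('a)) * (\<integral>\<^sup>+x. f (t + c *\<^sub>R x) \<partial>lborel)"
    by (subst lborel_affine[OF c, of t])
      (simp add: nn_integral_density nn_integral_distr nn_integral_cmult ennreal_power)
  then have "ennreal (1 / \<bar>c\<bar> ^ DIM('a)) * (\<integral>\<^sup>+x. f x \<partial>lborel) =
     ennreal (1 / \<bar>c\<bar> ^ DIM('a) * \<bar>c\<bar> ^ DIM('a)) * (\<integral>\<^sup>+x. f (t + c *\<^sub>R x) \<partial>lborel)"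
    by (subst ennreal_mult) (auto simp: mult.assoc)
  then show ?thesis using c by simp
qed

lemma borel_measurable_fst_snd_raw [measurable (raw)]:
  fixes f :: "'m \<Rightarrow> 'a::euclidean_space \<times> 'b::euclidean_space"
  assumes "f \<in> borel_measurable M"
  shows "(\<lambda>x. fst (f x)) \<in> borel_measurable M" "(\<lambda>x. snd (f x)) \<in> borel_measurable M"
  by (rule measurable_compose[OF assms], intro borel_measurable_continuous_onI continuous_intros)+

lemma nn_integral_lborel_triple:
  fixes f :: "'a::euclidean_space \<times> 'b::euclidean_space \<times> 'c::euclidean_space \<Rightarrow> ennreal"
  assumes [measurable]: "f \<in> borel_measurable borel"
  shows "integral\<^sup>N lborel f = (\<integral>\<^sup>+t. \<integral>\<^sup>+v. \<integral>\<^sup>+x. f (t, x, v) \<partial>lborel \<partial>lborel \<partial>lborel)"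
proof -
  have f1: "f \<in> borel_measurable (lborel \<Otimes>\<^sub>M lborel)"
    by (subst lborel_prod) simp
  have f2: "(\<lambda>p. f (t, fst p, snd p)) \<in> borel_measurable (lborel \<Otimes>\<^sub>M lborel)" for t
    by (subst lborel_prod) simp
  have "integral\<^sup>N lborel f = (\<integral>\<^sup>+t. \<integral>\<^sup>+p. f (t, p) \<partial>lborel \<partial>lborel)"
    by (subst lborel.nn_integral_fst[OF f1]) (simp add: lborel_prod)
  also have "\<dots> = (\<integral>\<^sup>+t. \<integral>\<^sup>+v. \<integral>\<^sup>+x. f (t, x, v) \<partial>lborel \<partial>lborel \<partial>lborel)"
  proof (rule nn_integral_cong)
    fix t
    show "(\<integral>\<^sup>+p. f (t, p) \<partial>lborel) = (\<integral>\<^sup>+v. \<integral>\<^sup>+x. f (t, x, v) \<partial>lborel \<partial>lborel)"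
      using lborel_pair.nn_integral_snd[OF f2[of t]]
      by (simp add: lborel_prod)
  qed
  finally show ?thesis .
qed

text \<open>Both \<open>y \<mapsto> y\<^sup>-\<^sup>1 \<circ> z\<close> and \<open>z \<mapsto> y\<^sup>-\<^sup>1 \<circ> z\<close> have this triangular form: for fixed time and velocity the
position is merely translated and scaled. Integrating over the position first removes the shift \<open>b\<close>,
however it depends on the other variables.\<close>

lemma nn_integral_triangular_affine:
  fixes f :: "real \<times> 'a::euclidean_space \<times> 'b::euclidean_space \<Rightarrow> ennreal"
  assumes [measurable]: "f \<in> borel_measurable borel"
    and b[measurable]: "(\<lambda>p. b (fst p) (snd p)) \<in> borel_measurable borel"
    and c: "c1 \<noteq> 0" "c2 \<noteq> 0" "c3 \<noteq> 0"
  shows "(\<integral>\<^sup>+y. f (a1 + c1 * fst y, b (fst y) (snd (snd y)) + c2 *\<^sub>R fst (snd y),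
                    a3 + c3 *\<^sub>R snd (snd y)) \<partial>lborel) =
     ennreal (1 / (\<bar>c1\<bar> * \<bar>c2\<bar> ^ DIM('a) * \<bar>c3\<bar> ^ DIM('b))) * integral\<^sup>N lborel f"
    (is "?L = _")
proof -
  let ?k = "\<lambda>c n. ennreal (1 / \<bar>c\<bar> ^ n)"
  have "(\<lambda>y::real \<times> 'a \<times> 'b. (fst y, snd (snd y))) \<in> borel_measurable borel"
    by measurable
  from measurable_compose[OF this b]
  have [measurable]: "(\<lambda>y::real \<times> 'a \<times> 'b. b (fst y) (snd (snd y))) \<in> borel_measurable borel"
    by simp
  have "?L = (\<integral>\<^sup>+t. \<integral>\<^sup>+v. \<integral>\<^sup>+x. f (a1 + c1 * t, b t v + c2 *\<^sub>R x, a3 + c3 *\<^sub>R v) \<partial>lborel \<partial>lborel \<partial>lborel)"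
    by (subst nn_integral_lborel_triple) simp_all
  also have "\<dots> = (\<integral>\<^sup>+t. \<integral>\<^sup>+v. ?k c2 DIM('a) * (\<integral>\<^sup>+x. f (a1 + c1 * t, x, a3 + c3 *\<^sub>R v) \<partial>lborel) \<partial>lborel \<partial>lborel)"
    by (intro nn_integral_cong nn_integral_affine[OF _ c(2)]) simp
  also have "\<dots> = ?k c2 DIM('a) * (\<integral>\<^sup>+t. \<integral>\<^sup>+v. (\<integral>\<^sup>+x. f (a1 + c1 * t, x, a3 + c3 *\<^sub>R v) \<partial>lborel) \<partial>lborel \<partial>lborel)"
    by (simp add: nn_integral_cmult)
  also have "\<dots> = ?k c2 DIM('a) * (\<integral>\<^sup>+t. ?k c3 DIM('b) * (\<integral>\<^sup>+v. (\<integral>\<^sup>+x. f (a1 + c1 * t, x, v) \<partial>lborel) \<partial>lborel) \<partial>lborel)"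
    by (intro arg_cong2[where f="(*)"] refl nn_integral_cong nn_integral_affine[OF _ c(3)]) simp
  also have "\<dots> = ?k c2 DIM('a) * (?k c3 DIM('b) * (\<integral>\<^sup>+t. (\<integral>\<^sup>+v. (\<integral>\<^sup>+x. f (a1 + c1 * t, x, v) \<partial>lborel) \<partial>lborel) \<partial>lborel))"
    by (simp add: nn_integral_cmult)
  also have "\<dots> = ?k c2 DIM('a) * (?k c3 DIM('b) * (?k c1 1 * integral\<^sup>N lborel f))"
    using nn_integral_affine[OF _ c(1), of "\<lambda>t. \<integral>\<^sup>+v. \<integral>\<^sup>+x. f (t, x, v) \<partial>lborel \<partial>lborel" a1]
    by (simp add: nn_integral_lborel_triple)
  also have "\<dots> = ennreal (1 / (\<bar>c1\<bar> * \<bar>c2\<bar> ^ DIM('a) * \<bar>c3\<bar> ^ DIM('b))) * integral\<^sup>N lborel f"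
  proof -
    have "ennreal (1 / (\<bar>c1\<bar> * \<bar>c2\<bar> ^ DIM('a) * \<bar>c3\<bar> ^ DIM('b))) = ?k c2 DIM('a) * (?k c3 DIM('b) * ?k c1 1)"
      by (subst ennreal_mult[symmetric], simp, simp, subst ennreal_mult[symmetric], simp, simp,
          rule arg_cong[of _ _ ennreal]) (simp add: field_simps)
    then show ?thesis by (simp only: mult.assoc)
  qed
  finally show ?thesis .
qed

lemma nn_integral_kernel_swap:
  fixes \<kappa> :: "'a::euclidean_space \<Rightarrow> 'b::euclidean_space \<Rightarrow> ennreal"
  assumes "(\<lambda>p. \<kappa> (fst p) (snd p)) \<in> borel_measurable borel"
  shows "(\<integral>\<^sup>+z. \<integral>\<^sup>+y. \<kappa> y z \<partial>lborel \<partial>lborel) = (\<integral>\<^sup>+y. \<integral>\<^sup>+z. \<kappa> y z \<partial>lborel \<partial>lborel)"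
proof (rule lborel_pair.Fubini')
  show "case_prod \<kappa> \<in> borel_measurable (lborel \<Otimes>\<^sub>M lborel)"
    using assms by (subst lborel_prod) (simp add: case_prod_beta')
qed

lemma borel_measurable_section:
  fixes \<kappa> :: "'a::euclidean_space \<Rightarrow> 'b::euclidean_space \<Rightarrow> 'c::topological_space"
  assumes "(\<lambda>p. \<kappa> (fst p) (snd p)) \<in> borel_measurable borel"
  shows "(\<lambda>y. \<kappa> y z) \<in> borel_measurable borel" "(\<lambda>z. \<kappa> y z) \<in> borel_measurable borel"
  using measurable_compose[OF _ assms, of "\<lambda>y. (y, z)" borel]
    measurable_compose[OF _ assms, of "\<lambda>z. (y, z)" borel]
  by simp_all

lemma borel_measurable_kernel_nn_integral:
  fixes \<kappa> :: "'a::euclidean_space \<Rightarrow> 'b::euclidean_space \<Rightarrow> ennreal"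
  assumes \<kappa>: "(\<lambda>p. \<kappa> (fst p) (snd p)) \<in> borel_measurable borel" and [measurable]: "f \<in> borel_measurable borel"
  shows "(\<lambda>z. \<integral>\<^sup>+y. f y * \<kappa> y z \<partial>lborel) \<in> borel_measurable borel"
proof -
  have "(\<lambda>p. f (snd p) * \<kappa> (snd p) (fst p)) \<in> borel_measurable (lborel \<Otimes>\<^sub>M lborel)"
    using measurable_compose[OF _ \<kappa>, of "\<lambda>p. (snd p, fst p)" borel]
    by (subst lborel_prod) simp
  from lborel.borel_measurable_nn_integral_fst[OF this] show ?thesis by simp
qed

text \<open>Cauchy--Schwarz for the measure with density \<open>\<kappa>\<close> in \<open>y\<close>, of mass at most \<open>B\<close>, followed by
integration in \<open>z\<close> with the order of the integrals exchanged.\<close>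

lemma Schur_test:
  fixes \<kappa> :: "'a::euclidean_space \<Rightarrow> 'b::euclidean_space \<Rightarrow> ennreal"
  assumes \<kappa>: "(\<lambda>p. \<kappa> (fst p) (snd p)) \<in> borel_measurable borel"
    and [measurable]: "f \<in> borel_measurable borel"
    and A: "\<And>y. (\<integral>\<^sup>+z. \<kappa> y z \<partial>lborel) \<le> A" and B: "\<And>z. (\<integral>\<^sup>+y. \<kappa> y z \<partial>lborel) \<le> B"
  shows "(\<integral>\<^sup>+z. (\<integral>\<^sup>+y. f y * \<kappa> y z \<partial>lborel)\<^sup>2 \<partial>lborel) \<le> A * B * (\<integral>\<^sup>+y. (f y)\<^sup>2 \<partial>lborel)"
proof -
  note [measurable] = borel_measurable_section[OF \<kappa>] \<kappa>
  have "(\<integral>\<^sup>+y. f y * \<kappa> y z \<partial>lborel)\<^sup>2 \<le> B * (\<integral>\<^sup>+y. (f y)\<^sup>2 * \<kappa> y z \<partial>lborel)" for z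
  proof -
    have "(\<integral>\<^sup>+y. f y * 1 \<partial>density lborel (\<lambda>y. \<kappa> y z))\<^sup>2
       \<le> (\<integral>\<^sup>+y. (f y)\<^sup>2 \<partial>density lborel (\<lambda>y. \<kappa> y z)) * (\<integral>\<^sup>+y. 1\<^sup>2 \<partial>density lborel (\<lambda>y. \<kappa> y z))"
      by (rule Cauchy_Schwarz_nn_integral) simp_all
    also have "\<dots> = (\<integral>\<^sup>+y. (f y)\<^sup>2 * \<kappa> y z \<partial>lborel) * (\<integral>\<^sup>+y. \<kappa> y z \<partial>lborel)"
      by (simp add: nn_integral_density mult.commute del: nn_integral_const)
    also have "\<dots> \<le> (\<integral>\<^sup>+y. (f y)\<^sup>2 * \<kappa> y z \<partial>lborel) * B"
      by (intro mult_left_mono B) simp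
    finally show ?thesis
      by (simp add: nn_integral_density mult.commute)
  qed
  then have "(\<integral>\<^sup>+z. (\<integral>\<^sup>+y. f y * \<kappa> y z \<partial>lborel)\<^sup>2 \<partial>lborel)
      \<le> (\<integral>\<^sup>+z. B * (\<integral>\<^sup>+y. (f y)\<^sup>2 * \<kappa> y z \<partial>lborel) \<partial>lborel)"
    by (intro nn_integral_mono)
  also have "\<dots> = B * (\<integral>\<^sup>+z. (\<integral>\<^sup>+y. (f y)\<^sup>2 * \<kappa> y z \<partial>lborel) \<partial>lborel)"
    by (rule nn_integral_cmult) (use borel_measurable_kernel_nn_integral[OF \<kappa>, of "\<lambda>y. (f y)\<^sup>2"] in simp)
  also have "(\<integral>\<^sup>+z. (\<integral>\<^sup>+y. (f y)\<^sup>2 * \<kappa> y z \<partial>lborel) \<partial>lborel)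
      = (\<integral>\<^sup>+y. (\<integral>\<^sup>+z. (f y)\<^sup>2 * \<kappa> y z \<partial>lborel) \<partial>lborel)"
    by (rule nn_integral_kernel_swap) measurable
  also have "\<dots> = (\<integral>\<^sup>+y. (f y)\<^sup>2 * (\<integral>\<^sup>+z. \<kappa> y z \<partial>lborel) \<partial>lborel)"
    by (simp add: nn_integral_cmult)
  also have "\<dots> \<le> (\<integral>\<^sup>+y. (f y)\<^sup>2 * A \<partial>lborel)"
    by (intro nn_integral_mono mult_left_mono A) simp
  also have "\<dots> = (\<integral>\<^sup>+y. (f y)\<^sup>2 \<partial>lborel) * A"
    by (rule nn_integral_multc) simp
  finally have "(\<integral>\<^sup>+z. (\<integral>\<^sup>+y. f y * \<kappa> y z \<partial>lborel)\<^sup>2 \<partial>lborel)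
      \<le> B * ((\<integral>\<^sup>+y. (f y)\<^sup>2 \<partial>lborel) * A)"
    by (simp add: mult_left_mono)
  then show ?thesis by (simp only: mult_ac)
qed

text \<open>One factor of the square is estimated by the height of the kernel, the other one by its mass.\<close>

lemma nn_integral_kernel_L1_L2:
  fixes \<kappa> :: "'a::euclidean_space \<Rightarrow> 'b::euclidean_space \<Rightarrow> ennreal"
  assumes \<kappa>: "(\<lambda>p. \<kappa> (fst p) (snd p)) \<in> borel_measurable borel"
    and [measurable]: "f \<in> borel_measurable borel"
    and A: "\<And>y. (\<integral>\<^sup>+z. \<kappa> y z \<partial>lborel) \<le> A" and S: "\<And>y z. \<kappa> y z \<le> S"
  shows "(\<integral>\<^sup>+z. (\<integral>\<^sup>+y. f y * \<kappa> y z \<partial>lborel)\<^sup>2 \<partial>lborel) \<le> A * S * (\<integral>\<^sup>+y. f y \<partial>lborel)\<^sup>2"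
proof -
  note [measurable] = borel_measurable_section[OF \<kappa>] \<kappa>
  let ?F = "\<integral>\<^sup>+y. f y \<partial>lborel"
  have *: "(\<integral>\<^sup>+y. f y * \<kappa> y z \<partial>lborel) \<le> S * ?F" for z
  proof -
    have "(\<integral>\<^sup>+y. f y * \<kappa> y z \<partial>lborel) \<le> (\<integral>\<^sup>+y. f y * S \<partial>lborel)"
      by (intro nn_integral_mono mult_left_mono S) simp
    also have "\<dots> = ?F * S" by (rule nn_integral_multc) simp
    finally show ?thesis by (simp add: mult.commute)
  qed
  have "(\<integral>\<^sup>+z. (\<integral>\<^sup>+y. f y * \<kappa> y z \<partial>lborel)\<^sup>2 \<partial>lborel)
      \<le> (\<integral>\<^sup>+z. (S * ?F) * (\<integral>\<^sup>+y. f y * \<kappa> y z \<partial>lborel) \<partial>lborel)"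
    unfolding power2_eq_square by (intro nn_integral_mono mult_right_mono *) simp
  also have "\<dots> = (S * ?F) * (\<integral>\<^sup>+z. (\<integral>\<^sup>+y. f y * \<kappa> y z \<partial>lborel) \<partial>lborel)"
    by (rule nn_integral_cmult) (use borel_measurable_kernel_nn_integral[OF \<kappa>, of f] in simp)
  also have "(\<integral>\<^sup>+z. (\<integral>\<^sup>+y. f y * \<kappa> y z \<partial>lborel) \<partial>lborel)
      = (\<integral>\<^sup>+y. (\<integral>\<^sup>+z. f y * \<kappa> y z \<partial>lborel) \<partial>lborel)"
    by (rule nn_integral_kernel_swap) measurable
  also have "\<dots> = (\<integral>\<^sup>+y. f y * (\<integral>\<^sup>+z. \<kappa> y z \<partial>lborel) \<partial>lborel)"
    by (simp add: nn_integral_cmult)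
  also have "\<dots> \<le> (\<integral>\<^sup>+y. f y * A \<partial>lborel)"
    by (intro nn_integral_mono mult_left_mono A) simp
  also have "\<dots> = ?F * A"
    by (rule nn_integral_multc) simp
  finally have "(\<integral>\<^sup>+z. (\<integral>\<^sup>+y. f y * \<kappa> y z \<partial>lborel)\<^sup>2 \<partial>lborel) \<le> (S * ?F) * (?F * A)"
    by (simp add: mult_left_mono)
  then show ?thesis by (simp only: mult_ac power2_eq_square)
qed

text \<open>With smooth data and compact regions all integrands are of this kind; the class spares separate
integrability arguments, in particular for exchanging integrals.\<close>

definition bdd_borel :: "('a::euclidean_space \<Rightarrow> real) \<Rightarrow> bool" where
  "bdd_borel f \<longleftrightarrow> f \<in> borel_measurable borel \<and>
     (\<exists>R. \<forall>z. \<bar>f z\<bar> \<le> R) \<and> (\<exists>R. \<forall>z. f z \<noteq> 0 \<longrightarrow> norm z \<le> R)"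

lemma bdd_borel_measurable: "bdd_borel f \<Longrightarrow> f \<in> borel_measurable borel"
  by (simp add: bdd_borel_def)

lemma bdd_borel_mult_continuous:
  assumes f: "bdd_borel f" and g: "continuous_on UNIV g"
  shows "bdd_borel (\<lambda>z. f z * g z)"
proof -
  obtain R S where R: "\<And>z. \<bar>f z\<bar> \<le> R" and S: "\<And>z. f z \<noteq> 0 \<Longrightarrow> norm z \<le> S"
    using f unfolding bdd_borel_def by metis
  have [measurable]: "f \<in> borel_measurable borel" "g \<in> borel_measurable borel"
    using f g by (auto simp: bdd_borel_def intro: borel_measurable_continuous_onI)
  have "compact (g ` cball 0 S)"
    by (intro compact_continuous_image compact_cball continuous_on_subset[OF g]) auto
  then obtain T where T: "\<And>z. norm z \<le> S \<Longrightarrow> \<bar>g z\<bar> \<le> T"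
    using compact_imp_bounded[of "g ` cball 0 S"] unfolding bounded_iff by fastforce
  have "\<bar>f z * g z\<bar> \<le> R * \<bar>T\<bar>" for z
  proof (cases "f z = 0")
    case True
    then show ?thesis using R[of z] by simp
  next
    case False
    then have "\<bar>g z\<bar> \<le> \<bar>T\<bar>" using T[OF S] by force
    then show ?thesis using R[of z] by (simp add: abs_mult mult_mono)
  qed
  then show ?thesis
    using S unfolding bdd_borel_def by (intro conjI exI[of _ "R * \<bar>T\<bar>"] exI[of _ S]) auto
qed

lemma bdd_borel_pair:
  assumes "bdd_borel f" "bdd_borel g"
  shows "bdd_borel (\<lambda>p. f (fst p) * g (snd p))"
proof -
  obtain R S where R: "\<And>z. \<bar>f z\<bar> \<le> R" and S: "\<And>z. f z \<noteq> 0 \<Longrightarrow> norm z \<le> S"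
    using assms(1) unfolding bdd_borel_def by metis
  obtain R' S' where R': "\<And>z. \<bar>g z\<bar> \<le> R'" and S': "\<And>z. g z \<noteq> 0 \<Longrightarrow> norm z \<le> S'"
    using assms(2) unfolding bdd_borel_def by metis
  have [measurable]: "f \<in> borel_measurable borel" "g \<in> borel_measurable borel"
    using assms by (auto simp: bdd_borel_def)
  have "0 \<le> R" using R[of undefined] by linarith
  then have "\<bar>f (fst p) * g (snd p)\<bar> \<le> R * R'" for p
    unfolding abs_mult by (intro mult_mono R R') auto
  moreover have "norm p \<le> S + S'" if "f (fst p) * g (snd p) \<noteq> 0" for p
    using that S[of "fst p"] S'[of "snd p"] norm_Pair_le[of "fst p" "snd p"] by auto
  ultimately show ?thesis
    unfolding bdd_borel_def by (intro conjI) (measurable, blast+)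
qed

lemma bdd_borel_integrable:
  assumes "bdd_borel f"
  shows "integrable lborel f"
proof -
  obtain R S where R: "\<And>z. \<bar>f z\<bar> \<le> R" and S: "\<And>z. f z \<noteq> 0 \<Longrightarrow> norm z \<le> S"
    using assms(1) unfolding bdd_borel_def by metis
  have [measurable]: "f \<in> borel_measurable borel"
    using assms by (auto simp: bdd_borel_def)
  have "integrable lborel (\<lambda>z. R * indicator (cball 0 S) z)"
    by (intro integrable_mult_right integrable_real_indicator emeasure_bounded_finite bounded_cball) simp
  then show ?thesis
  proof (rule Bochner_Integration.integrable_bound)
    show "AE z in lborel. norm (f z) \<le> norm (R * indicator (cball 0 S) z :: real)"
      using R S by (auto simp: indicator_def dist_norm intro!: always_eventually)
        (metis abs_ge_self order_trans)+
  qed simp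
qed

lemma bdd_borel_indicator_continuous:
  assumes "compact E" "continuous_on E f"
  shows "bdd_borel (\<lambda>z. indicator E z * f z)"
proof -
  have "bounded (f ` E)" "bounded E"
    using assms compact_continuous_image compact_imp_bounded by blast+
  then obtain R S where "\<And>z. z \<in> E \<Longrightarrow> \<bar>f z\<bar> \<le> R" "\<And>z. z \<in> E \<Longrightarrow> norm z \<le> S"
    unfolding bounded_iff by auto
  moreover from this have "\<bar>indicator E z * f z\<bar> \<le> \<bar>R\<bar>" for z
    by (cases "z \<in> E") (auto simp: abs_mult intro: order_trans[OF _ abs_ge_self])
  ultimately show ?thesis
    using borel_measurable_continuous_on_indicator[OF borel_compact[OF assms(1)] assms(2)]
    unfolding bdd_borel_def
    by (intro conjI exI[of _ "\<bar>R\<bar>"] exI[of _ S]) (auto simp: indicator_def split: if_splits)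
qed

lemma bdd_borel_indicator:
  assumes "compact A"
  shows "bdd_borel (\<lambda>z. indicator A z :: real)"
  using bdd_borel_indicator_continuous[OF assms, of "\<lambda>_. 1"] by simp

lemma bdd_borel_kernel_integral:
  fixes F :: "'a::euclidean_space \<times> 'b::euclidean_space \<Rightarrow> real"
  assumes f: "bdd_borel f" and g: "bdd_borel g" and F: "continuous_on UNIV F"
  shows "bdd_borel (\<lambda>z. g z * (LBINT y. f y * F (y, z)))"
proof -
  obtain R S where R: "\<And>z. \<bar>f z\<bar> \<le> R" and S: "\<And>z. f z \<noteq> 0 \<Longrightarrow> norm z \<le> S"
    using f unfolding bdd_borel_def by metis
  obtain R' S' where R': "\<And>z. \<bar>g z\<bar> \<le> R'" and S': "\<And>z. g z \<noteq> 0 \<Longrightarrow> norm z \<le> S'"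
    using g unfolding bdd_borel_def by metis
  have [measurable]: "f \<in> borel_measurable borel" "g \<in> borel_measurable borel"
    "F \<in> borel_measurable borel"
    using f g F by (auto simp: bdd_borel_def intro: borel_measurable_continuous_onI)
  have m: "(\<lambda>z. \<integral>y. f y * F (y, z) \<partial>lborel) \<in> borel_measurable borel"
  proof -
    have "(\<lambda>(z, y). f y * F (y, z)) \<in> borel_measurable (borel \<Otimes>\<^sub>M lborel)"
    proof -
      have "(\<lambda>p. f (snd p) * F (snd p, fst p)) \<in> borel_measurable (borel :: ('b \<times> 'a) measure)"
        by measurable
      then show ?thesis by (simp add: case_prod_beta' borel_prod[symmetric] cong: measurable_cong_sets)
    qed
    from lborel.borel_measurable_lebesgue_integral[OF this] show ?thesis by simp
  qed
  have "compact (F ` (cball 0 S \<times> cball 0 S'))"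
    by (intro compact_continuous_image compact_Times compact_cball continuous_on_subset[OF F]) auto
  then obtain T where T: "\<And>y z. norm y \<le> S \<Longrightarrow> norm z \<le> S' \<Longrightarrow> \<bar>F (y, z)\<bar> \<le> T"
    using compact_imp_bounded[of "F ` (cball 0 S \<times> cball 0 S')"] unfolding bounded_iff by fastforce
  have "R' \<ge> 0" using R'[of undefined] by linarith
  have "\<bar>g z * (LBINT y. f y * F (y, z))\<bar> \<le> R' * (LBINT y. \<bar>f y\<bar> * \<bar>T\<bar>)" for z
  proof (cases "g z = 0")
    case True
    then show ?thesis using \<open>R' \<ge> 0\<close> by simp
  next
    case False
    have fF: "integrable lborel (\<lambda>y. f y * F (y, z))"
      by (intro bdd_borel_integrable bdd_borel_mult_continuous[OF f] continuous_on_compose2[OF F])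
         (auto intro!: continuous_intros)
    have "\<bar>f y * F (y, z)\<bar> \<le> \<bar>f y\<bar> * \<bar>T\<bar>" for y
      using T[of y z] S[of y] S'[OF False] by (cases "f y = 0") (auto simp: abs_mult intro!: mult_left_mono)
    then have "(LBINT y. \<bar>f y * F (y, z)\<bar>) \<le> (LBINT y. \<bar>f y\<bar> * \<bar>T\<bar>)"
      using bdd_borel_integrable[OF f] fF by (intro integral_mono) auto
    then have "\<bar>\<integral>y. f y * F (y, z) \<partial>lborel\<bar> \<le> (LBINT y. \<bar>f y\<bar> * \<bar>T\<bar>)"
      using integral_norm_bound[of lborel "\<lambda>y. f y * F (y, z)"] unfolding real_norm_def
      by linarith
    then show ?thesis
      unfolding abs_mult using R'[of z] \<open>R' \<ge> 0\<close> by (intro mult_mono) auto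
  qed
  note bound = this
  show ?thesis
    unfolding bdd_borel_def
  proof (intro conjI)
    show "(\<lambda>z. g z * (LBINT y. f y * F (y, z))) \<in> borel_measurable borel"
      using m by measurable
    show "\<exists>R. \<forall>z. \<bar>g z * (LBINT y. f y * F (y, z))\<bar> \<le> R"
      using bound by blast
    show "\<exists>R. \<forall>z. g z * (LBINT y. f y * F (y, z)) \<noteq> 0 \<longrightarrow> norm z \<le> R"
      using S' by (metis mult_zero_left)
  qed
qed

lemma bdd_borel_Fubini:
  fixes F :: "'a::euclidean_space \<times> 'b::euclidean_space \<Rightarrow> real"
  assumes f: "bdd_borel f" and g: "bdd_borel g" and F: "continuous_on UNIV F"
  shows "(LBINT z. g z * (LBINT y. f y * F (y, z))) =
         (LBINT y. f y * (LBINT z. g z * F (y, z)))"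
proof -
  have "integrable lborel (\<lambda>p. f (fst p) * g (snd p) * F p)"
    by (intro bdd_borel_integrable bdd_borel_mult_continuous[OF _ F] bdd_borel_pair f g)
  then have "integrable (lborel \<Otimes>\<^sub>M lborel) (case_prod (\<lambda>y z. f y * g z * F (y, z)))"
    by (simp add: lborel_prod case_prod_beta')
  note * = lborel_pair.Fubini_integral[OF this]
  have "g z * (LBINT y. f y * F (y, z)) = (LBINT y. f y * g z * F (y, z))" for z
    by (subst integral_mult_right_zero[symmetric]) (simp only: mult_ac)
  moreover have "f y * (LBINT z. g z * F (y, z)) = (LBINT z. f y * g z * F (y, z))" for y
    by (subst integral_mult_right_zero[symmetric]) (simp only: mult_ac)
  ultimately show ?thesis using * by (simp only:)
qed

lemma bdd_borel_mult:
  assumes "bdd_borel f" "bdd_borel g"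
  shows "bdd_borel (\<lambda>z. f z * g z)"
proof -
  obtain R S where R: "\<And>z. \<bar>f z\<bar> \<le> R" and S: "\<And>z. f z \<noteq> 0 \<Longrightarrow> norm z \<le> S"
    using assms(1) unfolding bdd_borel_def by metis
  obtain R' where R': "\<And>z. \<bar>g z\<bar> \<le> R'"
    using assms(2) unfolding bdd_borel_def by metis
  have [measurable]: "f \<in> borel_measurable borel" "g \<in> borel_measurable borel"
    using assms by (auto simp: bdd_borel_def)
  have "0 \<le> R" using R[of undefined] by linarith
  then have "\<bar>f z * g z\<bar> \<le> R * R'" for z
    unfolding abs_mult by (intro mult_mono R R') auto
  moreover have "norm z \<le> S" if "f z * g z \<noteq> 0" for z using that S by simp
  ultimately show ?thesis
    unfolding bdd_borel_def by (intro conjI) (measurable, blast+)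
qed

lemma nn_integral_bdd_borel_nonneg:
  assumes "bdd_borel f" "\<And>z. 0 \<le> f z"
  shows "(\<integral>\<^sup>+z. ennreal (f z) \<partial>lborel) = ennreal (LBINT z. f z)"
  by (intro nn_integral_eq_integral bdd_borel_integrable assms always_eventually allI)

lemma ennreal_abs_integral_le:
  fixes f :: "'a \<Rightarrow> real"
  shows "ennreal \<bar>\<integral>z. f z \<partial>M\<bar> \<le> (\<integral>\<^sup>+z. ennreal \<bar>f z\<bar> \<partial>M)"
proof (cases "integrable M f")
  case True
  then show ?thesis using integral_norm_bound_ennreal[OF True] by simp
next
  case False
  then show ?thesis by (simp add: not_integrable_integral_eq)
qed

lemma Cauchy_Schwarz_integral:
  fixes f g :: "'a \<Rightarrow> real"
  assumes [measurable]: "f \<in> borel_measurable M" "g \<in> borel_measurable M"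
    and f2: "integrable M (\<lambda>z. (f z)\<^sup>2)" and g2: "integrable M (\<lambda>z. (g z)\<^sup>2)"
  shows "(\<integral>z. f z * g z \<partial>M) \<le> sqrt (\<integral>z. (f z)\<^sup>2 \<partial>M) * sqrt (\<integral>z. (g z)\<^sup>2 \<partial>M)"
proof -
  let ?F = "\<integral>z. (f z)\<^sup>2 \<partial>M" and ?G = "\<integral>z. (g z)\<^sup>2 \<partial>M"
  have sq: "(\<integral>\<^sup>+z. (ennreal \<bar>f z\<bar>)\<^sup>2 \<partial>M) = ennreal (\<integral>z. (f z)\<^sup>2 \<partial>M)"
    if "integrable M (\<lambda>z. (f z)\<^sup>2)" for f
    using nn_integral_eq_integral[OF that] by (simp add: ennreal_power)
  have "(ennreal \<bar>\<integral>z. f z * g z \<partial>M\<bar>)\<^sup>2 \<le> (\<integral>\<^sup>+z. ennreal \<bar>f z\<bar> * ennreal \<bar>g z\<bar> \<partial>M)\<^sup>2"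
    using ennreal_abs_integral_le[of M "\<lambda>z. f z * g z"]
    by (intro power_mono) (simp_all add: abs_mult ennreal_mult)
  also have "\<dots> \<le> (\<integral>\<^sup>+z. (ennreal \<bar>f z\<bar>)\<^sup>2 \<partial>M) * (\<integral>\<^sup>+z. (ennreal \<bar>g z\<bar>)\<^sup>2 \<partial>M)"
    by (rule Cauchy_Schwarz_nn_integral) measurable
  also have "\<dots> = ennreal (?F * ?G)"
    by (simp add: sq f2 g2 ennreal_mult)
  finally have "(\<integral>z. f z * g z \<partial>M)\<^sup>2 \<le> ?F * ?G"
    by (simp add: ennreal_power)
  then have "\<bar>\<integral>z. f z * g z \<partial>M\<bar> \<le> sqrt (?F * ?G)"
    by (rule real_le_rsqrt[of "\<bar>_\<bar>", unfolded power2_abs])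
  then show ?thesis by (simp add: real_sqrt_mult)
qed

lemma integral_add_sum:
  fixes f :: "'a \<Rightarrow> real"
  assumes "integrable M f" "\<And>i. i \<in> I \<Longrightarrow> integrable M (g i)"
  shows "(\<integral>z. f z + (\<Sum>i\<in>I. g i z) \<partial>M) = (\<integral>z. f z \<partial>M) + (\<Sum>i\<in>I. \<integral>z. g i z \<partial>M)"
  using assms by simp

section \<open>Differentiation under the integral and integration by parts\<close>

text \<open>Dominated convergence for the difference quotients, which the mean value inequality bounds by the
dominating function of the derivatives.\<close>

lemma has_derivative_integral_dominated:
  fixes f :: "'a::euclidean_space \<Rightarrow> 'b \<Rightarrow> real"
  assumes r: "r > 0"
    and int: "\<And>x. x \<in> ball x0 r \<Longrightarrow> integrable M (f x)"
    and der: "\<And>x z. x \<in> ball x0 r \<Longrightarrow> ((\<lambda>x. f x z) has_derivative f' x z) (at x)"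
    and bound: "\<And>x z e. x \<in> ball x0 r \<Longrightarrow> \<bar>f' x z e\<bar> \<le> w z * norm e"
    and w: "integrable M w"
    and meas: "\<And>e. (\<lambda>z. f' x0 z e) \<in> borel_measurable M"
  shows "((\<lambda>x. \<integral>z. f x z \<partial>M) has_derivative (\<lambda>e. \<integral>z. f' x0 z e \<partial>M)) (at x0)"
proof -
  have x0: "x0 \<in> ball x0 r" using r by simp
  have lin: "linear (f' x0 z)" for z
    using der[OF x0] has_derivative_linear by blast
  have intf': "integrable M (\<lambda>z. f' x0 z e)" for e
  proof (rule Bochner_Integration.integrable_bound)
    show "integrable M (\<lambda>z. w z * norm e)" using w by simp
    show "AE z in M. norm (f' x0 z e) \<le> norm (w z * norm e)"
      using bound[OF x0] by (auto intro!: always_eventually order_trans[OF _ abs_ge_self])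
  qed (rule meas)
  have "bounded_linear (\<lambda>e. \<integral>z. f' x0 z e \<partial>M)"
    by (intro linear_conv_bounded_linear[THEN iffD1] linearI)
       (simp_all add: linear_add[OF lin] linear_scale[OF lin] intf')
  moreover have "((\<lambda>x. norm ((\<integral>z. f x z \<partial>M) - (\<integral>z. f x0 z \<partial>M) - (\<integral>z. f' x0 z (x - x0) \<partial>M)) / norm (x - x0))
      \<longlongrightarrow> 0) (at x0)"
    unfolding tendsto_at_iff_sequentially
  proof (intro allI impI)
    fix X :: "nat \<Rightarrow> 'a" assume X: "\<forall>i. X i \<in> UNIV - {x0}" "X \<longlonglongrightarrow> x0"
    define q where "q i z = (f (X i) z - f x0 z - f' x0 z (X i - x0)) / norm (X i - x0)" for i z
    have ev: "\<forall>\<^sub>F i in sequentially. X i \<in> ball x0 r"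
      using X(2) r by (metis centre_in_ball open_ball topological_tendstoD)
    then obtain N where N: "\<And>i. i \<ge> N \<Longrightarrow> X i \<in> ball x0 r"
      unfolding eventually_sequentially by blast
    have qb: "\<bar>q (i + N) z\<bar> \<le> 2 * w z" for i z
    proof -
      let ?x = "X (i + N)"
      have x: "?x \<in> ball x0 r" using N by simp
      have "norm (f ?x z - f x0 z) \<le> w z * norm (?x - x0)"
      proof (rule differentiable_bound[where S="ball x0 r" and f'="\<lambda>x. f' x z"])
        fix y assume "y \<in> ball x0 r"
        then show "((\<lambda>x. f x z) has_derivative f' y z) (at y within ball x0 r)"
          using der has_derivative_at_withinI by blast
        show "onorm (f' y z) \<le> w z"
          using bound[OF \<open>y \<in> ball x0 r\<close>, of z] by (intro onorm_le) simp
      qed (use x x0 in auto)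
      then have "\<bar>f ?x z - f x0 z - f' x0 z (?x - x0)\<bar> \<le> 2 * w z * norm (?x - x0)"
        using bound[OF x0, of z "?x - x0"] by simp
      moreover have "norm (?x - x0) > 0" using X(1) by simp
      ultimately show ?thesis
        unfolding q_def by (simp add: divide_le_eq)
    qed
    have qint: "integrable M (q (i + N))" for i
      unfolding q_def using int[OF N[of "i + N"]] int[OF x0] intf' by simp
    have "(\<lambda>i. \<integral>z. q (i + N) z \<partial>M) \<longlonglongrightarrow> (\<integral>z. 0 \<partial>M)"
    proof (rule integral_dominated_convergence[where w="\<lambda>z. 2 * w z"])
      show "AE z in M. (\<lambda>i. q (i + N) z) \<longlonglongrightarrow> 0"
      proof (intro always_eventually allI)
        fix z
        have "((\<lambda>x. norm (f x z - f x0 z - f' x0 z (x - x0)) / norm (x - x0)) \<longlongrightarrow> 0) (at x0)"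
          using der[OF x0, of z] unfolding has_derivative_iff_norm by blast
        then have "((\<lambda>x. norm (f x z - f x0 z - f' x0 z (x - x0)) / norm (x - x0)) \<circ> X) \<longlonglongrightarrow> 0"
          using X unfolding tendsto_at_iff_sequentially by blast
        then have "(\<lambda>i. norm (q i z)) \<longlonglongrightarrow> 0"
          by (simp add: q_def o_def)
        then show "(\<lambda>i. q (i + N) z) \<longlonglongrightarrow> 0"
          using tendsto_norm_zero_iff LIMSEQ_ignore_initial_segment by blast
      qed
      show "AE z in M. norm (q (i + N) z) \<le> 2 * w z" for i
        using qb by (auto intro!: always_eventually)
    qed (use w qint in \<open>auto intro: borel_measurable_integrable\<close>)
    then have lim: "(\<lambda>i. \<bar>\<integral>z. q (i + N) z \<partial>M\<bar>) \<longlonglongrightarrow> 0"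
      by (simp add: tendsto_rabs_zero_iff)
    have "(\<lambda>i. ((\<lambda>x. norm ((\<integral>z. f x z \<partial>M) - (\<integral>z. f x0 z \<partial>M) - (\<integral>z. f' x0 z (x - x0) \<partial>M))
            / norm (x - x0)) \<circ> X) (i + N)) \<longlonglongrightarrow> 0"
    proof (rule Lim_transform_eventually[OF lim], intro always_eventually allI)
      fix i
      have "(\<integral>z. q (i + N) z \<partial>M) =
        ((\<integral>z. f (X (i + N)) z \<partial>M) - (\<integral>z. f x0 z \<partial>M) - (\<integral>z. f' x0 z (X (i + N) - x0) \<partial>M)) / norm (X (i + N) - x0)"
        unfolding q_def using int[OF N[of "i + N"]] int[OF x0] intf' by simp
      then show "\<bar>\<integral>z. q (i + N) z \<partial>M\<bar> = ((\<lambda>x. norm ((\<integral>z. f x z \<partial>M) - (\<integral>z. f x0 z \<partial>M) - (\<integral>z. f' x0 z (x - x0) \<partial>M))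
            / norm (x - x0)) \<circ> X) (i + N)"
        by simp
    qed
    then show "((\<lambda>x. norm ((\<integral>z. f x z \<partial>M) - (\<integral>z. f x0 z \<partial>M) - (\<integral>z. f' x0 z (x - x0) \<partial>M))
            / norm (x - x0)) \<circ> X) \<longlonglongrightarrow> 0"
      by (rule LIMSEQ_offset)
  qed
  ultimately show ?thesis by (simp add: has_derivative_iff_norm)
qed

text \<open>By translation invariance the integral of \<open>F(h e + z)\<close> over \<open>z\<close> does not depend on \<open>h\<close>;
differentiate it at \<open>h = 0\<close>.\<close>

lemma integral_derivative_compact_support_zero:
  fixes F :: "'a::euclidean_space \<Rightarrow> real"
  assumes der: "\<And>z. (F has_derivative F' z) (at z)"
    and cont: "continuous_on UNIV (\<lambda>z. F' z e)"
    and supp: "\<And>z. norm z > R \<Longrightarrow> F z = 0"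
  shows "(LBINT z. F' z e) = 0"
proof -
  have lin: "linear (F' z)" for z using der has_derivative_linear by blast
  have F'0: "F' z e = 0" if "norm z > R" for z
  proof -
    have "((\<lambda>_. 0::real) has_derivative (\<lambda>_. 0)) (at z)" by simp
    then have "(F has_derivative (\<lambda>_. 0)) (at z)"
      by (rule has_derivative_transform_within_open[of _ _ _ _ "- cball 0 R"])
         (use supp that in auto)
    then show ?thesis using der has_derivative_unique by metis
  qed
  have "bounded ((\<lambda>z. F' z e) ` cball 0 R)"
    by (intro compact_imp_bounded compact_continuous_image compact_cball continuous_on_subset[OF cont]) auto
  then obtain C where C: "\<And>z. norm z \<le> R \<Longrightarrow> \<bar>F' z e\<bar> \<le> C"
    unfolding bounded_iff by fastforce
  have C': "\<bar>F' z e\<bar> \<le> \<bar>C\<bar> * indicator (cball 0 R) z" for z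
    using C[of z] F'0[of z] by (cases "norm z \<le> R") (auto simp: indicator_def)
  have contF: "continuous_on UNIV F"
    by (intro continuous_at_imp_continuous_on ballI has_derivative_continuous[OF der])
  have intF: "integrable lborel (\<lambda>z. F (h *\<^sub>R e + z))" for h
  proof (rule bdd_borel_integrable)
    have "bdd_borel (\<lambda>z. indicator (cball 0 (R + norm (h *\<^sub>R e))) z * F (h *\<^sub>R e + z))"
      by (intro bdd_borel_indicator_continuous compact_cball continuous_on_compose2[OF contF])
         (auto intro!: continuous_intros)
    moreover have "indicator (cball 0 (R + norm (h *\<^sub>R e))) z * F (h *\<^sub>R e + z) = F (h *\<^sub>R e + z)" for z
    proof (cases "norm z \<le> R + norm (h *\<^sub>R e)")
      case False
      then have "norm (h *\<^sub>R e + z) > R"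
        using norm_triangle_ineq2[of z "- (h *\<^sub>R e)"] by (simp add: add.commute)
      then show ?thesis using supp by simp
    qed simp
    ultimately show "bdd_borel (\<lambda>z. F (h *\<^sub>R e + z))" by (simp only:)
  qed
  have "((\<lambda>h. \<integral>z. F (h *\<^sub>R e + z) \<partial>lborel) has_derivative
      (\<lambda>k. \<integral>z. k * F' (0 *\<^sub>R e + z) e \<partial>lborel)) (at 0)"
  proof (rule has_derivative_integral_dominated[where r=1 and f'="\<lambda>h z k. k * F' (h *\<^sub>R e + z) e"
        and w="\<lambda>z. \<bar>C\<bar> * indicator (cball 0 (R + norm e)) z"])
    fix h :: real and z k assume h: "h \<in> ball 0 1"
    have "((\<lambda>h. F (h *\<^sub>R e + z)) has_derivative (\<lambda>k. F' (h *\<^sub>R e + z) (k *\<^sub>R e))) (at h)"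
      by (rule has_derivative_compose[OF _ der, unfolded o_def]) (auto intro!: derivative_eq_intros)
    then show "((\<lambda>h. F (h *\<^sub>R e + z)) has_derivative (\<lambda>k. k * F' (h *\<^sub>R e + z) e)) (at h)"
      by (simp add: linear_scale[OF lin])
    have "indicator (cball 0 R) (h *\<^sub>R e + z) \<le> (indicator (cball 0 (R + norm e)) z :: real)"
    proof (cases "norm (h *\<^sub>R e + z) \<le> R")
      case True
      have "norm (h *\<^sub>R e) \<le> norm e" using h by (simp add: mult_left_le_one_le)
      then have "norm z \<le> R + norm e"
        using True norm_triangle_ineq2[of z "- (h *\<^sub>R e)"] by (simp add: add.commute)
      then show ?thesis using True by simp
    qed (simp add: indicator_def)
    then have "\<bar>F' (h *\<^sub>R e + z) e\<bar> \<le> \<bar>C\<bar> * indicator (cball 0 (R + norm e)) z"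
      using C'[of "h *\<^sub>R e + z"] by (meson abs_ge_zero mult_left_mono order_trans)
    then show "\<bar>k * F' (h *\<^sub>R e + z) e\<bar> \<le> \<bar>C\<bar> * indicator (cball 0 (R + norm e)) z * norm k"
      by (simp add: abs_mult mult.commute mult_left_mono)
  next
    show "integrable lborel (\<lambda>z. \<bar>C\<bar> * indicator (cball 0 (R + norm e)) z)"
      by (intro integrable_mult_right integrable_real_indicator emeasure_bounded_finite bounded_cball) simp
    show "(\<lambda>z. k * F' (0 *\<^sub>R e + z) e) \<in> borel_measurable lborel" for k
      using borel_measurable_continuous_onI[OF cont] by simp
  qed (use intF in auto)
  moreover have "(LBINT z. F (h *\<^sub>R e + z)) = (LBINT z. F z)" for h
  proof -
    have "(LBINT z. F z) = (\<integral>z. F z \<partial>distr lborel borel ((+) (h *\<^sub>R e)))"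
      by (simp add: lborel_distr_plus)
    also have "\<dots> = (LBINT z. F (h *\<^sub>R e + z))"
      by (rule integral_distr) (use borel_measurable_continuous_onI[OF contF] in simp_all)
    finally show ?thesis by simp
  qed
  ultimately have "((\<lambda>h::real. \<integral>z. F z \<partial>lborel) has_derivative (\<lambda>k. k * (LBINT z. F' z e))) (at 0)"
    by simp
  then have "(\<lambda>k::real. k * (LBINT z. F' z e)) = (\<lambda>k. 0)"
    using has_derivative_unique has_derivative_const by metis
  then show ?thesis by (metis mult_1)
qed

lemma smooth_on_set_obtains:
  assumes "smooth_on_set u D"
  obtains U where "open U" "D \<subseteq> U"
    "\<And>z. z \<in> U \<Longrightarrow> (u has_derivative (\<lambda>e. deriv_along e u z)) (at z)"
    "continuous_on U u" "\<And>e. continuous_on U (deriv_along e u)"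
proof -
  obtain U where U: "open U" "D \<subseteq> U" and Ck: "\<And>k. Ck_on k u U"
    using assms unfolding smooth_on_set_def by blast
  have diff: "u differentiable_on U" using Ck[of 1] by simp
  show ?thesis
  proof (rule that[OF U])
    show "(u has_derivative (\<lambda>e. deriv_along e u z)) (at z)" if "z \<in> U" for z
      using diff U(1) that by (metis differentiable_on_def at_within_open frechet_derivative_works)
    show "continuous_on U u" using Ck[of 0] by simp
    show "continuous_on U (deriv_along e u)" for e using Ck[of 1] by simp
  qed
qed

text \<open>The function \<open>u\<close> is smooth near \<open>E\<close> only, but its product with a test function supported in \<open>E\<close> is
differentiable everywhere, with derivative zero off \<open>E\<close>.\<close>

lemma integration_by_parts:
  fixes u \<theta> :: "'a::euclidean_space \<Rightarrow> real"
  assumes u: "smooth_on_set u E" and E: "compact E"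
    and \<theta>: "smooth_on_set \<theta> UNIV" and supp: "\<And>z. z \<notin> E \<Longrightarrow> \<theta> z = 0"
  shows "(LBINT z. indicator E z * u z * deriv_along e \<theta> z) =
     - (LBINT z. indicator E z * deriv_along e u z * \<theta> z)"
proof -
  obtain U where U: "open U" "E \<subseteq> U"
    and du: "\<And>z. z \<in> U \<Longrightarrow> (u has_derivative (\<lambda>e. deriv_along e u z)) (at z)"
    and cu: "continuous_on U u" and cdu: "\<And>e. continuous_on U (deriv_along e u)"
    using smooth_on_set_obtains[OF u] by metis
  have d\<theta>: "(\<theta> has_derivative (\<lambda>e. deriv_along e \<theta> z)) (at z)"
    and c\<theta>: "continuous_on S \<theta>" and cd\<theta>: "continuous_on S (deriv_along e \<theta>)" for z e S
    using smooth_on_set_obtains[OF \<theta>] by (metis UNIV_I subset_UNIV continuous_on_subset subsetD)+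
  have cE: "closed E" using E compact_imp_closed by blast
  have supp': "deriv_along e \<theta> z = 0" if "z \<notin> E" for e z
    using deriv_along_outside_support[OF cE supp that] .
  \<comment> \<open>off the domain of smoothness of \<open>u\<close> its derivative is an arbitrary value, which the factor \<open>\<theta> z = 0\<close> cancels\<close>
  define G where "G z e = u z * deriv_along e \<theta> z + deriv_along e u z * \<theta> z" for z e
  have G0: "G z e = 0" if "z \<notin> E" for z e
    using that supp supp' by (simp add: G_def)
  obtain R where R: "\<And>z. z \<in> E \<Longrightarrow> norm z \<le> R"
    using compact_imp_bounded[OF E] unfolding bounded_iff by blast
  have "(LBINT z. G z e) = 0"
  proof (rule integral_derivative_compact_support_zero[where F="\<lambda>z. u z * \<theta> z" and R=R])
    fix z
    show "((\<lambda>z. u z * \<theta> z) has_derivative G z) (at z)"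
    proof (cases "z \<in> U")
      case True
      show ?thesis unfolding G_def
        by (rule has_derivative_mult[OF du[OF True] d\<theta>])
    next
      case False
      then have "z \<notin> E" using U by blast
      have "((\<lambda>_. 0::real) has_derivative (\<lambda>_. 0)) (at z)" by simp
      then have "((\<lambda>z. u z * \<theta> z) has_derivative (\<lambda>_. 0)) (at z)"
        by (rule has_derivative_transform_within_open[of _ _ _ _ "- E"])
           (use supp cE \<open>z \<notin> E\<close> in auto)
      then show ?thesis using G0[OF \<open>z \<notin> E\<close>] by presburger
    qed
  next
    have "continuous_on U (\<lambda>z. G z e)" unfolding G_def
      by (intro continuous_intros cu cdu c\<theta> cd\<theta>)
    moreover have "continuous_on (- E) (\<lambda>z. G z e)"
      by (rule continuous_on_cong[THEN iffD1, OF refl _ continuous_on_const[of _ 0]]) (simp add: G0)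
    ultimately have "continuous_on (U \<union> - E) (\<lambda>z. G z e)"
      using U(1) cE by (intro continuous_on_open_Un) auto
    then show "continuous_on UNIV (\<lambda>z. G z e)"
      using U(2) by (metis Un_commute double_compl sup.absorb_iff2 sup_shunt)
  next
    show "u z * \<theta> z = 0" if "norm z > R" for z
      using R[of z] supp[of z] that by force
  qed
  moreover have "bdd_borel (\<lambda>z. indicator E z * (u z * deriv_along e \<theta> z))"
    "bdd_borel (\<lambda>z. indicator E z * (deriv_along e u z * \<theta> z))"
    by (intro bdd_borel_indicator_continuous E continuous_intros continuous_on_subset[OF cu]
        continuous_on_subset[OF cdu] U c\<theta> cd\<theta>)+
  then have "(LBINT z. indicator E z * (u z * deriv_along e \<theta> z) + indicator E z * (deriv_along e u z * \<theta> z))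
     = (LBINT z. indicator E z * (u z * deriv_along e \<theta> z))
       + (LBINT z. indicator E z * (deriv_along e u z * \<theta> z))"
    by (intro Bochner_Integration.integral_add bdd_borel_integrable)
  moreover have "(LBINT z. indicator E z * (u z * deriv_along e \<theta> z) + indicator E z * (deriv_along e u z * \<theta> z))
     = (LBINT z. G z e)"
    by (rule Bochner_Integration.integral_cong) (auto simp: G_def indicator_def supp supp')
  ultimately show ?thesis by (simp add: mult.assoc)
qed

lemma elem_smooth_deriv_fst:
  assumes "elem_smooth \<Phi>"
  shows "((\<lambda>y. \<Phi> (y, z)) has_derivative (\<lambda>e. deriv_along (e, 0) \<Phi> (y, z))) (at y)"
proof -
  have "((\<lambda>y. (y, z)) has_derivative (\<lambda>e. (e, 0))) (at y)"
    by (auto intro!: derivative_eq_intros)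
  from has_derivative_compose[OF this elem_smooth_has_derivative[OF assms]] show ?thesis .
qed

text \<open>The kernel has continuous derivatives and the support of \<open>G\<close> is bounded, so the derivatives in \<open>y\<close>
are bounded for \<open>y\<close> near a given point and \<open>z\<close> in the support.\<close>

lemma has_derivative_kernel_integral:
  fixes \<Phi> :: "'a::euclidean_space \<times> 'b::euclidean_space \<Rightarrow> real"
  assumes G: "bdd_borel G" and \<Phi>: "elem_smooth \<Phi>"
  shows "((\<lambda>y. \<integral>z. G z * \<Phi> (y, z) \<partial>lborel) has_derivative
     (\<lambda>e. \<integral>z. G z * deriv_along (e, 0) \<Phi> (y, z) \<partial>lborel)) (at y)"
proof -
  have cD: "continuous_on S (deriv_along e \<Phi>)" for e S
    by (intro elem_smooth_continuous elem_smooth_deriv_along \<Phi>)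
  obtain S where S: "\<And>z. G z \<noteq> 0 \<Longrightarrow> norm z \<le> S"
    using G unfolding bdd_borel_def by blast
  have "\<exists>C. \<forall>y'\<in>cball y 1. \<forall>z\<in>cball 0 S. \<bar>deriv_along (b, 0) \<Phi> (y', z)\<bar> \<le> C" for b
  proof -
    have "bounded (deriv_along (b, 0) \<Phi> ` (cball y 1 \<times> cball 0 S))"
      by (intro compact_imp_bounded compact_continuous_image compact_Times compact_cball cD)
    then show ?thesis unfolding bounded_iff by (auto simp: image_iff)
  qed
  then obtain C where C: "\<And>b y' z. y' \<in> cball y 1 \<Longrightarrow> z \<in> cball 0 S \<Longrightarrow> \<bar>deriv_along (b, 0) \<Phi> (y', z)\<bar> \<le> C b"
    by metis
  define K where "K = (\<Sum>b\<in>Basis. C b)"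
  have K: "\<bar>deriv_along (e, 0) \<Phi> (y', z)\<bar> \<le> K * norm e" if "y' \<in> cball y 1" "z \<in> cball 0 S" for y' z e
  proof -
    have lin: "linear (\<lambda>e. deriv_along (e, 0) \<Phi> (y', z))"
      using elem_smooth_deriv_fst[OF \<Phi>] has_derivative_linear by blast
    have "deriv_along (e, 0) \<Phi> (y', z) = deriv_along ((\<Sum>b\<in>Basis. (e \<bullet> b) *\<^sub>R b), 0) \<Phi> (y', z)"
      by (simp add: euclidean_representation)
    also have "\<dots> = (\<Sum>b\<in>Basis. (e \<bullet> b) * deriv_along (b, 0) \<Phi> (y', z))"
      by (simp add: linear_sum[OF lin] linear_scale[OF lin])
    also have "\<bar>\<dots>\<bar> \<le> (\<Sum>b\<in>Basis. \<bar>(e \<bullet> b) * deriv_along (b, 0) \<Phi> (y', z)\<bar>)"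
      by (rule sum_abs)
    also have "\<dots> \<le> (\<Sum>b\<in>Basis. norm e * C b)"
      unfolding abs_mult by (intro sum_mono mult_mono C that Basis_le_norm) auto
    finally show ?thesis by (simp add: K_def sum_distrib_left mult.commute)
  qed
  show ?thesis
  proof (rule has_derivative_integral_dominated[where r=1 and w="\<lambda>z. \<bar>G z\<bar> * K"])
    show "integrable lborel (\<lambda>z. G z * \<Phi> (y, z))" for y
      by (intro bdd_borel_integrable bdd_borel_mult_continuous[OF G]
          continuous_on_compose2[OF elem_smooth_continuous[OF \<Phi>, of UNIV]]) (auto intro!: continuous_intros)
    show "((\<lambda>y. G z * \<Phi> (y, z)) has_derivative (\<lambda>e. G z * deriv_along (e, 0) \<Phi> (y, z))) (at y)" for y z
      by (intro has_derivative_mult_right elem_smooth_deriv_fst[OF \<Phi>])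
    show "\<bar>G z * deriv_along (e, 0) \<Phi> (x, z)\<bar> \<le> \<bar>G z\<bar> * K * norm e" if "x \<in> ball y 1" for x z e
    proof (cases "G z = 0")
      case False
      then show ?thesis using K[of x z e] S[of z] that by (simp add: abs_mult mult.assoc)
    qed simp
    show "integrable lborel (\<lambda>z. \<bar>G z\<bar> * K)"
      using bdd_borel_integrable[OF G] by simp
    have "continuous_on UNIV (\<lambda>z. deriv_along (e, 0) \<Phi> (y, z))" for e
      by (intro continuous_on_compose2[OF cD[of UNIV]]) (auto intro!: continuous_intros)
    then show "(\<lambda>z. G z * deriv_along (e, 0) \<Phi> (y, z)) \<in> borel_measurable lborel" for e
      using borel_measurable_times[OF bdd_borel_measurable[OF G] borel_measurable_continuous_onI] by simp
  qed simp
qed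

text \<open>Differentiating such an integral gives another one, whose kernel is a derivative of the first.\<close>

lemma smooth_kernel_integral:
  assumes G: "bdd_borel G" and \<Phi>: "elem_smooth \<Phi>"
  shows "smooth_on_set (\<lambda>y. \<integral>z. G z * \<Phi> (y, z) \<partial>lborel) D"
proof -
  let ?P = "\<lambda>f. \<exists>\<Phi>. elem_smooth \<Phi> \<and> f = (\<lambda>y. \<integral>z. G z * \<Phi> (y, z) \<partial>lborel)"
  have "Ck_on k (\<lambda>y. \<integral>z. G z * \<Phi> (y, z) \<partial>lborel) UNIV" for k
  proof (rule Ck_on_coinduct[where P="?P"])
    show "f differentiable_on UNIV" if "?P f" for f
      using that has_derivative_kernel_integral[OF G]
      by (auto simp: differentiable_on_def differentiable_def)
    show "?P (deriv_along e f)" if Pf: "?P f" for f e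
    proof -
      obtain \<Phi> where \<Phi>: "elem_smooth \<Phi>" "f = (\<lambda>y. \<integral>z. G z * \<Phi> (y, z) \<partial>lborel)"
        using Pf by blast
      have "deriv_along e f = (\<lambda>y. \<integral>z. G z * deriv_along (e, 0) \<Phi> (y, z) \<partial>lborel)"
        unfolding \<Phi>(2) by (rule ext, rule deriv_along_eqI, rule has_derivative_kernel_integral[OF G \<Phi>(1)])
      then show ?thesis using elem_smooth_deriv_along[OF \<Phi>(1)] by blast
    qed
  qed (use \<Phi> in blast)
  then show ?thesis unfolding smooth_on_set_def by blast
qed

section \<open>The relative position and its derivatives\<close>

text \<open>The point \<open>\<delta>\<^bsub>1/s\<^esub>(y\<^sup>-\<^sup>1 \<circ> z)\<close> in coordinates.\<close>

definition rel_pos :: "real \<Rightarrow> 'd::finite kpoint \<Rightarrow> 'd kpoint \<Rightarrow> 'd kpoint" where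
  "rel_pos s y z = ((fst z - fst y) / s ^ 2,
     (1 / s ^ 3) *\<^sub>R (fst (snd z) - fst (snd y) - (fst z - fst y) *\<^sub>R snd (snd y)),
     (1 / s) *\<^sub>R (snd (snd z) - snd (snd y)))"

text \<open>The homogeneous dimension: the dilation \<open>\<delta>\<^sub>s\<close> scales volume by \<open>s\<^sup>2\<close> from time, \<open>s\<^sup>3\<^sup>d\<close> from position
and \<open>s\<^sup>d\<close> from velocity.\<close>

definition hom_dim :: "'d::finite itself \<Rightarrow> nat" where
  "hom_dim _ = 4 * CARD('d) + 2"

lemma kin_comp_inv_rel_pos:
  assumes "s \<noteq> 0"
  shows "kin_comp z (kin_inv (dilation s (rel_pos s y z))) = y"
proof -
  obtain a b c a' b' c' where [simp]: "z = (a, b, c)" "y = (a', b', c')"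
    by (metis prod_cases3)
  have "dilation s (rel_pos s y z) = (a - a', b - b' - (a - a') *\<^sub>R c', c - c')"
    using assms by (simp add: rel_pos_def)
  then show ?thesis by (simp add: algebra_simps)
qed

lemma elem_smooth_rel_pos:
  fixes \<gamma> :: "'d::finite kpoint \<Rightarrow> real"
  assumes "elem_smooth \<gamma>"
  shows "elem_smooth (\<lambda>p. \<gamma> (rel_pos s (fst p) (snd p)))"
proof (rule elem_smooth_compose[OF assms])
  fix a :: "'d kpoint"
  obtain a1 a2 a3 where a: "a = (a1, a2, a3)" by (metis prod_cases3)
  have coord: "elem_smooth (\<lambda>p::'d kpoint \<times> 'd kpoint. fst (fst p))"
    "elem_smooth (\<lambda>p::'d kpoint \<times> 'd kpoint. fst (snd p))"
    "elem_smooth (\<lambda>p::'d kpoint \<times> 'd kpoint. fst (snd (fst p)) \<bullet> b)"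
    "elem_smooth (\<lambda>p::'d kpoint \<times> 'd kpoint. fst (snd (snd p)) \<bullet> b)"
    "elem_smooth (\<lambda>p::'d kpoint \<times> 'd kpoint. snd (snd (fst p)) \<bullet> b)"
    "elem_smooth (\<lambda>p::'d kpoint \<times> 'd kpoint. snd (snd (snd p)) \<bullet> b)" for b :: "real ^ 'd"
    using elem_smooth.inner[of "((1, 0, 0), 0) :: 'd kpoint \<times> 'd kpoint"]
      elem_smooth.inner[of "(0, (1, 0, 0)) :: 'd kpoint \<times> 'd kpoint"]
      elem_smooth.inner[of "((0, b, 0), 0) :: 'd kpoint \<times> 'd kpoint"]
      elem_smooth.inner[of "(0, (0, b, 0)) :: 'd kpoint \<times> 'd kpoint"]
      elem_smooth.inner[of "((0, 0, b), 0) :: 'd kpoint \<times> 'd kpoint"]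
      elem_smooth.inner[of "(0, (0, 0, b)) :: 'd kpoint \<times> 'd kpoint"]
    by (simp_all add: inner_prod_def)
  have "elem_smooth (\<lambda>p::'d kpoint \<times> 'd kpoint.
      (fst (snd p) - fst (fst p)) * (a1 / s ^ 2)
      + ((fst (snd (snd p)) \<bullet> a2 - fst (snd (fst p)) \<bullet> a2
          - (fst (snd p) - fst (fst p)) * (snd (snd (fst p)) \<bullet> a2)) * (1 / s ^ 3)
      + (snd (snd (snd p)) \<bullet> a3 - snd (snd (fst p)) \<bullet> a3) * (1 / s)))"
    by (intro elem_smooth.add elem_smooth.mult elem_smooth.const elem_smooth_diff coord)
  then show "elem_smooth (\<lambda>p. rel_pos s (fst p) (snd p) \<bullet> a)"
    by (simp add: a rel_pos_def inner_prod_def inner_diff_left inner_scaleR_left)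
qed

lemma rel_pos_kernel_measurable:
  assumes "elem_smooth \<gamma>"
  shows "(\<lambda>p. ennreal \<bar>\<gamma> (rel_pos s (fst p) (snd p))\<bar>) \<in> borel_measurable borel"
  using elem_smooth_measurable[OF elem_smooth_rel_pos[OF assms]] by measurable

lemma nn_integral_rel_pos:
  fixes f :: "'d::finite kpoint \<Rightarrow> ennreal"
  assumes [measurable]: "f \<in> borel_measurable borel" and s: "s > 0"
  shows "(\<integral>\<^sup>+y. f (rel_pos s y z) \<partial>lborel) = ennreal (s ^ hom_dim TYPE('d)) * integral\<^sup>N lborel f"
    and "(\<integral>\<^sup>+z. f (rel_pos s y z) \<partial>lborel) = ennreal (s ^ hom_dim TYPE('d)) * integral\<^sup>N lborel f"
proof -
  have pow: "1 / (\<bar>c1\<bar> * \<bar>c2\<bar> ^ CARD('d) * \<bar>c3\<bar> ^ CARD('d)) = s ^ hom_dim TYPE('d)"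
    if "\<bar>c1\<bar> = 1 / s ^ 2" "\<bar>c2\<bar> = 1 / s ^ 3" "\<bar>c3\<bar> = 1 / s" for c1 c2 c3 :: real
    using s that by (simp add: hom_dim_def power_one_over power_add power_mult[symmetric])
      (simp add: power_add[symmetric])
  have "rel_pos s y z = (fst z / s ^ 2 + (- 1 / s ^ 2) * fst y,
      (1 / s ^ 3) *\<^sub>R (fst (snd z) - (fst z - fst y) *\<^sub>R snd (snd y)) + (- 1 / s ^ 3) *\<^sub>R fst (snd y),
      (1 / s) *\<^sub>R snd (snd z) + (- 1 / s) *\<^sub>R snd (snd y))" for y
    by (simp add: rel_pos_def diff_divide_distrib algebra_simps)
  moreover have "(\<lambda>p::real \<times> (real ^ 'd). (1 / s ^ 3) *\<^sub>R (fst (snd z) - (fst z - fst p) *\<^sub>R snd p)) \<in> borel_measurable borel"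
    by measurable
  ultimately show "(\<integral>\<^sup>+y. f (rel_pos s y z) \<partial>lborel) = ennreal (s ^ hom_dim TYPE('d)) * integral\<^sup>N lborel f"
    using nn_integral_triangular_affine[of f
      "\<lambda>t v. (1 / s ^ 3) *\<^sub>R (fst (snd z) - (fst z - t) *\<^sub>R v)" "- 1 / s ^ 2" "- 1 / s ^ 3" "- 1 / s"
      "fst z / s ^ 2" "(1 / s) *\<^sub>R snd (snd z)"] s
      pow[of "- 1 / s ^ 2" "- 1 / s ^ 3" "- 1 / s"]
    by simp
  have "rel_pos s y z = (- fst y / s ^ 2 + (1 / s ^ 2) * fst z,
      - ((1 / s ^ 3) *\<^sub>R (fst (snd y) + (fst z - fst y) *\<^sub>R snd (snd y))) + (1 / s ^ 3) *\<^sub>R fst (snd z),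
      - ((1 / s) *\<^sub>R snd (snd y)) + (1 / s) *\<^sub>R snd (snd z))" for z
    by (simp add: rel_pos_def diff_divide_distrib algebra_simps)
  moreover have "(\<lambda>p::real \<times> (real ^ 'd). - ((1 / s ^ 3) *\<^sub>R (fst (snd y) + (fst p - fst y) *\<^sub>R snd (snd y)))) \<in> borel_measurable borel"
    by measurable
  ultimately show "(\<integral>\<^sup>+z. f (rel_pos s y z) \<partial>lborel) = ennreal (s ^ hom_dim TYPE('d)) * integral\<^sup>N lborel f"
    using nn_integral_triangular_affine[of f
      "\<lambda>t v. - ((1 / s ^ 3) *\<^sub>R (fst (snd y) + (t - fst y) *\<^sub>R snd (snd y)))" "1 / s ^ 2" "1 / s ^ 3" "1 / s"
      "- fst y / s ^ 2" "- ((1 / s) *\<^sub>R snd (snd y))"] s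
      pow[of "1 / s ^ 2" "1 / s ^ 3" "1 / s"]
    by simp
qed

lemma has_derivative_rel_pos_source:
  assumes s: "s \<noteq> 0"
  shows "((\<lambda>y. rel_pos s y z) has_derivative
     (\<lambda>e. (- fst e / s ^ 2,
           (1 / s ^ 3) *\<^sub>R (- fst (snd e) + fst e *\<^sub>R snd (snd y) - (fst z - fst y) *\<^sub>R snd (snd e)),
           - ((1 / s) *\<^sub>R snd (snd e))))) (at y)"
proof -
  have eq: "(\<lambda>y. rel_pos s y z) = (\<lambda>y. ((1 / s ^ 2) * (fst z - fst y),
     (1 / s ^ 3) *\<^sub>R (fst (snd z) - fst (snd y) - (fst z - fst y) *\<^sub>R snd (snd y)),
     (1 / s) *\<^sub>R (snd (snd z) - snd (snd y))))"
    by (simp add: rel_pos_def)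
  have D: "((\<lambda>y. (A * (fst z - fst y),
     B *\<^sub>R (fst (snd z) - fst (snd y) - (fst z - fst y) *\<^sub>R snd (snd y)),
     C *\<^sub>R (snd (snd z) - snd (snd y)))) has_derivative (\<lambda>e. (A * (- fst e),
           B *\<^sub>R (- fst (snd e) + fst e *\<^sub>R snd (snd y) - (fst z - fst y) *\<^sub>R snd (snd e)),
           C *\<^sub>R (- snd (snd e))))) (at y)" for A B C :: real
    by (auto intro!: derivative_eq_intros simp: algebra_simps)
  show ?thesis
    using D[of "1 / s ^ 2" "1 / s ^ 3" "1 / s"] unfolding eq by simp
qed

text \<open>The fields \<open>Y\<close> and \<open>\<nabla>\<^sub>v\<close> are left invariant, and inversion of the argument turns them into right
invariant fields: in the variable \<open>y\<^sup>-\<^sup>1 \<circ> z\<close> they are, up to sign, \<open>\<partial>\<^sub>t\<close> and \<open>\<partial>\<^sub>v + t \<partial>\<^sub>x\<close>, of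
degrees two and one under dilation.\<close>

lemma deriv_along_rel_pos:
  fixes \<gamma> :: "'d::finite kpoint \<Rightarrow> real"
  assumes \<gamma>: "elem_smooth \<gamma>" and s: "s \<noteq> 0"
  shows deriv_along_rel_pos_transport:
      "deriv_along ((1, snd (snd y), 0), 0) (\<lambda>p. \<gamma> (rel_pos s (fst p) (snd p))) (y, z) =
        - (1 / s ^ 2) * deriv_along (1, 0, 0) \<gamma> (rel_pos s y z)"
    and deriv_along_rel_pos_velocity:
      "deriv_along ((0, 0, e), 0) (\<lambda>p. \<gamma> (rel_pos s (fst p) (snd p))) (y, z) =
        - (1 / s) * deriv_along (0, fst (rel_pos s y z) *\<^sub>R e, e) \<gamma> (rel_pos s y z)"
proof -
  let ?D = "\<lambda>e. (- fst e / s ^ 2,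
           (1 / s ^ 3) *\<^sub>R (- fst (snd e) + fst e *\<^sub>R snd (snd y) - (fst z - fst y) *\<^sub>R snd (snd e)),
           - ((1 / s) *\<^sub>R snd (snd e)))"
  have lin: "linear (\<lambda>e. deriv_along e \<gamma> w)" for w
    using elem_smooth_has_derivative[OF \<gamma>] has_derivative_linear by blast
  have eq: "deriv_along (a, 0) (\<lambda>p. \<gamma> (rel_pos s (fst p) (snd p))) (y, z) =
      deriv_along (?D a) \<gamma> (rel_pos s y z)" for a
  proof -
    have "((\<lambda>y. \<gamma> (rel_pos s y z)) has_derivative (\<lambda>a. deriv_along (?D a) \<gamma> (rel_pos s y z))) (at y)"
      by (rule has_derivative_compose[OF has_derivative_rel_pos_source[OF s] elem_smooth_has_derivative[OF \<gamma>]])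
    moreover have "((\<lambda>y. \<gamma> (rel_pos s y z)) has_derivative
        (\<lambda>a. deriv_along (a, 0) (\<lambda>p. \<gamma> (rel_pos s (fst p) (snd p))) (y, z))) (at y)"
      using elem_smooth_deriv_fst[OF elem_smooth_rel_pos[OF \<gamma>]] by simp
    ultimately show ?thesis by (rule has_derivative_unique[THEN fun_cong, symmetric])
  qed
  have "?D (1, snd (snd y), 0) = (- (1 / s ^ 2)) *\<^sub>R (1, 0, 0)"
    by simp
  then show "deriv_along ((1, snd (snd y), 0), 0) (\<lambda>p. \<gamma> (rel_pos s (fst p) (snd p))) (y, z) =
        - (1 / s ^ 2) * deriv_along (1, 0, 0) \<gamma> (rel_pos s y z)"
    unfolding eq by (simp only: linear_scale[OF lin] real_scaleR_def)
  have "?D (0, 0, e) = (- (1 / s)) *\<^sub>R (0, fst (rel_pos s y z) *\<^sub>R e, e)"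
    using s by (simp add: rel_pos_def power2_eq_square power3_eq_cube)
  then show "deriv_along ((0, 0, e), 0) (\<lambda>p. \<gamma> (rel_pos s (fst p) (snd p))) (y, z) =
        - (1 / s) * deriv_along (0, fst (rel_pos s y z) *\<^sub>R e, e) \<gamma> (rel_pos s y z)"
    unfolding eq by (simp only: linear_scale[OF lin] real_scaleR_def)
qed

lemma has_real_derivative_rel_pos_scale:
  fixes \<gamma> :: "'d::finite kpoint \<Rightarrow> real"
  assumes \<gamma>: "elem_smooth \<gamma>" and s: "s \<noteq> 0"
  shows "((\<lambda>s. \<gamma> (rel_pos s y z)) has_real_derivative
     - (1 / s) * deriv_along (2 * fst (rel_pos s y z), 3 *\<^sub>R fst (snd (rel_pos s y z)), snd (snd (rel_pos s y z)))
         \<gamma> (rel_pos s y z)) (at s)"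
proof -
  let ?w = "rel_pos s y z"
  let ?E = "(2 * fst ?w, 3 *\<^sub>R fst (snd ?w), snd (snd ?w))"
  define a where "a = fst z - fst y"
  define b where "b = fst (snd z) - fst (snd y) - a *\<^sub>R snd (snd y)"
  define c where "c = snd (snd z) - snd (snd y)"
  have rel: "rel_pos s y z = (a / s ^ 2, (1 / s ^ 3) *\<^sub>R b, (1 / s) *\<^sub>R c)" for s
    by (simp add: rel_pos_def a_def b_def c_def)
  have lin: "linear (\<lambda>e. deriv_along e \<gamma> w)" for w
    using elem_smooth_has_derivative[OF \<gamma>] has_derivative_linear by blast
  have p: "((\<lambda>s. 1 / s ^ 3) has_real_derivative - (3 / s ^ 4)) (at s)"
    "((\<lambda>s. 1 / s) has_real_derivative - (1 / s ^ 2)) (at s)"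
    "((\<lambda>s. a / s ^ 2) has_real_derivative - (2 * a / s ^ 3)) (at s)"
    using s by (auto intro!: derivative_eq_intros simp: field_simps power2_eq_square eval_nat_numeral)
  note p' = p[unfolded has_field_derivative_def]
  have "((\<lambda>s. rel_pos s y z) has_derivative (\<lambda>h. (h * (- (1 / s))) *\<^sub>R ?E)) (at s)"
    unfolding rel
    by (rule has_derivative_eq_rhs[OF has_derivative_Pair[OF p'(3)
          has_derivative_Pair[OF has_derivative_scaleR_left[OF p'(1)] has_derivative_scaleR_left[OF p'(2)]]]])
       (use s in \<open>auto simp: fun_eq_iff field_simps eval_nat_numeral\<close>)
  from has_derivative_compose[OF this elem_smooth_has_derivative[OF \<gamma>]]
  have "((\<lambda>s. \<gamma> (rel_pos s y z)) has_derivative (\<lambda>h. (h * (- (1 / s))) * deriv_along ?E \<gamma> ?w)) (at s)"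
    by (simp only: linear_scale[OF lin] real_scaleR_def)
  then show ?thesis
    unfolding has_field_derivative_def
    by (rule has_derivative_eq_rhs) (simp add: fun_eq_iff)
qed

section \<open>Bump functions and the divergence form of the scale derivative\<close>

lemma exists_bump:
  fixes B :: "'a::euclidean_space set"
  assumes "open B" "B \<noteq> {}"
  obtains \<phi> K where "elem_smooth \<phi>" "compact K" "K \<subseteq> B" "\<And>w. w \<notin> K \<Longrightarrow> \<phi> w = 0"
    "\<And>w. 0 \<le> \<phi> w" "(\<integral>\<^sup>+w. ennreal (\<phi> w) \<partial>lborel) = 1"
proof -
  obtain c r where r: "r > 0" "cball c r \<subseteq> B"
    using assms open_contains_cball by (metis ex_in_conv)
  define \<phi> where "\<phi> w = flat 0 (r\<^sup>2 - (\<Sum>b\<in>Basis. (w \<bullet> b - c \<bullet> b) * (w \<bullet> b - c \<bullet> b)))" for w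
  have sm: "elem_smooth \<phi>"
    unfolding \<phi>_def by (intro elem_smooth_intros)
  have \<phi>: "\<phi> w = flat 0 (r\<^sup>2 - (dist w c)\<^sup>2)" for w
    unfolding \<phi>_def dist_norm power2_norm_eq_inner
    by (subst (2) euclidean_inner) (simp add: inner_diff_left)
  have nonneg: "0 \<le> \<phi> w" for w by (simp add: \<phi> flat_def)
  have supp: "\<phi> w = 0" if "w \<notin> cball c r" for w
  proof -
    have "r\<^sup>2 \<le> (dist w c)\<^sup>2" using that r(1) by (intro power_mono) (auto simp: dist_commute)
    then show ?thesis by (simp add: \<phi> flat_def)
  qed
  define I where "I = (LBINT w. \<phi> w)"
  have bb: "bdd_borel \<phi>"
  proof -
    have "bdd_borel (\<lambda>w. indicator (cball c r) w * \<phi> w)"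
      by (intro bdd_borel_indicator_continuous compact_cball elem_smooth_continuous sm)
    moreover have "indicator (cball c r) w * \<phi> w = \<phi> w" for w
      using supp[of w] by (auto simp: indicator_def)
    ultimately show ?thesis by (simp only:)
  qed
  have int: "integrable lborel \<phi>" using bb by (rule bdd_borel_integrable)
  have "I \<ge> 0" unfolding I_def using nonneg by (intro Bochner_Integration.integral_nonneg)
  moreover have "I \<noteq> 0"
  proof
    assume "I = 0"
    then have "AE w in lborel. \<phi> w = 0"
      using integral_nonneg_eq_0_iff_AE[OF int] nonneg by (auto simp: I_def)
    moreover have "{w. \<phi> w \<noteq> 0} = ball c r"
      using r(1) by (auto simp: \<phi> flat_def dist_commute power2_less_imp_less abs_square_less_1
          intro!: power_strict_mono) 
    ultimately have "ball c r \<in> null_sets lborel"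
      by (simp add: AE_iff_null)
    then show False
      using r(1) unit_ball_vol_pos[of "real DIM('a)"] by (simp add: null_sets_def emeasure_ball)
  qed
  ultimately have I: "I > 0" by simp
  have "(\<integral>\<^sup>+w. ennreal (\<phi> w * (1 / I)) \<partial>lborel) = ennreal (LBINT w. \<phi> w * (1 / I))"
    using int nonneg I by (intro nn_integral_eq_integral integrable_mult_left always_eventually) auto
  also have "\<dots> = 1" using I by (simp add: I_def)
  finally have "(\<integral>\<^sup>+w. ennreal (\<phi> w * (1 / I)) \<partial>lborel) = 1" .
  then show ?thesis
    using r supp nonneg I sm
    by (intro that[of "\<lambda>w. \<phi> w * (1 / I)" "cball c r"] elem_smooth_intros) auto
qed

text \<open>The right invariant field \<open>(\<partial>\<^sub>v + t \<partial>\<^sub>x) \<cdot> e\<close> of the kinetic group.\<close>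

definition lifted_velocity :: "(real ^ 'd) \<Rightarrow> ('d::finite kpoint \<Rightarrow> real) \<Rightarrow> 'd kpoint \<Rightarrow> real" where
  "lifted_velocity e \<gamma> w = deriv_along (0, fst w *\<^sub>R e, e) \<gamma> w"

lemma elem_smooth_coordinates:
  "elem_smooth (\<lambda>w::'d::finite kpoint. fst w)"
  "elem_smooth (\<lambda>w::'d::finite kpoint. fst (snd w) $ i)"
  "elem_smooth (\<lambda>w::'d::finite kpoint. snd (snd w) $ i)"
  using elem_smooth.inner[of "(1, 0, 0) :: 'd kpoint"]
    elem_smooth.inner[of "(0, axis i 1, 0) :: 'd kpoint"]
    elem_smooth.inner[of "(0, 0, axis i 1) :: 'd kpoint"]
  by (simp_all add: inner_prod_def inner_axis)

lemma deriv_along_coordinates: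
  "deriv_along e (\<lambda>w::'d::finite kpoint. fst w) z = fst e"
  "deriv_along e (\<lambda>w::'d::finite kpoint. fst (snd w) $ i) z = fst (snd e) $ i"
  "deriv_along e (\<lambda>w::'d::finite kpoint. snd (snd w) $ i) z = snd (snd e) $ i"
  by (rule deriv_along_eqI, auto intro!: derivative_eq_intros bounded_linear.has_derivative[OF bounded_linear_vec_nth])+

lemma linear_kpoint_expand:
  fixes L :: "'d::finite kpoint \<Rightarrow> real"
  assumes "linear L"
  shows "L (a, b, c) = a * L (1, 0, 0) + (\<Sum>i\<in>UNIV. b $ i * L (0, axis i 1, 0)) + (\<Sum>i\<in>UNIV. c $ i * L (0, 0, axis i 1))"
proof -
  have "(a, b, c) = a *\<^sub>R (1, 0, 0) + (0, b, 0) + (0, 0, c)" by simp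
  also have "(0, b, 0) = (\<Sum>i\<in>UNIV. (b $ i) *\<^sub>R (0, axis i 1, 0 :: real ^ 'd))"
    by (rule prod_eqI) (simp_all add: fst_sum snd_sum basis_expansion[of b, unfolded scalar_mult_eq_scaleR] sum_prod prod_eq_iff)
  also have "(0, 0, c) = (\<Sum>i\<in>UNIV. (c $ i) *\<^sub>R (0 :: real, 0 :: real ^ 'd, axis i 1))"
    by (rule prod_eqI) (simp_all add: fst_sum snd_sum basis_expansion[of c, unfolded scalar_mult_eq_scaleR] sum_prod prod_eq_iff)
  finally show ?thesis
    by (simp only: linear_add[OF assms] linear_sum[OF assms] linear_scale[OF assms] real_scaleR_def)
qed

lemma elem_smooth_linear_deriv: "elem_smooth \<gamma> \<Longrightarrow> linear (\<lambda>e. deriv_along e \<gamma> w)"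
  using elem_smooth_has_derivative has_derivative_linear by blast

lemma lifted_velocity_axis:
  fixes \<gamma> :: "'d::finite kpoint \<Rightarrow> real"
  assumes "elem_smooth \<gamma>"
  shows "lifted_velocity (axis i 1) \<gamma> w =
    fst w * deriv_along (0, axis i 1, 0) \<gamma> w + deriv_along (0, 0, axis i 1) \<gamma> w"
proof -
  note lin = elem_smooth_linear_deriv[OF assms, of w]
  have "(0, fst w *\<^sub>R axis i 1, axis i 1) = fst w *\<^sub>R (0, axis i 1, 0) + ((0, 0, axis i 1) :: 'd kpoint)"
    by simp
  then show ?thesis
    unfolding lifted_velocity_def
    by (simp only: linear_add[OF lin] linear_scale[OF lin] real_scaleR_def)
qed

lemma elem_smooth_lifted_velocity:
  assumes "elem_smooth \<gamma>"
  shows "elem_smooth (lifted_velocity (axis i 1) \<gamma>)"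
  unfolding lifted_velocity_axis[OF assms, abs_def]
  by (intro elem_smooth_intros elem_smooth_coordinates elem_smooth_deriv_along assms)

locale mollifier =
  fixes \<phi> :: "'d::finite kpoint \<Rightarrow> real" and K :: "'d kpoint set"
  assumes smooth: "elem_smooth \<phi>"
    and compact_K: "compact K"
    and supp: "w \<notin> K \<Longrightarrow> \<phi> w = 0"
    and nonneg: "0 \<le> \<phi> w"
    and nn_integral_1: "(\<integral>\<^sup>+w. ennreal (\<phi> w) \<partial>lborel) = 1"
begin

text \<open>With \<open>X\<^sub>i = \<partial>/\<partial>v\<^sub>i + t \<partial>/\<partial>x\<^sub>i\<close>, the profile \<open>scale_deriv\<close> of the scale derivative is minus the sum of \<open>\<partial>\<^sub>t(2 t \<phi>)\<close>,
of the \<open>X\<^sub>i(v\<^sub>i \<phi>)\<close>, and of the \<open>x\<^sub>i\<close>-derivatives of the spatial fluxes \<open>\<eta>\<^sub>i = (3 x\<^sub>i - t v\<^sub>i) \<phi>\<close>. The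
commutator identity writes the \<open>x\<^sub>i\<close>-derivative of \<open>\<eta>\<^sub>i\<close> as \<open>\<partial>\<^sub>t(X\<^sub>i \<eta>\<^sub>i) - X\<^sub>i(\<partial>\<^sub>t \<eta>\<^sub>i)\<close>, and collecting
the arguments of \<open>\<partial>\<^sub>t\<close> and of \<open>X\<^sub>i\<close> yields the transport flux and the velocity fluxes.\<close>

definition spatial_flux :: "'d \<Rightarrow> 'd kpoint \<Rightarrow> real" where
  "spatial_flux i w = (3 * fst (snd w) $ i - fst w * snd (snd w) $ i) * \<phi> w"

definition transport_flux :: "'d kpoint \<Rightarrow> real" where
  "transport_flux w = - 2 * fst w * \<phi> w - (\<Sum>i\<in>UNIV. lifted_velocity (axis i 1) (spatial_flux i) w)"

definition velocity_flux :: "'d \<Rightarrow> 'd kpoint \<Rightarrow> real" where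
  "velocity_flux i w = - (snd (snd w) $ i * \<phi> w) + deriv_along (1, 0, 0) (spatial_flux i) w"

text \<open>The profile of the derivative of \<open>s\<^sup>-\<^sup>Q \<phi>(\<delta>\<^bsub>1/s\<^esub> w)\<close> in \<open>s\<close>.\<close>

definition scale_deriv :: "'d kpoint \<Rightarrow> real" where
  "scale_deriv w = - (real (hom_dim TYPE('d)) * \<phi> w
      + deriv_along (2 * fst w, 3 *\<^sub>R fst (snd w), snd (snd w)) \<phi> w)"

lemma elem_smooth_spatial_flux: "elem_smooth (spatial_flux i)"
  unfolding spatial_flux_def[abs_def]
  by (intro elem_smooth_intros elem_smooth_coordinates smooth)

lemma elem_smooth_transport_flux: "elem_smooth transport_flux"
  unfolding transport_flux_def[abs_def]
  by (intro elem_smooth_intros elem_smooth_coordinates elem_smooth_lifted_velocity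
      elem_smooth_spatial_flux smooth)

lemma elem_smooth_velocity_flux: "elem_smooth (velocity_flux i)"
  unfolding velocity_flux_def[abs_def]
  by (intro elem_smooth_intros elem_smooth_coordinates elem_smooth_deriv_along
      elem_smooth_spatial_flux smooth)

text \<open>The mixed second derivatives of the spatial fluxes cancel by symmetry; what remains of the first-order
terms is the scaling generator, and the divergences of the coordinate functions add up to the
homogeneous dimension.\<close>

lemma scale_deriv_eq_divergence:
  "scale_deriv w = deriv_along (1, 0, 0) transport_flux w
     + (\<Sum>i\<in>UNIV. lifted_velocity (axis i 1) (velocity_flux i) w)"
proof -
  let ?T = "\<lambda>f::'d kpoint \<Rightarrow> real. deriv_along (1, 0, 0) f w"
  let ?P = "\<lambda>i (f::'d kpoint \<Rightarrow> real). deriv_along (0, axis i 1, 0) f w"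
  let ?V = "\<lambda>i (f::'d kpoint \<Rightarrow> real). deriv_along (0, 0, axis i 1) f w"
  note es = elem_smooth_intros elem_smooth_coordinates elem_smooth_deriv_along
    elem_smooth_lifted_velocity elem_smooth_spatial_flux smooth
  obtain t x v where w: "w = (t, x, v)" by (metis prod_cases3)
  have P: "?P i (spatial_flux i) = 3 * \<phi> w + (3 * x $ i - t * v $ i) * ?P i \<phi>" for i
  proof -
    have "?P i (spatial_flux i) = (3 * fst (snd w) $ i - fst w * snd (snd w) $ i) * ?P i \<phi>
       + deriv_along (0, axis i 1, 0) (\<lambda>w. 3 * fst (snd w) $ i - fst w * snd (snd w) $ i) w * \<phi> w"
      unfolding spatial_flux_def[abs_def] by (intro deriv_along_mult es)
    moreover have "deriv_along (0, axis i 1, 0) (\<lambda>w::'d kpoint. 3 * fst (snd w) $ i - fst w * snd (snd w) $ i) w = 3"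
      by (simp add: deriv_along_diff deriv_along_mult deriv_along_coordinates deriv_along_const es del: frechet_derivative_const)
    ultimately show ?thesis by (simp add: w)
  qed
  have T1: "?T transport_flux = ?T (\<lambda>w. - 2 * fst w * \<phi> w)
     - ?T (\<lambda>w. \<Sum>i\<in>UNIV. lifted_velocity (axis i 1) (spatial_flux i) w)"
    unfolding transport_flux_def[abs_def] by (intro deriv_along_diff es)
  have T2: "?T (\<lambda>w. - 2 * fst w * \<phi> w) = - 2 * \<phi> w - 2 * t * ?T \<phi>"
  proof -
    have "?T (\<lambda>w. (- 2 * fst w) * \<phi> w) = (- 2 * fst w) * ?T \<phi> + ?T (\<lambda>w. - 2 * fst w) * \<phi> w"
      by (intro deriv_along_mult es)
    moreover have "?T (\<lambda>w. - 2 * fst w) = - 2 * ?T fst + ?T (\<lambda>_. - 2) * fst w"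
      by (intro deriv_along_mult es)
    ultimately show ?thesis
      using deriv_along_coordinates(1)[where e="(1,0,0)" and z=w] deriv_along_const[where e="(1,0,0)" and c="-2" and z=w]
      by (simp add: w)
  qed
  have T3: "?T (\<lambda>w. \<Sum>i\<in>UNIV. lifted_velocity (axis i 1) (spatial_flux i) w)
     = (\<Sum>i\<in>UNIV. ?T (lifted_velocity (axis i 1) (spatial_flux i)))"
    by (rule deriv_along_sum) (intro es)
  have T4: "?T (lifted_velocity (axis i 1) (spatial_flux i)) =
     ?P i (spatial_flux i) + t * ?T (deriv_along (0, axis i 1, 0) (spatial_flux i))
       + ?T (deriv_along (0, 0, axis i 1) (spatial_flux i))" for i
  proof -
    have "?T (lifted_velocity (axis i 1) (spatial_flux i)) =
      ?T (\<lambda>w. fst w * deriv_along (0, axis i 1, 0) (spatial_flux i) w) + ?T (deriv_along (0, 0, axis i 1) (spatial_flux i))"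
      unfolding lifted_velocity_axis[OF elem_smooth_spatial_flux, abs_def]
      by (intro deriv_along_add es)
    moreover have "?T (\<lambda>w. fst w * deriv_along (0, axis i 1, 0) (spatial_flux i) w) =
       fst w * ?T (deriv_along (0, axis i 1, 0) (spatial_flux i)) + ?T fst * ?P i (spatial_flux i)"
      by (intro deriv_along_mult es)
    ultimately show ?thesis
      using deriv_along_coordinates(1)[where e="(1,0,0)" and z=w] by (simp add: w)
  qed
  have L: "lifted_velocity (axis i 1) (velocity_flux i) w =
     - \<phi> w - v $ i * (t * ?P i \<phi> + ?V i \<phi>)
      + (t * ?T (deriv_along (0, axis i 1, 0) (spatial_flux i))
         + ?T (deriv_along (0, 0, axis i 1) (spatial_flux i)))" for i
  proof -
    have 1: "deriv_along e (velocity_flux i) w = - (snd (snd w) $ i * deriv_along e \<phi> w + snd (snd e) $ i * \<phi> w)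
        + deriv_along e (deriv_along (1, 0, 0) (spatial_flux i)) w" for e
    proof -
      have "deriv_along e (velocity_flux i) w = deriv_along e (\<lambda>w. 0 - snd (snd w) $ i * \<phi> w) w
          + deriv_along e (deriv_along (1, 0, 0) (spatial_flux i)) w"
        unfolding velocity_flux_def[abs_def] by (subst deriv_along_add) (auto intro!: es)
      moreover have "deriv_along e (\<lambda>w. 0 - snd (snd w) $ i * \<phi> w) w =
          deriv_along e (\<lambda>w. 0) w - deriv_along e (\<lambda>w. snd (snd w) $ i * \<phi> w) w"
        by (intro deriv_along_diff es)
      moreover have "deriv_along e (\<lambda>w. snd (snd w) $ i * \<phi> w) w =
          snd (snd w) $ i * deriv_along e \<phi> w + deriv_along e (\<lambda>w. snd (snd w) $ i) w * \<phi> w"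
        by (intro deriv_along_mult es)
      ultimately show ?thesis
        by (simp only: deriv_along_const deriv_along_coordinates)
    qed
    note comm = deriv_along_commute[OF elem_smooth_spatial_flux, where e'="(1, 0, 0)"]
    show ?thesis
      unfolding lifted_velocity_axis[OF elem_smooth_velocity_flux] 1 comm
      by (simp add: w algebra_simps)
  qed
  have E: "deriv_along (2 * fst w, 3 *\<^sub>R fst (snd w), snd (snd w)) \<phi> w =
     2 * t * ?T \<phi> + (\<Sum>i\<in>UNIV. 3 * x $ i * ?P i \<phi>) + (\<Sum>i\<in>UNIV. v $ i * ?V i \<phi>)"
    by (subst linear_kpoint_expand[OF elem_smooth_linear_deriv[OF smooth]]) (simp add: w)
  show ?thesis
    unfolding scale_deriv_def hom_dim_def E T1 T2 T3 T4 L P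
    by (simp add: sum.distrib sum_subtractf sum_negf algebra_simps sum_distrib_left)
qed

lemma has_real_derivative_mollifier_scale:
  assumes s: "s > 0"
  shows "((\<lambda>s. \<phi> (rel_pos s y z) / s ^ hom_dim TYPE('d)) has_real_derivative
     scale_deriv (rel_pos s y z) / s ^ (hom_dim TYPE('d) + 1)) (at s)"
proof -
  let ?Q = "hom_dim TYPE('d)"
  have "((\<lambda>s. s ^ ?Q) has_real_derivative real ?Q * s ^ (?Q - 1)) (at s)"
    using DERIV_pow[of ?Q s] by simp
  from DERIV_divide[OF has_real_derivative_rel_pos_scale[OF smooth] this]
  show ?thesis
    by (rule DERIV_cong) (use s in \<open>auto simp: scale_deriv_def hom_dim_def field_simps\<close>)
qed

end

section \<open>Pairings with compactly supported smooth functions\<close>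

lemma L2_norm_nonneg: "0 \<le> L2_norm D f"
  by (simp add: L2_norm_def)

lemma bdd_borel_continuous_support:
  assumes "compact E" "continuous_on UNIV f" "\<And>z. z \<notin> E \<Longrightarrow> f z = 0"
  shows "bdd_borel f"
proof -
  have "bdd_borel (\<lambda>z. indicator E z * f z)"
    by (rule bdd_borel_indicator_continuous[OF assms(1) continuous_on_subset[OF assms(2)]]) simp
  moreover have "(\<lambda>z. indicator E z * f z) = f"
    using assms(3) by (auto simp: fun_eq_iff indicator_def)
  ultimately show ?thesis by (simp only:)
qed

lemma in_L2_continuous_support:
  fixes f :: "'a::euclidean_space \<Rightarrow> 'b::euclidean_space"
  assumes D: "D \<in> sets lebesgue" and E: "compact E" and f: "continuous_on UNIV f"
    and supp: "\<And>z. z \<notin> E \<Longrightarrow> f z = 0"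
  shows "in_L2 D f"
proof -
  have "bdd_borel (\<lambda>z. (norm (f z))\<^sup>2)"
    by (rule bdd_borel_continuous_support[OF E]) (auto intro!: continuous_intros f simp: supp)
  then have "integrable lebesgue (\<lambda>z. (norm (f z))\<^sup>2)"
    using bdd_borel_integrable bdd_borel_measurable by (subst integrable_completion) auto
  then have "integrable (lebesgue_on D) (\<lambda>z. (norm (f z))\<^sup>2)"
    using D integrable_mult_indicator[OF D, of "\<lambda>z. (norm (f z))\<^sup>2"]
    by (subst integrable_restrict_space) (auto simp: mult.commute)
  moreover have "f \<in> borel_measurable (lebesgue_on D)"
    using borel_measurable_continuous_onI[OF f]
    by (intro measurable_restrict_space1 measurable_completion) simp
  ultimately show ?thesis by (simp add: in_L2_def)
qed

lemma integral_lebesgue_on_support: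
  fixes f :: "'a::euclidean_space \<Rightarrow> real"
  assumes D: "D \<in> sets lebesgue" and f: "f \<in> borel_measurable borel"
    and supp: "\<And>z. z \<notin> D \<Longrightarrow> f z = 0"
  shows "(\<integral>z. f z \<partial>lebesgue_on D) = (LBINT z. f z)"
proof -
  have "(\<integral>z. f z \<partial>lebesgue_on D) = (\<integral>z. indicator D z *\<^sub>R f z \<partial>lebesgue)"
    using D by (intro integral_restrict_space) simp
  also have "\<dots> = (\<integral>z. f z \<partial>lebesgue)"
    by (intro Bochner_Integration.integral_cong) (auto simp: indicator_def supp)
  also have "\<dots> = (LBINT z. f z)"
    by (rule integral_completion) (use f in simp)
  finally show ?thesis .
qed

lemma kin_smooth_continuous:
  assumes "u \<in> kin_smooth D" "E \<subseteq> D"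
  shows "continuous_on E u"
proof -
  have "smooth_on_set u D" using assms(1) by (simp add: kin_smooth_def)
  then obtain U where "D \<subseteq> U" "continuous_on U u" by (rule smooth_on_set_obtains)
  then show ?thesis using assms(2) continuous_on_subset by blast
qed

lemma transport_expand:
  assumes "(u has_derivative (\<lambda>e. deriv_along e u z)) (at z)"
  shows "transport u z = deriv_along (1, 0, 0) u z
     + (\<Sum>i\<in>UNIV. snd (snd z) $ i * deriv_along (0, axis i 1, 0) u z)"
  unfolding transport_def
  using linear_kpoint_expand[OF has_derivative_linear[OF assms], of 1 "snd (snd z)" 0] by simp

lemma norm_grad_v: "(norm (grad_v u z))\<^sup>2 = (\<Sum>i\<in>UNIV. (deriv_along (0, 0, axis i 1) u z)\<^sup>2)"
  unfolding power2_norm_eq_inner by (simp add: inner_vec_def grad_v_def power2_eq_square)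

lemma smooth_UNIV:
  assumes "smooth_on_set h UNIV"
  shows "(h has_derivative (\<lambda>e. deriv_along e h z)) (at z)"
    and "continuous_on S h" and "continuous_on S (deriv_along e h)"
  using smooth_on_set_obtains[OF assms] by (metis UNIV_I subset_UNIV continuous_on_subset subsetD)+

lemma continuous_on_transport:
  assumes "open U" "\<And>z. z \<in> U \<Longrightarrow> (u has_derivative (\<lambda>e. deriv_along e u z)) (at z)"
    "\<And>e. continuous_on U (deriv_along e u)"
  shows "continuous_on U (transport u)"
proof -
  have "continuous_on U (\<lambda>z. deriv_along (1, 0, 0) u z
     + (\<Sum>i\<in>UNIV. snd (snd z) $ i * deriv_along (0, axis i 1, 0) u z))"
    by (intro continuous_intros assms(3))
  then show ?thesis
    by (rule continuous_on_eq) (simp add: transport_expand[OF assms(2)])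
qed

lemma continuous_on_grad_v:
  "(\<And>e. continuous_on U (deriv_along e u)) \<Longrightarrow> continuous_on U (grad_v u)"
  unfolding grad_v_def[abs_def] by (intro continuous_intros)

lemma smooth_on_set_cmult:
  assumes "smooth_on_set h UNIV"
  shows "smooth_on_set (\<lambda>z. c * h z) UNIV"
proof -
  have "Ck_on k (\<lambda>z. c * h z) UNIV" if "Ck_on k h UNIV" for k h
    using that
  proof (induction k arbitrary: h)
    case 0
    then show ?case by (auto intro: continuous_intros)
  next
    case (Suc k)
    have der: "(h has_derivative (\<lambda>e. deriv_along e h z)) (at z)" for z
      using Suc.prems by (metis Ck_on.simps(2) UNIV_I differentiable_on_def frechet_derivative_works)
    then have der': "((\<lambda>z. c * h z) has_derivative (\<lambda>e. c * deriv_along e h z)) (at z)" for z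
      by (rule has_derivative_mult_right)
    then have "deriv_along e (\<lambda>z. c * h z) = (\<lambda>z. c * deriv_along e h z)" for e
      by (intro ext deriv_along_eqI)
    then show ?case
      using Suc der' by (auto simp: differentiable_on_def differentiable_def)
  qed
  then show ?thesis
    using assms unfolding smooth_on_set_def
    by (metis UNIV_I open_UNIV subsetI subset_UNIV subset_antisym)
qed

lemma kin_smooth_compact_support:
  assumes D: "D \<in> sets lebesgue" and E: "compact E" and h: "smooth_on_set h UNIV"
    and supp: "\<And>z. z \<notin> E \<Longrightarrow> h z = 0"
  shows "h \<in> kin_smooth D"
proof -
  have dsupp: "deriv_along e h z = 0" if "z \<notin> E" for e z
    using deriv_along_outside_support[OF compact_imp_closed[OF E] supp that] .
  have "smooth_on_set h D" using h unfolding smooth_on_set_def by blast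
  moreover have "in_L2 D h" by (rule in_L2_continuous_support[OF D E smooth_UNIV(2)[OF h] supp])
  moreover have "in_L2 D (grad_v h)"
    by (rule in_L2_continuous_support[OF D E continuous_on_grad_v[OF smooth_UNIV(3)[OF h]]])
       (simp add: grad_v_def dsupp vec_eq_iff)
  moreover have "in_L2 D (transport h)"
    by (rule in_L2_continuous_support[OF D E continuous_on_transport[OF open_UNIV smooth_UNIV(1)[OF h] smooth_UNIV(3)[OF h]]])
       (simp add: transport_def dsupp)
  ultimately show ?thesis by (simp add: kin_smooth_def)
qed

text \<open>Such an \<open>h\<close> is constant along every line in a velocity direction, and every such line leaves the
compact support.\<close>

lemma smooth_compact_support_grad_v_zero:
  fixes h :: "'d::finite kpoint \<Rightarrow> real"
  assumes E: "compact E" and h: "smooth_on_set h UNIV"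
    and supp: "\<And>z. z \<notin> E \<Longrightarrow> h z = 0"
    and zero: "(LBINT z. (norm (grad_v h z))\<^sup>2) = 0"
  shows "h z = 0"
proof -
  define q where "q z = (norm (grad_v h z))\<^sup>2" for z
  have dsupp: "deriv_along e h z = 0" if "z \<notin> E" for e z
    using deriv_along_outside_support[OF compact_imp_closed[OF E] supp that] .
  have cq: "continuous_on UNIV q"
    unfolding q_def by (intro continuous_intros continuous_on_grad_v smooth_UNIV(3)[OF h])
  have "bdd_borel q"
    by (rule bdd_borel_continuous_support[OF E cq]) (simp add: q_def grad_v_def dsupp vec_eq_iff)
  then have "AE z in lborel. q z = 0"
    using zero integral_nonneg_eq_0_iff_AE[OF bdd_borel_integrable, of q] by (simp add: q_def[symmetric]) (simp add: q_def)
  moreover have "open {z. q z \<noteq> 0}"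
    using cq by (intro open_Collect_neq) auto
  ultimately have "{z. q z \<noteq> 0} \<in> null_sets lborel" "open {z. q z \<noteq> 0}"
    by (simp_all add: AE_iff_null)
  then have "{z. q z \<noteq> 0} = {}"
    using open_not_negligible[of "{z. q z \<noteq> 0}"] null_sets_completionI negligible_iff_null_sets by blast
  then have "q z = 0" for z by blast
  then have "grad_v h z = 0" for z by (simp add: q_def)
  then have D0: "deriv_along (0, 0, axis i 1) h z = 0" for i z
    by (simp add: grad_v_def vec_eq_iff)
  obtain i :: 'd where True by simp
  define p where "p l = z + l *\<^sub>R (0, 0, axis i 1)" for l :: real
  have "((\<lambda>l. h (p l)) has_real_derivative 0) (at l)" for l
  proof -
    have "(p has_derivative (\<lambda>k. k *\<^sub>R (0, 0, axis i 1))) (at l)"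
      unfolding p_def by (auto intro!: derivative_eq_intros)
    from has_derivative_compose[OF this smooth_UNIV(1)[OF h]]
    have "((\<lambda>l. h (p l)) has_derivative (\<lambda>k. deriv_along (k *\<^sub>R (0, 0, axis i 1)) h (p l))) (at l)" .
    moreover have "deriv_along (k *\<^sub>R (0, 0, axis i 1)) h (p l) = 0" for k
      using linear_scale[OF has_derivative_linear[OF smooth_UNIV(1)[OF h, of "p l"]], of k "(0, 0, axis i 1)"]
      by (simp only: D0) simp
    ultimately show ?thesis by (simp add: has_field_derivative_def lambda_zero)
  qed
  then have const: "h (p l) = h (p 0)" for l
    using DERIV_isconst_all by blast
  obtain R where R: "\<And>z. z \<in> E \<Longrightarrow> norm z \<le> R"
    using compact_imp_bounded[OF E] unfolding bounded_iff by blast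
  have "norm (p (norm z + \<bar>R\<bar> + 1)) \<ge> \<bar>norm z + \<bar>R\<bar> + 1\<bar> * norm (0 :: real, 0 :: real ^ 'd, axis i (1 :: real)) - norm z"
    unfolding p_def using norm_triangle_ineq2[of "(norm z + \<bar>R\<bar> + 1) *\<^sub>R (0 :: real, 0 :: real ^ 'd, axis i (1 :: real))" "- z"]
    by (simp add: add.commute del: scaleR_Pair)
  then have "norm (p (norm z + \<bar>R\<bar> + 1)) > R" by (simp add: norm_Pair)
  then have "h (p (norm z + \<bar>R\<bar> + 1)) = 0" by (metis R not_less supp)
  then have "h (p 0) = 0" using const[of "norm z + \<bar>R\<bar> + 1"] by simp
  then show ?thesis by (simp add: p_def zero_prod_def[symmetric])
qed

text \<open>The dual norm only tests functions with normalised velocity gradient. If the gradient of \<open>h\<close> does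
not vanish, \<open>h\<close> can be normalised; otherwise \<open>h\<close> is zero.\<close>

lemma transport_pairing_le:
  fixes u h :: "'d::finite kpoint \<Rightarrow> real"
  assumes D: "D \<in> sets lebesgue" and E: "compact E" and ED: "E \<subseteq> D"
    and h: "smooth_on_set h UNIV" and supp: "\<And>z. z \<notin> E \<Longrightarrow> h z = 0"
    and N: "transport_dual_norm D u < \<infinity>"
  shows "(\<integral>z. transport u z * h z \<partial>lebesgue_on D)
     \<le> enn2real (transport_dual_norm D u) * sqrt (LBINT z. (norm (grad_v h z))\<^sup>2)"
proof -
  define \<nu> where "\<nu> = sqrt (LBINT z. (norm (grad_v h z))\<^sup>2)"
  have dsupp: "deriv_along e h z = 0" if "z \<notin> E" for e z
    using deriv_along_outside_support[OF compact_imp_closed[OF E] supp that] .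
  then have dsupp': "deriv_along e h z = 0" if "z \<notin> D" for e z
    using that ED by blast
  show ?thesis
  proof (cases "\<nu> = 0")
    case True
    then have "h z = 0" for z
      using smooth_compact_support_grad_v_zero[OF E h supp] by (simp add: \<nu>_def)
    then show ?thesis using True by (simp add: \<nu>_def)
  next
    case False
    then have \<nu>: "\<nu> > 0" unfolding \<nu>_def
      by (smt (verit) Bochner_Integration.integral_nonneg real_sqrt_ge_zero zero_le_power2)
    define k where "k z = (1 / \<nu>) * h z" for z
    have sk: "smooth_on_set k UNIV" unfolding k_def[abs_def] by (rule smooth_on_set_cmult[OF h])
    have dk: "deriv_along e k z = (1 / \<nu>) * deriv_along e h z" for e z
      unfolding k_def[abs_def]
      by (intro deriv_along_eqI has_derivative_mult_right smooth_UNIV(1)[OF h])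
    then have "grad_v k z = (1 / \<nu>) *\<^sub>R grad_v h z" for z
      by (simp add: grad_v_def vec_eq_iff)
    then have gk: "(norm (grad_v k z))\<^sup>2 = (1 / \<nu>)\<^sup>2 * (norm (grad_v h z))\<^sup>2" for z
      by (simp add: power_mult_distrib power_divide)
    have "L2_norm D (grad_v k) = sqrt (LBINT z. (norm (grad_v k z))\<^sup>2)"
      unfolding L2_norm_def
      by (intro arg_cong[of _ _ sqrt] integral_lebesgue_on_support[OF D] borel_measurable_continuous_onI
          continuous_intros continuous_on_grad_v smooth_UNIV(3)[OF sk])
         (simp_all add: norm_grad_v dk dsupp')
    also have "\<dots> = sqrt ((1 / \<nu>)\<^sup>2 * \<nu>\<^sup>2)"
      unfolding gk by (simp add: \<nu>_def)
    also have "\<dots> = 1" using \<nu> by (simp add: power_divide)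
    finally have "L2_norm D (grad_v k) = 1" .
    moreover have "k \<in> kin_smooth D"
      by (rule kin_smooth_compact_support[OF D E sk]) (simp add: k_def supp)
    ultimately have le: "ennreal (\<integral>z. transport u z * k z \<partial>lebesgue_on D) \<le> transport_dual_norm D u"
      unfolding transport_dual_norm_def by (intro SUP_upper) simp
    have "(\<integral>z. transport u z * k z \<partial>lebesgue_on D) \<le> enn2real (transport_dual_norm D u)"
    proof (cases "(\<integral>z. transport u z * k z \<partial>lebesgue_on D) \<ge> 0")
      case True
      then show ?thesis using enn2real_mono[OF le] N by simp
    next
      case False
      then show ?thesis using enn2real_nonneg[of "transport_dual_norm D u"] by linarith
    qed
    moreover have "(\<integral>z. transport u z * k z \<partial>lebesgue_on D) = (1 / \<nu>) * (\<integral>z. transport u z * h z \<partial>lebesgue_on D)"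
      unfolding k_def by (subst integral_mult_right_zero[symmetric]) (simp only: mult_ac)
    ultimately have "(1 / \<nu>) * (\<integral>z. transport u z * h z \<partial>lebesgue_on D) \<le> enn2real (transport_dual_norm D u)"
      by simp
    from mult_left_mono[OF this, of \<nu>] show ?thesis
      using \<nu> unfolding \<nu>_def[symmetric] by (simp add: mult.commute)
  qed
qed

text \<open>The coefficient \<open>v\<close> of the \<open>x\<close>-derivatives does not depend on \<open>x\<close>, so it moves into the test
function.\<close>

lemma transport_by_parts:
  fixes u h :: "'d::finite kpoint \<Rightarrow> real"
  assumes u: "smooth_on_set u E" and E: "compact E"
    and h: "smooth_on_set h UNIV" and vh: "\<And>i. smooth_on_set (\<lambda>z. snd (snd z) $ i * h z) UNIV"
    and supp: "\<And>z. z \<notin> E \<Longrightarrow> h z = 0"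
  shows "(LBINT z. indicator E z * u z * transport h z) =
     - (LBINT z. indicator E z * transport u z * h z)"
proof -
  obtain U where U: "open U" "E \<subseteq> U"
    and du: "\<And>z. z \<in> U \<Longrightarrow> (u has_derivative (\<lambda>e. deriv_along e u z)) (at z)"
    and cu: "continuous_on U u" and cdu: "\<And>e. continuous_on U (deriv_along e u)"
    using smooth_on_set_obtains[OF u] by metis
  have v: "deriv_along (0, axis i 1, 0) (\<lambda>z. snd (snd z) $ i * h z) z = snd (snd z) $ i * deriv_along (0, axis i 1, 0) h z" for i z
  proof -
    have "((\<lambda>z. snd (snd z) $ i * h z) has_derivative
      (\<lambda>e. snd (snd z) $ i * deriv_along e h z + snd (snd e) $ i * h z)) (at z)"
      by (intro has_derivative_mult smooth_UNIV(1)[OF h] bounded_linear.has_derivative[OF bounded_linear_vec_nth]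
          has_derivative_snd has_derivative_ident)
    from deriv_along_eqI[OF this, of "(0, axis i 1, 0)"] show ?thesis by simp
  qed
  have I: "integrable lborel (\<lambda>z. indicator E z * f z)" if "continuous_on E f" for f :: "'d kpoint \<Rightarrow> real"
    by (intro bdd_borel_integrable bdd_borel_indicator_continuous E that)
  have parts: "(LBINT z. indicator E z * (u z * (snd (snd z) $ i * deriv_along (0, axis i 1, 0) h z))) =
     - (LBINT z. indicator E z * (deriv_along (0, axis i 1, 0) u z * (snd (snd z) $ i * h z)))" for i
    using integration_by_parts[OF u E vh[of i], of "(0, axis i 1, 0)"] supp
    by (simp add: v mult.assoc)
  note ci = continuous_intros continuous_on_subset[OF cu U(2)] continuous_on_subset[OF cdu U(2)] smooth_UNIV[OF h]
  have "(LBINT z. indicator E z * u z * transport h z) =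
     (LBINT z. indicator E z * (u z * deriv_along (1, 0, 0) h z)
       + (\<Sum>i\<in>UNIV. indicator E z * (u z * (snd (snd z) $ i * deriv_along (0, axis i 1, 0) h z))))"
    by (simp add: transport_expand[OF smooth_UNIV(1)[OF h]] algebra_simps sum_distrib_left)
  also have "\<dots> = (LBINT z. indicator E z * (u z * deriv_along (1, 0, 0) h z))
     + (\<Sum>i\<in>UNIV. \<integral>z. indicator E z * (u z * (snd (snd z) $ i * deriv_along (0, axis i 1, 0) h z)) \<partial>lborel)"
    by (intro integral_add_sum I ci)
  also have "\<dots> = - (LBINT z. indicator E z * (deriv_along (1, 0, 0) u z * h z))
     - (\<Sum>i\<in>UNIV. \<integral>z. indicator E z * (deriv_along (0, axis i 1, 0) u z * (snd (snd z) $ i * h z)) \<partial>lborel)"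
    using integration_by_parts[OF u E h supp, of "(1, 0, 0)"]
    by (simp add: parts mult.assoc sum_negf)
  also have "\<dots> = - ((LBINT z. indicator E z * (deriv_along (1, 0, 0) u z * h z)
       + (\<Sum>i\<in>UNIV. indicator E z * (deriv_along (0, axis i 1, 0) u z * (snd (snd z) $ i * h z)))))"
    by (subst integral_add_sum) (intro I ci, intro I ci, simp)
  also have "\<dots> = - (LBINT z. indicator E z * transport u z * h z)"
    by (rule arg_cong[of _ _ uminus], rule Bochner_Integration.integral_cong)
       (use U in \<open>auto simp: indicator_def transport_expand[OF du] algebra_simps sum_distrib_left subsetD\<close>)
  finally show ?thesis .
qed

text \<open>Here the function \<open>G\<close> sits at \<open>z\<close> and the average is a function of the other point \<open>y\<close>: this is the
transpose of mollification, and it produces the test functions of the duality argument.\<close>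

definition kernel_average :: "real \<Rightarrow> ('d::finite kpoint \<Rightarrow> real) \<Rightarrow> ('d kpoint \<Rightarrow> real) \<Rightarrow> 'd kpoint \<Rightarrow> real" where
  "kernel_average s \<gamma> G y = (LBINT z. G z * \<gamma> (rel_pos s y z))"

lemma nn_integral_abs_rel_pos:
  fixes \<gamma> :: "'d::finite kpoint \<Rightarrow> real"
  assumes \<gamma>: "elem_smooth \<gamma>" "bdd_borel \<gamma>" and s: "s > 0"
  shows "(\<integral>\<^sup>+y. ennreal \<bar>\<gamma> (rel_pos s y z)\<bar> \<partial>lborel) = ennreal (s ^ hom_dim TYPE('d) * (LBINT w. \<bar>\<gamma> w\<bar>))"
    and "(\<integral>\<^sup>+z. ennreal \<bar>\<gamma> (rel_pos s y z)\<bar> \<partial>lborel) = ennreal (s ^ hom_dim TYPE('d) * (LBINT w. \<bar>\<gamma> w\<bar>))"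
proof -
  have m: "(\<lambda>w. ennreal \<bar>\<gamma> w\<bar>) \<in> borel_measurable borel"
    using elem_smooth_measurable[OF \<gamma>(1)] by measurable
  have "(\<integral>\<^sup>+w. ennreal \<bar>\<gamma> w\<bar> \<partial>lborel) = ennreal (LBINT w. \<bar>\<gamma> w\<bar>)"
    using bdd_borel_integrable[OF \<gamma>(2)] by (intro nn_integral_eq_integral) auto
  then show "(\<integral>\<^sup>+y. ennreal \<bar>\<gamma> (rel_pos s y z)\<bar> \<partial>lborel) = ennreal (s ^ hom_dim TYPE('d) * (LBINT w. \<bar>\<gamma> w\<bar>))"
    and "(\<integral>\<^sup>+z. ennreal \<bar>\<gamma> (rel_pos s y z)\<bar> \<partial>lborel) = ennreal (s ^ hom_dim TYPE('d) * (LBINT w. \<bar>\<gamma> w\<bar>))"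
    using nn_integral_rel_pos(1)[OF m s, of z] nn_integral_rel_pos(2)[OF m s, of y] s
    by (simp_all add: ennreal_mult)
qed

lemma kernel_average_L2:
  fixes \<gamma> G :: "'d::finite kpoint \<Rightarrow> real"
  assumes \<gamma>: "elem_smooth \<gamma>" "bdd_borel \<gamma>" and G: "bdd_borel G" and s: "s > 0"
    and b: "bdd_borel (kernel_average s \<gamma> G)"
  shows "sqrt (LBINT y. (kernel_average s \<gamma> G y)\<^sup>2) \<le>
     s ^ hom_dim TYPE('d) * (LBINT w. \<bar>\<gamma> w\<bar>) * sqrt (LBINT z. (G z)\<^sup>2)"
proof -
  let ?m = "s ^ hom_dim TYPE('d) * (LBINT w. \<bar>\<gamma> w\<bar>)"
  have m0: "?m \<ge> 0" using s by (intro mult_nonneg_nonneg Bochner_Integration.integral_nonneg) auto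
  have [measurable]: "G \<in> borel_measurable borel" using G by (rule bdd_borel_measurable)
  have k: "(\<lambda>p. ennreal \<bar>\<gamma> (rel_pos s (snd p) (fst p))\<bar>) \<in> borel_measurable borel"
    using measurable_compose[OF _ rel_pos_kernel_measurable[OF \<gamma>(1)], of "\<lambda>p. (snd p, fst p)" borel s] by simp
  have G2: "bdd_borel (\<lambda>z. (G z)\<^sup>2)" "bdd_borel (\<lambda>z. (kernel_average s \<gamma> G z)\<^sup>2)"
    unfolding power2_eq_square by (intro bdd_borel_mult G b)+
  have "ennreal (LBINT y. (kernel_average s \<gamma> G y)\<^sup>2) = (\<integral>\<^sup>+y. (ennreal \<bar>kernel_average s \<gamma> G y\<bar>)\<^sup>2 \<partial>lborel)"
    using nn_integral_bdd_borel_nonneg[OF G2(2)] by (simp add: ennreal_power)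
  also have "\<dots> \<le> (\<integral>\<^sup>+y. (\<integral>\<^sup>+z. ennreal \<bar>G z\<bar> * ennreal \<bar>\<gamma> (rel_pos s y z)\<bar> \<partial>lborel)\<^sup>2 \<partial>lborel)"
  proof (intro nn_integral_mono power_mono)
    fix y
    show "ennreal \<bar>kernel_average s \<gamma> G y\<bar> \<le> (\<integral>\<^sup>+z. ennreal \<bar>G z\<bar> * ennreal \<bar>\<gamma> (rel_pos s y z)\<bar> \<partial>lborel)"
      using ennreal_abs_integral_le[of lborel "\<lambda>z. G z * \<gamma> (rel_pos s y z)"]
      by (simp add: kernel_average_def abs_mult ennreal_mult)
  qed simp
  also have "\<dots> \<le> ennreal ?m * ennreal ?m * (\<integral>\<^sup>+z. (ennreal \<bar>G z\<bar>)\<^sup>2 \<partial>lborel)"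
    by (rule Schur_test[of "\<lambda>z y. ennreal \<bar>\<gamma> (rel_pos s y z)\<bar>", OF k])
       (simp_all add: nn_integral_abs_rel_pos[OF \<gamma> s])
  also have "(\<integral>\<^sup>+z. (ennreal \<bar>G z\<bar>)\<^sup>2 \<partial>lborel) = ennreal (LBINT z. (G z)\<^sup>2)"
    using nn_integral_bdd_borel_nonneg[OF G2(1)] by (simp add: ennreal_power)
  also have "ennreal ?m * ennreal ?m * \<dots> = ennreal (?m\<^sup>2 * (LBINT z. (G z)\<^sup>2))"
    using m0 by (simp add: ennreal_mult power2_eq_square)
  finally have "(LBINT y. (kernel_average s \<gamma> G y)\<^sup>2) \<le> ?m\<^sup>2 * (LBINT z. (G z)\<^sup>2)"
    by (subst (asm) ennreal_le_iff) (auto intro!: mult_nonneg_nonneg Bochner_Integration.integral_nonneg)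
  then have "sqrt (LBINT y. (kernel_average s \<gamma> G y)\<^sup>2) \<le> sqrt (?m\<^sup>2 * (LBINT z. (G z)\<^sup>2))"
    by (rule real_sqrt_le_mono)
  also have "\<dots> = ?m * sqrt (LBINT z. (G z)\<^sup>2)"
    using m0 by (simp add: real_sqrt_mult)
  finally show ?thesis .
qed

lemma kernel_average_eq:
  "kernel_average s \<gamma> G = (\<lambda>y. \<integral>z. G z * (\<lambda>p. \<gamma> (rel_pos s (fst p) (snd p))) (y, z) \<partial>lborel)"
  by (simp add: kernel_average_def fun_eq_iff)

lemma smooth_kernel_average:
  assumes "elem_smooth \<gamma>" "bdd_borel G"
  shows "smooth_on_set (kernel_average s \<gamma> G) UNIV"
  unfolding kernel_average_eq by (rule smooth_kernel_integral[OF assms(2) elem_smooth_rel_pos[OF assms(1)]])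

lemma smooth_velocity_mult_kernel_average:
  fixes \<gamma> :: "'d::finite kpoint \<Rightarrow> real"
  assumes "elem_smooth \<gamma>" "bdd_borel G"
  shows "smooth_on_set (\<lambda>y. snd (snd y) $ i * kernel_average s \<gamma> G y) UNIV"
proof -
  have "elem_smooth (\<lambda>p::'d kpoint \<times> 'd kpoint. snd (snd (fst p)) $ i)"
    using elem_smooth.inner[of "((0, 0, axis i 1), 0) :: 'd kpoint \<times> 'd kpoint"]
    by (simp add: inner_prod_def inner_axis)
  then have "elem_smooth (\<lambda>p::'d kpoint \<times> 'd kpoint. snd (snd (fst p)) $ i * \<gamma> (rel_pos s (fst p) (snd p)))"
    by (intro elem_smooth.mult elem_smooth_rel_pos assms)
  from smooth_kernel_integral[OF assms(2) this, of UNIV]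
  have "smooth_on_set (\<lambda>y. \<integral>z. snd (snd y) $ i * (G z * \<gamma> (rel_pos s y z)) \<partial>lborel) UNIV"
    by (simp add: mult.left_commute)
  then show ?thesis unfolding kernel_average_def by simp
qed

lemma deriv_kernel_average:
  fixes \<gamma> :: "'d::finite kpoint \<Rightarrow> real"
  assumes \<gamma>: "elem_smooth \<gamma>" and G: "bdd_borel G" and s: "s > 0"
  shows transport_kernel_average:
      "transport (kernel_average s \<gamma> G) y = - (1 / s ^ 2) * kernel_average s (deriv_along (1, 0, 0) \<gamma>) G y"
    and velocity_deriv_kernel_average:
      "deriv_along (0, 0, e) (kernel_average s \<gamma> G) y = - (1 / s) * kernel_average s (lifted_velocity e \<gamma>) G y"
proof -
  have eq: "deriv_along e (kernel_average s \<gamma> G) y =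
     (LBINT z. G z * deriv_along (e, 0) (\<lambda>p. \<gamma> (rel_pos s (fst p) (snd p))) (y, z))" for e
    unfolding kernel_average_eq
    by (rule deriv_along_eqI, rule has_derivative_kernel_integral[OF G elem_smooth_rel_pos[OF \<gamma>]])
  have s0: "s \<noteq> 0" using s by simp
  show "transport (kernel_average s \<gamma> G) y = - (1 / s ^ 2) * kernel_average s (deriv_along (1, 0, 0) \<gamma>) G y"
    unfolding transport_def eq deriv_along_rel_pos_transport[OF \<gamma> s0] kernel_average_def
    by (subst integral_mult_right_zero[symmetric]) (simp only: mult_ac)
  show "deriv_along (0, 0, e) (kernel_average s \<gamma> G) y = - (1 / s) * kernel_average s (lifted_velocity e \<gamma>) G y"
    unfolding eq deriv_along_rel_pos_velocity[OF \<gamma> s0] kernel_average_def lifted_velocity_def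
    by (subst integral_mult_right_zero[symmetric]) (simp only: mult_ac)
qed

context mollifier
begin

lemma flux_support:
  assumes "w \<notin> K"
  shows "spatial_flux i w = 0" "transport_flux w = 0" "velocity_flux i w = 0"
    "lifted_velocity v transport_flux w = 0" "lifted_velocity v (velocity_flux i) w = 0"
    "deriv_along e transport_flux w = 0" "scale_deriv w = 0"
proof -
  note cl = compact_imp_closed[OF compact_K]
  have 1: "spatial_flux i w = 0" if "w \<notin> K" for w i
    using supp[OF that] by (simp add: spatial_flux_def)
  have d1: "deriv_along e (spatial_flux i) w = 0" if "w \<notin> K" for w i e
    by (rule deriv_along_outside_support[OF cl 1 that])
  have 2: "transport_flux w = 0" if "w \<notin> K" for w
    using that by (simp add: transport_flux_def supp lifted_velocity_def d1)
  have 3: "velocity_flux i w = 0" if "w \<notin> K" for i w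
    using that by (simp add: velocity_flux_def supp d1)
  show "spatial_flux i w = 0" "transport_flux w = 0" "velocity_flux i w = 0"
    using 1 2 3 assms by blast+
  show "lifted_velocity v transport_flux w = 0" "lifted_velocity v (velocity_flux i) w = 0"
    "deriv_along e transport_flux w = 0"
    using deriv_along_outside_support[OF cl 2 assms] deriv_along_outside_support[OF cl 3 assms]
    by (simp_all add: lifted_velocity_def)
  show "scale_deriv w = 0"
    using deriv_along_outside_support[OF cl supp assms] by (simp add: scale_deriv_def supp[OF assms])
qed

lemma elem_smooth_scale_deriv: "elem_smooth scale_deriv"
  unfolding scale_deriv_eq_divergence[abs_def]
  by (intro elem_smooth_intros elem_smooth_deriv_along elem_smooth_lifted_velocity
      elem_smooth_transport_flux elem_smooth_velocity_flux)

lemma bdd_borel_of_support: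
  assumes "elem_smooth \<gamma>" "\<And>w. w \<notin> K \<Longrightarrow> \<gamma> w = 0"
  shows "bdd_borel \<gamma>"
  by (rule bdd_borel_continuous_support[OF compact_K elem_smooth_continuous[OF assms(1)] assms(2)])

lemma kernel_average_support:
  assumes "\<And>w. w \<notin> K \<Longrightarrow> \<gamma> w = 0" "\<And>y z. G z \<noteq> 0 \<Longrightarrow> rel_pos s y z \<in> K \<Longrightarrow> y \<in> E" "y \<notin> E"
  shows "kernel_average s \<gamma> G y = 0"
proof -
  have "G z * \<gamma> (rel_pos s y z) = 0" for z using assms by (metis mult_eq_0_iff)
  then show ?thesis by (simp only: kernel_average_def Bochner_Integration.integral_zero)
qed

definition dissipation_const :: real where
  "dissipation_const = sqrt (\<Sum>i\<in>UNIV. (LBINT w. \<bar>lifted_velocity (axis i 1) transport_flux w\<bar>)\<^sup>2)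
     + (\<Sum>i\<in>UNIV. \<integral>w. \<bar>velocity_flux i w\<bar> \<partial>lborel)"

lemma dissipation_const_nonneg: "0 \<le> dissipation_const"
  unfolding dissipation_const_def
  by (intro add_nonneg_nonneg real_sqrt_ge_zero sum_nonneg Bochner_Integration.integral_nonneg) auto

lemma kernel_average_scale_deriv:
  assumes G: "bdd_borel G" and s: "s > 0"
  shows "kernel_average s scale_deriv G y =
    - (s\<^sup>2) * transport (kernel_average s transport_flux G) y
    - s * (\<Sum>i\<in>UNIV. deriv_along (0, 0, axis i 1) (kernel_average s (velocity_flux i) G) y)"
proof -
  have I: "integrable lborel (\<lambda>z. G z * \<gamma> (rel_pos s y z))" if "elem_smooth \<gamma>" for \<gamma>
    using elem_smooth_continuous[OF elem_smooth_rel_pos[OF that], of UNIV s]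
    by (intro bdd_borel_integrable bdd_borel_mult_continuous[OF G])
       (auto intro!: continuous_on_compose2[where f="\<lambda>z. (y, z)" and g="\<lambda>p. \<gamma> (rel_pos s (fst p) (snd p))", simplified] continuous_intros)
  have "kernel_average s scale_deriv G y = (LBINT z. G z * deriv_along (1, 0, 0) transport_flux (rel_pos s y z)
     + (\<Sum>i\<in>UNIV. G z * lifted_velocity (axis i 1) (velocity_flux i) (rel_pos s y z)))"
    by (simp add: kernel_average_def scale_deriv_eq_divergence distrib_left sum_distrib_left)
  also have "\<dots> = kernel_average s (deriv_along (1, 0, 0) transport_flux) G y
     + (\<Sum>i\<in>UNIV. kernel_average s (lifted_velocity (axis i 1) (velocity_flux i)) G y)"
    unfolding kernel_average_def
    by (intro integral_add_sum I elem_smooth_deriv_along elem_smooth_lifted_velocity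
      elem_smooth_transport_flux elem_smooth_velocity_flux)
  finally show ?thesis
    using s by (simp add: transport_kernel_average[OF elem_smooth_transport_flux G s]
        velocity_deriv_kernel_average[OF elem_smooth_velocity_flux G s] sum_negf sum_divide_distrib[symmetric])
qed

text \<open>The heart of the proof. With \<open>G = - 1\<^sub>A g\<^sub>s\<close> the left-hand side is, up to the factor
\<open>s\<^bsup>Q+1\<^esup> / 2\<close>, the rate at which the squared norm of \<open>g\<^sub>s\<close> over \<open>A\<close> decreases in \<open>s\<close>. Exchanging the
integrals moves the kernel onto \<open>G\<close>, the divergence form of the kernel turns it into
derivatives of kernel averages of \<open>G\<close>, and integration by parts moves these onto \<open>u\<close>.\<close>

lemma dissipation_bound:
  assumes u: "u \<in> kin_smooth D" and D: "D \<in> sets lebesgue" and N: "transport_dual_norm D u < \<infinity>"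
    and E: "compact E" "E \<subseteq> D" and s: "s > 0" and G: "bdd_borel G"
    and reach: "\<And>y z. G z \<noteq> 0 \<Longrightarrow> rel_pos s y z \<in> K \<Longrightarrow> y \<in> E"
  shows "(LBINT z. G z * (LBINT y. indicator E y * u y * scale_deriv (rel_pos s y z)))
     \<le> s ^ (hom_dim TYPE('d) + 1) * dissipation_const *
        (enn2real (kin_seminorm_smooth D u) * sqrt (LBINT z. (G z)\<^sup>2))"
proof -
  define h where "h = kernel_average s transport_flux G"
  define k where "k i = kernel_average s (velocity_flux i) G" for i
  define nG where "nG = sqrt (LBINT z. (G z)\<^sup>2)"
  define Q where "Q = hom_dim TYPE('d)"
  have nG: "nG \<ge> 0" by (simp add: nG_def)
  have uE: "smooth_on_set u E" using u E(2) by (auto simp: kin_smooth_def smooth_on_set_def)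
  obtain U where U: "open U" "E \<subseteq> U"
    and du: "\<And>z. z \<in> U \<Longrightarrow> (u has_derivative (\<lambda>e. deriv_along e u z)) (at z)"
    and cu: "continuous_on U u" and cdu: "\<And>e. continuous_on U (deriv_along e u)"
    using smooth_on_set_obtains[OF uE] by metis
  have h: "smooth_on_set h UNIV" and k: "smooth_on_set (k i) UNIV" for i
    unfolding h_def k_def
    by (intro smooth_kernel_average elem_smooth_transport_flux elem_smooth_velocity_flux G)+
  have vh: "smooth_on_set (\<lambda>y. snd (snd y) $ i * h y) UNIV" for i
    unfolding h_def by (intro smooth_velocity_mult_kernel_average elem_smooth_transport_flux G)
  have hs: "h y = 0" if "y \<notin> E" for y
    unfolding h_def by (rule kernel_average_support, erule flux_support(2), erule (1) reach, rule that)
  have ks: "k i y = 0" if "y \<notin> E" for y i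
    unfolding k_def by (rule kernel_average_support, erule flux_support(3), erule (1) reach, rule that)
  have bu: "bdd_borel (\<lambda>y. indicator E y * u y)"
    by (intro bdd_borel_indicator_continuous E continuous_on_subset[OF cu U(2)])
  have bdu: "bdd_borel (\<lambda>y. indicator E y * deriv_along e u y)" for e
    by (intro bdd_borel_indicator_continuous E continuous_on_subset[OF cdu U(2)])
  have bt: "bdd_borel (\<lambda>y. indicator E y * transport u y)"
    by (intro bdd_borel_indicator_continuous E continuous_on_subset[OF continuous_on_transport[OF U(1) du cdu] U(2)])
  have bk: "bdd_borel (k i)" for i
    by (rule bdd_borel_continuous_support[OF E(1) smooth_UNIV(2)[OF k] ks])
  have I: "integrable lborel (\<lambda>z. indicator E z * u z * f z)" if "continuous_on UNIV f" for f
    by (intro bdd_borel_integrable bdd_borel_mult_continuous bu that)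

  have "(LBINT z. G z * (LBINT y. indicator E y * u y * scale_deriv (rel_pos s y z)))
     = (LBINT y. indicator E y * u y * kernel_average s scale_deriv G y)"
    unfolding kernel_average_def
    using bdd_borel_Fubini[OF bu G elem_smooth_continuous[OF elem_smooth_rel_pos[OF elem_smooth_scale_deriv]], of s] by simp
  also have "\<dots> = (LBINT y. - (s\<^sup>2) * (indicator E y * u y * transport h y)
       + (\<Sum>i\<in>UNIV. - s * (indicator E y * u y * deriv_along (0, 0, axis i 1) (k i) y)))"
    unfolding kernel_average_scale_deriv[OF G s] h_def[symmetric] k_def[symmetric]
    by (intro Bochner_Integration.integral_cong refl) (simp add: algebra_simps sum_distrib_left sum_negf)
  also have "\<dots> = - (s\<^sup>2) * (LBINT y. indicator E y * u y * transport h y)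
       + (\<Sum>i\<in>UNIV. - s * (LBINT y. indicator E y * u y * deriv_along (0, 0, axis i 1) (k i) y))"
    by (subst integral_add_sum)
       (auto intro!: integrable_mult_right I continuous_on_transport[OF open_UNIV smooth_UNIV(1)[OF h] smooth_UNIV(3)[OF h]] smooth_UNIV(3)[OF k]
         simp del: of_bool_eq)
  also have "\<dots> = s\<^sup>2 * (LBINT y. indicator E y * transport u y * h y)
       + s * (\<Sum>i\<in>UNIV. (LBINT y. indicator E y * deriv_along (0, 0, axis i 1) u y * k i y))"
  proof -
    have "(LBINT y. indicator E y * u y * transport h y) = - (LBINT y. indicator E y * transport u y * h y)"
      by (rule transport_by_parts[OF uE E(1) h vh]) (erule hs)
    moreover have "(LBINT y. indicator E y * u y * deriv_along (0, 0, axis i 1) (k i) y)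
        = - (LBINT y. indicator E y * deriv_along (0, 0, axis i 1) u y * k i y)" for i
      by (rule integration_by_parts[OF uE E(1) k]) (erule ks)
    ultimately show ?thesis by (simp add: sum_distrib_left)
  qed
  finally have J: "(LBINT z. G z * (LBINT y. indicator E y * u y * scale_deriv (rel_pos s y z))) = \<dots>" .

  let ?a = "\<lambda>i. \<integral>w. \<bar>lifted_velocity (axis i 1) transport_flux w\<bar> \<partial>lborel"
  let ?b = "\<lambda>i. \<integral>w. \<bar>velocity_flux i w\<bar> \<partial>lborel"
  let ?N = "enn2real (transport_dual_norm D u)"
  have b0: "?b i \<ge> 0" for i by (intro Bochner_Integration.integral_nonneg) simp
  have "(LBINT y. indicator E y * transport u y * h y) = (\<integral>y. transport u y * h y \<partial>lebesgue_on D)"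
  proof -
    have eq: "(\<lambda>y. transport u y * h y) = (\<lambda>y. indicator E y * transport u y * h y)"
      using hs by (auto simp: fun_eq_iff indicator_def)
    show ?thesis
      unfolding eq
    proof (rule integral_lebesgue_on_support[OF D, symmetric])
      show "(\<lambda>y. indicator E y * transport u y * h y) \<in> borel_measurable borel"
        by (intro bdd_borel_measurable bdd_borel_mult_continuous bt smooth_UNIV(2)[OF h])
      show "indicator E y * transport u y * h y = 0" if "y \<notin> D" for y
        using that E(2) hs[of y] by auto
    qed
  qed
  also have "\<dots> \<le> ?N * sqrt (LBINT y. (norm (grad_v h y))\<^sup>2)"
    by (rule transport_pairing_le[OF D E h hs N])
  \<comment> \<open>a velocity derivative of the kernel at scale \<open>s\<close> costs one power of \<open>s\<close>, which the factor \<open>s\<^sup>2\<close> of this term in \<open>J\<close> makes up for\<close>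
  also have "\<dots> \<le> ?N * (s ^ Q / s * sqrt (\<Sum>i\<in>UNIV. (?a i)\<^sup>2) * nG)"
  proof (intro mult_left_mono)
    have di: "deriv_along (0, 0, axis i 1) h y = - (1 / s) * kernel_average s (lifted_velocity (axis i 1) transport_flux) G y" for i y
      unfolding h_def by (rule velocity_deriv_kernel_average[OF elem_smooth_transport_flux G s])
    let ?l = "\<lambda>i. lifted_velocity (axis i 1) transport_flux"
    have es: "elem_smooth (?l i)" for i by (intro elem_smooth_lifted_velocity elem_smooth_transport_flux)
    have ls: "kernel_average s (?l i) G y = 0" if "y \<notin> E" for y i
      by (rule kernel_average_support, erule flux_support(4), erule (1) reach, rule that)
    have bl: "bdd_borel (kernel_average s (?l i) G)" for i
      by (rule bdd_borel_continuous_support[OF E(1) smooth_UNIV(2)[OF smooth_kernel_average[OF es G]] ls])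
    have sq: "(LBINT y. (kernel_average s (?l i) G y)\<^sup>2) \<le> (s ^ Q * ?a i * nG)\<^sup>2" for i
      using kernel_average_L2[OF es bdd_borel_of_support[OF es flux_support(4)] G s bl]
      unfolding nG_def Q_def by (rule sqrt_le_D)
    have "(LBINT y. (norm (grad_v h y))\<^sup>2) = (\<Sum>i\<in>UNIV. (1 / s)\<^sup>2 * (LBINT y. (kernel_average s (?l i) G y)\<^sup>2))"
    proof -
      have "(LBINT y. (norm (grad_v h y))\<^sup>2) = (LBINT y. (\<Sum>i\<in>UNIV. (1 / s)\<^sup>2 * (kernel_average s (?l i) G y)\<^sup>2))"
        by (simp add: norm_grad_v di power_mult_distrib power_divide)
      also have "\<dots> = (\<Sum>i\<in>UNIV. \<integral>y. (1 / s)\<^sup>2 * (kernel_average s (?l i) G y)\<^sup>2 \<partial>lborel)"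
        by (intro Bochner_Integration.integral_sum integrable_mult_right bdd_borel_integrable)
           (simp add: power2_eq_square bdd_borel_mult bl)
      finally show ?thesis by simp
    qed
    also have "\<dots> \<le> (\<Sum>i\<in>UNIV. (1 / s)\<^sup>2 * (s ^ Q * ?a i * nG)\<^sup>2)"
      by (intro sum_mono mult_left_mono sq) simp
    also have "\<dots> = (s ^ Q / s * nG)\<^sup>2 * (\<Sum>i\<in>UNIV. (?a i)\<^sup>2)"
      by (simp add: sum_distrib_left sum_divide_distrib power_mult_distrib power_divide mult_ac)
    finally have "sqrt (LBINT y. (norm (grad_v h y))\<^sup>2) \<le> sqrt ((s ^ Q / s * nG)\<^sup>2 * (\<Sum>i\<in>UNIV. (?a i)\<^sup>2))"
      by (rule real_sqrt_le_mono)
    also have "\<dots> = s ^ Q / s * sqrt (\<Sum>i\<in>UNIV. (?a i)\<^sup>2) * nG"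
      using s nG by (simp add: real_sqrt_mult mult_ac)
    finally show "sqrt (LBINT y. (norm (grad_v h y))\<^sup>2) \<le> s ^ Q / s * sqrt (\<Sum>i\<in>UNIV. (?a i)\<^sup>2) * nG" .
  qed (rule enn2real_nonneg)
  finally have T1: "s\<^sup>2 * (LBINT y. indicator E y * transport u y * h y)
      \<le> s\<^sup>2 * (?N * (s ^ Q / s * sqrt (\<Sum>i\<in>UNIV. (?a i)\<^sup>2) * nG))"
    by (rule mult_left_mono) simp

  have T2: "(LBINT y. indicator E y * deriv_along (0, 0, axis i 1) u y * k i y)
      \<le> L2_norm D (grad_v u) * (s ^ Q * ?b i * nG)" for i
  proof -
    have "(LBINT y. indicator E y * deriv_along (0, 0, axis i 1) u y * k i y)
       \<le> sqrt (LBINT y. (indicator E y * deriv_along (0, 0, axis i 1) u y)\<^sup>2) * sqrt (LBINT y. (k i y)\<^sup>2)"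
      by (rule Cauchy_Schwarz_integral)
         (use bdd_borel_measurable[OF bdu] bdd_borel_measurable[OF bk]
            bdd_borel_integrable[OF bdd_borel_mult[OF bdu bdu]] bdd_borel_integrable[OF bdd_borel_mult[OF bk bk]]
          in \<open>simp_all add: power2_eq_square\<close>)
    also have "\<dots> \<le> L2_norm D (grad_v u) * (s ^ Q * ?b i * nG)"
    proof (intro mult_mono)
      show "sqrt (LBINT y. (k i y)\<^sup>2) \<le> s ^ Q * ?b i * nG"
        unfolding k_def Q_def nG_def
        by (rule kernel_average_L2[OF elem_smooth_velocity_flux bdd_borel_of_support[OF elem_smooth_velocity_flux flux_support(3)] G s
              bk[unfolded k_def]])
      have g2: "integrable (lebesgue_on D) (\<lambda>z. (norm (grad_v u z))\<^sup>2)"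
        using u by (simp add: kin_smooth_def in_L2_def)
      have b2: "bdd_borel (\<lambda>y. (indicator E y * deriv_along (0, 0, axis i 1) u y)\<^sup>2)"
        unfolding power2_eq_square by (intro bdd_borel_mult bdu)
      have "(LBINT y. (indicator E y * deriv_along (0, 0, axis i 1) u y)\<^sup>2)
          = (\<integral>y. (indicator E y * deriv_along (0, 0, axis i 1) u y)\<^sup>2 \<partial>lebesgue_on D)"
        by (rule integral_lebesgue_on_support[OF D bdd_borel_measurable[OF b2], symmetric])
           (use E(2) in \<open>auto simp: indicator_def\<close>)
      also have "\<dots> \<le> (\<integral>y. (norm (grad_v u y))\<^sup>2 \<partial>lebesgue_on D)"
      proof (rule Bochner_Integration.integral_mono'[OF g2])
        fix y
        have "(deriv_along (0, 0, axis i 1) u y)\<^sup>2 \<le> (norm (grad_v u y))\<^sup>2"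
          unfolding norm_grad_v by (rule member_le_sum) auto
        then show "(indicator E y * deriv_along (0, 0, axis i 1) u y)\<^sup>2 \<le> (norm (grad_v u y))\<^sup>2"
          by (simp add: indicator_def)
      qed simp
      finally show "sqrt (LBINT y. (indicator E y * deriv_along (0, 0, axis i 1) u y)\<^sup>2) \<le> L2_norm D (grad_v u)"
        unfolding L2_norm_def by (rule real_sqrt_le_mono)
    qed (auto simp: L2_norm_def)
    finally show ?thesis .
  qed
  have "s * (\<Sum>i\<in>UNIV. (LBINT y. indicator E y * deriv_along (0, 0, axis i 1) u y * k i y))
     \<le> s * (\<Sum>i\<in>UNIV. L2_norm D (grad_v u) * (s ^ Q * ?b i * nG))"
    using s by (intro mult_left_mono sum_mono T2) simp
  with T1 J have "(LBINT z. G z * (LBINT y. indicator E y * u y * scale_deriv (rel_pos s y z)))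
     \<le> s\<^sup>2 * (?N * (s ^ Q / s * sqrt (\<Sum>i\<in>UNIV. (?a i)\<^sup>2) * nG))
       + s * (\<Sum>i\<in>UNIV. L2_norm D (grad_v u) * (s ^ Q * ?b i * nG))"
    by linarith
  also have "\<dots> = s ^ (Q + 1) * nG * (sqrt (\<Sum>i\<in>UNIV. (?a i)\<^sup>2) * ?N + (\<Sum>i\<in>UNIV. ?b i) * L2_norm D (grad_v u))"
    using s by (simp add: sum_distrib_left sum_distrib_right power2_eq_square algebra_simps)
  also have "\<dots> \<le> s ^ (Q + 1) * nG * (dissipation_const * ?N + dissipation_const * L2_norm D (grad_v u))"
    unfolding dissipation_const_def using s nG b0
    by (intro mult_left_mono add_mono mult_right_mono)
       (auto intro!: sum_nonneg simp: L2_norm_def)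
  finally have "(LBINT z. G z * (LBINT y. indicator E y * u y * scale_deriv (rel_pos s y z)))
      \<le> s ^ (Q + 1) * nG * (dissipation_const * ?N + dissipation_const * L2_norm D (grad_v u))" .
  moreover have "enn2real (kin_seminorm_smooth D u) = L2_norm D (grad_v u) + ?N"
    unfolding kin_seminorm_smooth_def using N
    by (simp add: enn2real_plus enn2real_ennreal[OF L2_norm_nonneg])
  ultimately show ?thesis
    unfolding Q_def nG_def by (simp add: algebra_simps)
qed

end

section \<open>The reachable set\<close>

lemma kin_comp_inv_dilation:
  "kin_comp z (kin_inv (dilation e w)) =
    (fst z - e ^ 2 * fst w,
     fst (snd z) - e ^ 3 *\<^sub>R fst (snd w) + (e ^ 2 * fst w) *\<^sub>R (e *\<^sub>R snd (snd w)) - (e ^ 2 * fst w) *\<^sub>R snd (snd z),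
     snd (snd z) - e *\<^sub>R snd (snd w))"
  by (cases z; cases w) (auto simp: algebra_simps)

text \<open>All points over which a mollification at a scale at most \<open>s\<close> averages when it is evaluated in \<open>A\<close>.
The scale zero is included, which makes the set compact and makes it contain \<open>A\<close>.\<close>

definition reach :: "'d::finite kpoint set \<Rightarrow> 'd kpoint set \<Rightarrow> real \<Rightarrow> 'd kpoint set" where
  "reach A K s = (\<lambda>p. kin_comp (fst p) (kin_inv (dilation (fst (snd p)) (snd (snd p))))) ` (A \<times> {0..s} \<times> K)"

lemma compact_reach:
  assumes "compact A" "compact K"
  shows "compact (reach A K s)"
  unfolding reach_def kin_comp_inv_dilation
  by (intro compact_continuous_image compact_Times assms compact_Icc continuous_intros)

lemma reach_subset:
  assumes "\<And>\<sigma>. \<sigma> \<in> {0..s} \<Longrightarrow> set_comp A (kin_inv ` (dilation \<sigma> ` B)) \<subseteq> D" "K \<subseteq> B"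
  shows "reach A K s \<subseteq> D"
proof
  fix y assume "y \<in> reach A K s"
  then obtain z \<sigma> w where *: "z \<in> A" "\<sigma> \<in> {0..s}" "w \<in> K" "y = kin_comp z (kin_inv (dilation \<sigma> w))"
    by (auto simp: reach_def)
  then have "y \<in> set_comp A (kin_inv ` (dilation \<sigma> ` B))"
    using assms(2) unfolding set_comp_def by blast
  then show "y \<in> D" using assms(1) *(2) by blast
qed

lemma mem_reach:
  assumes "z \<in> A" "0 < \<sigma>" "\<sigma> \<le> s" "rel_pos \<sigma> y z \<in> K"
  shows "y \<in> reach A K s"
  unfolding reach_def
  by (rule image_eqI[of _ _ "(z, \<sigma>, rel_pos \<sigma> y z)"])
     (use assms kin_comp_inv_rel_pos[of \<sigma> z y] in auto)

lemma subset_reach: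
  assumes "K \<noteq> {}" "0 \<le> s"
  shows "A \<subseteq> reach A K s"
proof
  fix z assume "z \<in> A"
  obtain w where "w \<in> K" using assms(1) by blast
  then show "z \<in> reach A K s"
    unfolding reach_def using \<open>z \<in> A\<close> assms(2)
    by (intro image_eqI[of _ _ "(z, 0, w)"]) (auto simp: kin_comp_inv_dilation)
qed

text \<open>The map \<open>(e, w) \<mapsto> z \<circ> (\<delta>\<^sub>e w)\<^sup>-\<^sup>1\<close> is uniformly continuous on a compact set and equals \<open>z\<close> at \<open>e = 0\<close>.\<close>

lemma rel_pos_source_near:
  assumes "compact K" "\<delta> > 0"
  obtains e0 where "e0 > 0" "\<And>e y. 0 < e \<Longrightarrow> e < e0 \<Longrightarrow> rel_pos e y z \<in> K \<Longrightarrow> dist y z < \<delta>"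
proof -
  let ?f = "\<lambda>p. kin_comp z (kin_inv (dilation (fst p) (snd p)))"
  have "uniformly_continuous_on ({0..1} \<times> K) ?f"
    unfolding kin_comp_inv_dilation
    by (intro compact_uniformly_continuous compact_Times assms compact_Icc continuous_intros)
  then obtain d where d: "d > 0" "\<And>p q. p \<in> {0..1} \<times> K \<Longrightarrow> q \<in> {0..1} \<times> K \<Longrightarrow> dist q p < d \<Longrightarrow> dist (?f q) (?f p) < \<delta>"
    unfolding uniformly_continuous_on_def using assms(2) by metis
  show ?thesis
  proof (rule that[of "min 1 d"])
    fix e y assume e: "0 < e" "e < min 1 d" and K: "rel_pos e y z \<in> K"
    have "dist (?f (e, rel_pos e y z)) (?f (0, rel_pos e y z)) < \<delta>"
      using e K by (intro d(2)) (auto simp: dist_Pair_Pair)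
    moreover have "?f (e, rel_pos e y z) = y" using kin_comp_inv_rel_pos[of e z y] e by simp
    moreover have "?f (0, rel_pos e y z) = z" by (simp add: kin_comp_inv_dilation)
    ultimately show "dist y z < \<delta>" by simp
  qed (use d in simp)
qed

section \<open>Kinetic mollification\<close>

lemma ennreal_power2_add_le: "(a + b)\<^sup>2 \<le> 2 * a\<^sup>2 + 2 * (b::ennreal)\<^sup>2"
proof (cases a; cases b)
  fix x y :: real assume xy: "a = ennreal x" "b = ennreal y" "0 \<le> x" "0 \<le> y"
  have "(x + y)\<^sup>2 \<le> 2 * x\<^sup>2 + 2 * y\<^sup>2"
    using sum_squares_bound[of x y] by (simp add: power2_sum)
  then have "ennreal ((x + y)\<^sup>2) \<le> ennreal (2 * x\<^sup>2 + 2 * y\<^sup>2)" by (rule ennreal_leI)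
  also have "\<dots> = 2 * ennreal (x\<^sup>2) + 2 * ennreal (y\<^sup>2)"
    by (simp add: ennreal_mult)
  finally show ?thesis
    using xy by (simp add: ennreal_power ennreal_plus[symmetric] del: ennreal_plus)
qed (auto simp: ennreal_mult_top power2_eq_square ennreal_top_mult)

context mollifier
begin

definition mean :: "real \<Rightarrow> ('d kpoint \<Rightarrow> real) \<Rightarrow> 'd kpoint \<Rightarrow> real" where
  "mean s f z = (LBINT y. f y * (\<phi> (rel_pos s y z) / s ^ hom_dim TYPE('d)))"

abbreviation mean_kernel :: "real \<Rightarrow> 'd kpoint \<Rightarrow> 'd kpoint \<Rightarrow> ennreal" where
  "mean_kernel s y z \<equiv> ennreal (\<phi> (rel_pos s y z) / s ^ hom_dim TYPE('d))"

lemma K_nonempty: "K \<noteq> {}"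
proof
  assume "K = {}"
  then have "\<phi> w = 0" for w using supp by simp
  then show False using nn_integral_1 by (simp del: split_paired_All)
qed

lemma bdd_borel_bump: "bdd_borel \<phi>"
  by (rule bdd_borel_of_support[OF smooth supp])

lemma mean_kernel_measurable: "(\<lambda>p. mean_kernel s (fst p) (snd p)) \<in> borel_measurable borel"
  using elem_smooth_measurable[OF elem_smooth_rel_pos[OF smooth, of s]] by measurable

lemma mean_kernel_mass:
  assumes s: "s > 0"
  shows "(\<integral>\<^sup>+y. mean_kernel s y z \<partial>lborel) = 1" "(\<integral>\<^sup>+z. mean_kernel s y z \<partial>lborel) = 1"
proof -
  have m: "(\<lambda>w. ennreal (\<phi> w)) \<in> borel_measurable borel"
    using elem_smooth_measurable[OF smooth] by measurable
  have k: "mean_kernel s y z = ennreal (1 / s ^ hom_dim TYPE('d)) * ennreal (\<phi> (rel_pos s y z))" for y z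
    using s nonneg by (simp add: ennreal_mult[symmetric])
  have "ennreal (1 / s ^ hom_dim TYPE('d)) * ennreal (s ^ hom_dim TYPE('d)) = 1"
    using s by (simp add: ennreal_mult[symmetric])
  then show "(\<integral>\<^sup>+y. mean_kernel s y z \<partial>lborel) = 1" "(\<integral>\<^sup>+z. mean_kernel s y z \<partial>lborel) = 1"
    unfolding k using nn_integral_rel_pos(1)[OF m s, of z] nn_integral_rel_pos(2)[OF m s, of y]
      borel_measurable_section[OF measurable_compose[OF borel_measurable_continuous_onI[OF elem_smooth_continuous[OF elem_smooth_rel_pos[OF smooth, of s]]] measurable_ennreal]]
    by (simp_all add: nn_integral_cmult nn_integral_1)
qed

lemma ennreal_abs_mean_le:
  assumes s: "s > 0"
  shows "ennreal \<bar>mean s f z\<bar> \<le> (\<integral>\<^sup>+y. ennreal \<bar>f y\<bar> * mean_kernel s y z \<partial>lborel)"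
proof -
  have "ennreal \<bar>f y * (\<phi> (rel_pos s y z) / s ^ hom_dim TYPE('d))\<bar> = ennreal \<bar>f y\<bar> * mean_kernel s y z" for y
    using s nonneg by (subst ennreal_mult[symmetric]) (simp_all add: abs_mult)
  then show ?thesis
    using ennreal_abs_integral_le[of lborel "\<lambda>y. f y * (\<phi> (rel_pos s y z) / s ^ hom_dim TYPE('d))"]
    by (simp only: mean_def)
qed

lemma mean_L2_le:
  assumes s: "s > 0" and f: "f \<in> borel_measurable borel"
  shows "(\<integral>\<^sup>+z. (ennreal \<bar>mean s f z\<bar>)\<^sup>2 \<partial>lborel) \<le> (\<integral>\<^sup>+y. (ennreal \<bar>f y\<bar>)\<^sup>2 \<partial>lborel)"
proof -
  note [measurable] = f
  have "(\<integral>\<^sup>+z. (ennreal \<bar>mean s f z\<bar>)\<^sup>2 \<partial>lborel)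
      \<le> (\<integral>\<^sup>+z. (\<integral>\<^sup>+y. ennreal \<bar>f y\<bar> * mean_kernel s y z \<partial>lborel)\<^sup>2 \<partial>lborel)"
    by (intro nn_integral_mono power_mono ennreal_abs_mean_le s) simp
  also have "\<dots> \<le> 1 * 1 * (\<integral>\<^sup>+y. (ennreal \<bar>f y\<bar>)\<^sup>2 \<partial>lborel)"
    by (rule Schur_test[OF mean_kernel_measurable]) (simp_all add: mean_kernel_mass[OF s])
  finally show ?thesis by simp
qed

text \<open>Of the two parts of \<open>f\<close>, one is controlled in \<open>L\<^sup>2\<close> by the unit mass of the kernel, the other one in
\<open>L\<^sup>1\<close> by its height. The split is needed because only the limit of an approximating sequence, not its
members, is controlled in \<open>L\<^sup>1\<close>.\<close>

lemma mean_L2_le_split: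
  assumes s: "s > 0" and f: "f \<in> borel_measurable borel"
    and [measurable]: "p \<in> borel_measurable borel" "q \<in> borel_measurable borel"
    and le: "\<And>y. ennreal \<bar>f y\<bar> \<le> p y + q y" and S: "\<And>w. \<phi> w \<le> S"
  shows "(\<integral>\<^sup>+z. (ennreal \<bar>mean s f z\<bar>)\<^sup>2 \<partial>lborel) \<le>
     2 * (\<integral>\<^sup>+y. (p y)\<^sup>2 \<partial>lborel) + 2 * (ennreal (S / s ^ hom_dim TYPE('d)) * (\<integral>\<^sup>+y. q y \<partial>lborel)\<^sup>2)"
proof -
  let ?k = "mean_kernel s"
  note km = borel_measurable_section[OF mean_kernel_measurable[of s]]
  note [measurable] = km
  note meas = borel_measurable_kernel_nn_integral[OF mean_kernel_measurable[of s]]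
  have "(ennreal \<bar>mean s f z\<bar>)\<^sup>2 \<le> 2 * (\<integral>\<^sup>+y. p y * ?k y z \<partial>lborel)\<^sup>2 + 2 * (\<integral>\<^sup>+y. q y * ?k y z \<partial>lborel)\<^sup>2" for z
  proof -
    have "ennreal \<bar>mean s f z\<bar> \<le> (\<integral>\<^sup>+y. ennreal \<bar>f y\<bar> * ?k y z \<partial>lborel)"
      by (rule ennreal_abs_mean_le[OF s])
    also have "\<dots> \<le> (\<integral>\<^sup>+y. p y * ?k y z + q y * ?k y z \<partial>lborel)"
      unfolding distrib_right[symmetric] by (intro nn_integral_mono mult_right_mono le) simp
    also have "\<dots> = (\<integral>\<^sup>+y. p y * ?k y z \<partial>lborel) + (\<integral>\<^sup>+y. q y * ?k y z \<partial>lborel)"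
      by (rule nn_integral_add) simp_all
    finally have "(ennreal \<bar>mean s f z\<bar>)\<^sup>2 \<le> ((\<integral>\<^sup>+y. p y * ?k y z \<partial>lborel) + (\<integral>\<^sup>+y. q y * ?k y z \<partial>lborel))\<^sup>2"
      by (intro power_mono) simp_all
    then show ?thesis using ennreal_power2_add_le order_trans by blast
  qed
  then have "(\<integral>\<^sup>+z. (ennreal \<bar>mean s f z\<bar>)\<^sup>2 \<partial>lborel) \<le>
     (\<integral>\<^sup>+z. 2 * (\<integral>\<^sup>+y. p y * ?k y z \<partial>lborel)\<^sup>2 + 2 * (\<integral>\<^sup>+y. q y * ?k y z \<partial>lborel)\<^sup>2 \<partial>lborel)"
    by (intro nn_integral_mono)
  also have "\<dots> = 2 * (\<integral>\<^sup>+z. (\<integral>\<^sup>+y. p y * ?k y z \<partial>lborel)\<^sup>2 \<partial>lborel)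
      + 2 * (\<integral>\<^sup>+z. (\<integral>\<^sup>+y. q y * ?k y z \<partial>lborel)\<^sup>2 \<partial>lborel)"
    using meas[of p] meas[of q] by (simp add: nn_integral_add nn_integral_cmult)
  also have "\<dots> \<le> 2 * (1 * 1 * (\<integral>\<^sup>+y. (p y)\<^sup>2 \<partial>lborel))
      + 2 * (1 * ennreal (S / s ^ hom_dim TYPE('d)) * (\<integral>\<^sup>+y. q y \<partial>lborel)\<^sup>2)"
  proof (intro add_mono mult_left_mono)
    show "(\<integral>\<^sup>+z. (\<integral>\<^sup>+y. p y * ?k y z \<partial>lborel)\<^sup>2 \<partial>lborel) \<le> 1 * 1 * (\<integral>\<^sup>+y. (p y)\<^sup>2 \<partial>lborel)"
      by (rule Schur_test[OF mean_kernel_measurable]) (simp_all add: mean_kernel_mass[OF s])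
    show "(\<integral>\<^sup>+z. (\<integral>\<^sup>+y. q y * ?k y z \<partial>lborel)\<^sup>2 \<partial>lborel) \<le> 1 * ennreal (S / s ^ hom_dim TYPE('d)) * (\<integral>\<^sup>+y. q y \<partial>lborel)\<^sup>2"
      by (rule nn_integral_kernel_L1_L2[OF mean_kernel_measurable])
         (simp, simp add: mean_kernel_mass[OF s], intro ennreal_leI divide_right_mono S, use s in simp)
  qed simp_all
  finally show ?thesis by simp
qed

lemma abs_mean_le:
  assumes s: "s > 0" and f: "\<And>y. \<bar>f y\<bar> \<le> R"
  shows "\<bar>mean s f z\<bar> \<le> R"
proof -
  have R: "R \<ge> 0" using f[of undefined] by linarith
  have "ennreal \<bar>mean s f z\<bar> \<le> (\<integral>\<^sup>+y. ennreal \<bar>f y\<bar> * mean_kernel s y z \<partial>lborel)"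
    by (rule ennreal_abs_mean_le[OF s])
  also have "\<dots> \<le> (\<integral>\<^sup>+y. ennreal R * mean_kernel s y z \<partial>lborel)"
    by (intro nn_integral_mono mult_right_mono ennreal_leI f) simp
  also have "\<dots> = ennreal R"
    using borel_measurable_section(1)[OF mean_kernel_measurable[of s], of z]
    by (simp add: nn_integral_cmult mean_kernel_mass[OF s])
  finally show ?thesis using R by (simp add: ennreal_le_iff)
qed

lemma mean_minus_const:
  assumes s: "s > 0" and f: "bdd_borel f"
  shows "mean s f z - c = mean s (\<lambda>y. f y - c) z"
proof -
  have k: "integrable lborel (\<lambda>y. \<phi> (rel_pos s y z) / s ^ hom_dim TYPE('d))"
    using elem_smooth_measurable[OF elem_smooth_rel_pos[OF smooth, of s]] nonneg s
      mean_kernel_mass(1)[OF s, of z] borel_measurable_section(1)[of "\<lambda>y z. \<phi> (rel_pos s y z)" z]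
    by (intro integrableI_nonneg) auto
  have "(\<integral>\<^sup>+y. mean_kernel s y z \<partial>lborel) = ennreal (LBINT y. \<phi> (rel_pos s y z) / s ^ hom_dim TYPE('d))"
    by (intro nn_integral_eq_integral k always_eventually allI divide_nonneg_nonneg nonneg) (use s in simp)
  then have "(LBINT y. \<phi> (rel_pos s y z) / s ^ hom_dim TYPE('d)) = 1"
    unfolding mean_kernel_mass(1)[OF s] by (metis ennreal_eq_1)
  moreover have "integrable lborel (\<lambda>y. f y * (\<phi> (rel_pos s y z) / s ^ hom_dim TYPE('d)))"
    using elem_smooth_continuous[OF elem_smooth_rel_pos[OF smooth], of UNIV s] s
    by (intro bdd_borel_integrable bdd_borel_mult_continuous[OF f] continuous_intros)
       (auto intro!: continuous_on_compose2[where f="\<lambda>y. (y, z)" and g="\<lambda>p. \<phi> (rel_pos s (fst p) (snd p))", simplified] continuous_intros)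
  moreover define \<kappa> where "\<kappa> y = \<phi> (rel_pos s y z) / s ^ hom_dim TYPE('d)" for y
  ultimately show ?thesis
    using k unfolding mean_def \<kappa>_def[symmetric] by (simp add: left_diff_distrib)
qed

text \<open>The kernel has mass one and for small \<open>\<sigma>\<close> lives on points \<open>y\<close> of \<open>E\<close> close to \<open>z\<close>, where \<open>f\<close> is
close to \<open>f z\<close>.\<close>

lemma mean_tendsto:
  assumes f: "bdd_borel f" and E: "continuous_on E f" and z: "z \<in> E" and s: "s > 0"
    and reach: "\<And>\<sigma> y. 0 < \<sigma> \<Longrightarrow> \<sigma> \<le> s \<Longrightarrow> rel_pos \<sigma> y z \<in> K \<Longrightarrow> y \<in> E"
  shows "((\<lambda>\<sigma>. mean \<sigma> f z) \<longlongrightarrow> f z) (at_right 0)"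
proof (rule tendstoI)
  fix \<eta> :: real assume \<eta>: "\<eta> > 0"
  obtain \<delta> where \<delta>: "\<delta> > 0" "\<And>y. y \<in> E \<Longrightarrow> dist y z < \<delta> \<Longrightarrow> dist (f y) (f z) < \<eta> / 2"
    using E z \<eta> unfolding continuous_on_iff by (metis half_gt_zero)
  obtain e0 where e0: "e0 > 0" "\<And>e y. 0 < e \<Longrightarrow> e < e0 \<Longrightarrow> rel_pos e y z \<in> K \<Longrightarrow> dist y z < \<delta>"
    using rel_pos_source_near[OF compact_K \<delta>(1)] by metis
  have "dist (mean \<sigma> f z) (f z) < \<eta>" if \<sigma>: "0 < \<sigma>" "\<sigma> < min e0 s" for \<sigma>
  proof -
    have "mean \<sigma> f z - f z = mean \<sigma> (\<lambda>y. if rel_pos \<sigma> y z \<in> K then f y - f z else 0) z"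
      unfolding mean_minus_const[OF \<sigma>(1) f] unfolding mean_def
      by (intro Bochner_Integration.integral_cong) (auto simp: supp)
    also have "\<bar>\<dots>\<bar> \<le> \<eta> / 2"
    proof (rule abs_mean_le[OF \<sigma>(1)])
      fix y
      show "\<bar>if rel_pos \<sigma> y z \<in> K then f y - f z else 0\<bar> \<le> \<eta> / 2"
        using \<delta>(2)[of y] e0(2)[of \<sigma> y] reach[of \<sigma> y] \<sigma> \<eta> by (auto simp: dist_real_def intro!: less_imp_le)
    qed
    finally show ?thesis using \<eta> by (simp add: dist_real_def)
  qed
  then show "\<forall>\<^sub>F \<sigma> in at_right 0. dist (mean \<sigma> f z) (f z) < \<eta>"
    unfolding eventually_at_right_field using e0(1) s by (intro exI[of _ "min e0 s"]) auto
qed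

end

section \<open>Dissipation along the scale\<close>

context mollifier
begin

definition mean_rate :: "real \<Rightarrow> ('d kpoint \<Rightarrow> real) \<Rightarrow> 'd kpoint \<Rightarrow> real" where
  "mean_rate s f z = (LBINT y. f y * scale_deriv (rel_pos s y z)) / s ^ (hom_dim TYPE('d) + 1)"

lemma scale_deriv_bound: obtains S where "\<And>w. \<bar>scale_deriv w\<bar> \<le> S" "S \<ge> 0"
proof -
  have "bdd_borel scale_deriv" by (rule bdd_borel_of_support[OF elem_smooth_scale_deriv flux_support(7)])
  then obtain S where S: "\<And>w. \<bar>scale_deriv w\<bar> \<le> S" unfolding bdd_borel_def by blast
  then show ?thesis using that[of S] abs_ge_zero order_trans by blast
qed

lemma bdd_borel_mult_kernel:
  assumes f: "bdd_borel f" and \<gamma>: "elem_smooth \<gamma>"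
  shows "bdd_borel (\<lambda>y. f y * \<gamma> (rel_pos s y z))"
  using elem_smooth_continuous[OF elem_smooth_rel_pos[OF \<gamma>], of UNIV s]
  by (intro bdd_borel_mult_continuous[OF f])
     (auto intro!: continuous_on_compose2[where f="\<lambda>y. (y, z)" and g="\<lambda>p. \<gamma> (rel_pos s (fst p) (snd p))", simplified] continuous_intros)

lemma abs_mean_rate_le:
  assumes f: "bdd_borel f" and S: "\<And>w. \<bar>scale_deriv w\<bar> \<le> S" and s: "0 < r" "r \<le> s"
  shows "\<bar>mean_rate s f z\<bar> \<le> (LBINT y. \<bar>f y\<bar> * S) / r ^ (hom_dim TYPE('d) + 1)"
proof -
  have S0: "S \<ge> 0" using S[of undefined] by linarith
  have "\<bar>\<integral>y. f y * scale_deriv (rel_pos s y z) \<partial>lborel\<bar> \<le> (LBINT y. \<bar>f y * scale_deriv (rel_pos s y z)\<bar>)"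
    using integral_norm_bound[of lborel "\<lambda>y. f y * scale_deriv (rel_pos s y z)"] by simp
  also have "\<dots> \<le> (LBINT y. \<bar>f y\<bar> * S)"
  proof (rule integral_mono)
    show "integrable lborel (\<lambda>y. \<bar>f y * scale_deriv (rel_pos s y z)\<bar>)"
      by (intro integrable_abs bdd_borel_integrable bdd_borel_mult_kernel f elem_smooth_scale_deriv)
    show "\<bar>f y * scale_deriv (rel_pos s y z)\<bar> \<le> \<bar>f y\<bar> * S" for y
      unfolding abs_mult by (intro mult_left_mono S) simp
  qed (use bdd_borel_integrable[OF f] in simp)
  finally have "\<bar>mean_rate s f z\<bar> \<le> (LBINT y. \<bar>f y\<bar> * S) / s ^ (hom_dim TYPE('d) + 1)"
    using s by (simp add: mean_rate_def divide_right_mono)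
  also have "\<dots> \<le> (LBINT y. \<bar>f y\<bar> * S) / r ^ (hom_dim TYPE('d) + 1)"
    using s S0 by (intro divide_left_mono power_mono Bochner_Integration.integral_nonneg mult_pos_pos zero_less_power) auto
  finally show ?thesis .
qed

lemma mean_has_real_derivative:
  assumes f: "bdd_borel f" and s: "s > 0"
  shows "((\<lambda>s. mean s f z) has_real_derivative mean_rate s f z) (at s)"
proof -
  let ?Q = "hom_dim TYPE('d)"
  obtain S where S: "\<And>w. \<bar>scale_deriv w\<bar> \<le> S" "S \<ge> 0" using scale_deriv_bound by metis
  have "((\<lambda>s. \<integral>y. f y * (\<phi> (rel_pos s y z) / s ^ ?Q) \<partial>lborel) has_derivative
     (\<lambda>e. \<integral>y. e * (f y * (scale_deriv (rel_pos s y z) / s ^ (?Q + 1))) \<partial>lborel)) (at s)"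
  proof (rule has_derivative_integral_dominated[where r="s / 2" and w="\<lambda>y. \<bar>f y\<bar> * (S / (s / 2) ^ (?Q + 1))"
        and f'="\<lambda>x y e. e * (f y * (scale_deriv (rel_pos x y z) / x ^ (?Q + 1)))"])
    fix x y assume x: "x \<in> ball s (s / 2)"
    then have x2: "s / 2 < x" by (auto simp: dist_real_def abs_if split: if_splits)
    then have x0: "0 < x" using s by linarith
    have "bdd_borel (\<lambda>y. f y * \<phi> (rel_pos x y z))"
      by (rule bdd_borel_mult_kernel[OF f smooth])
    from bdd_borel_integrable[OF this] 
    show "integrable lborel (\<lambda>y. f y * (\<phi> (rel_pos x y z) / x ^ ?Q))" by simp
    show "((\<lambda>x. f y * (\<phi> (rel_pos x y z) / x ^ ?Q)) has_derivative
       (\<lambda>e. e * (f y * (scale_deriv (rel_pos x y z) / x ^ (?Q + 1))))) (at x)"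
      using DERIV_cmult[OF has_real_derivative_mollifier_scale[OF x0, of y z], of "f y"]
      unfolding has_field_derivative_def by (rule has_derivative_eq_rhs) (simp add: fun_eq_iff)
    have "\<bar>scale_deriv (rel_pos x y z) / x ^ (?Q + 1)\<bar> \<le> S / (s / 2) ^ (?Q + 1)"
      unfolding abs_divide using x0 x2 s S by (intro frac_le) (auto simp del: power_Suc intro!: power_mono)
    then show "\<bar>e * (f y * (scale_deriv (rel_pos x y z) / x ^ (?Q + 1)))\<bar>
       \<le> \<bar>f y\<bar> * (S / (s / 2) ^ (?Q + 1)) * norm e" for e
      unfolding abs_mult real_norm_def by (subst mult.commute) (intro mult_right_mono mult_left_mono abs_ge_zero)
  next
    show "integrable lborel (\<lambda>y. \<bar>f y\<bar> * (S / (s / 2) ^ (?Q + 1)))"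
      using bdd_borel_integrable[OF f] by simp
    show "(\<lambda>y. e * (f y * (scale_deriv (rel_pos s y z) / s ^ (?Q + 1)))) \<in> borel_measurable lborel" for e
      using bdd_borel_measurable[OF bdd_borel_mult_kernel[OF f elem_smooth_scale_deriv, of s z]] by simp
  qed (use s in simp)
  then show ?thesis
    unfolding has_field_derivative_def mean_def mean_rate_def
    by (rule has_derivative_eq_rhs) (simp add: fun_eq_iff mult.commute)
qed

lemma bdd_borel_mean:
  assumes f: "bdd_borel f" and g: "bdd_borel g"
  shows "bdd_borel (\<lambda>z. g z * mean s f z)" "bdd_borel (\<lambda>z. g z * mean_rate s f z)"
proof -
  have *: "bdd_borel (\<lambda>z. g z * (LBINT y. f y * \<gamma> (rel_pos s y z)) * c)" if "elem_smooth \<gamma>" for \<gamma> c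
    using bdd_borel_mult_continuous[OF bdd_borel_kernel_integral[OF f g
        elem_smooth_continuous[OF elem_smooth_rel_pos[OF that]], of s], of "\<lambda>_. c"] by simp
  show "bdd_borel (\<lambda>z. g z * mean s f z)" "bdd_borel (\<lambda>z. g z * mean_rate s f z)"
    using *[OF smooth, of "1 / s ^ hom_dim TYPE('d)"] *[OF elem_smooth_scale_deriv, of "1 / s ^ (hom_dim TYPE('d) + 1)"]
    by (simp_all add: mean_def mean_rate_def)
qed

lemma bdd_borel_mean_square:
  assumes f: "bdd_borel f" and A: "bdd_borel (\<lambda>z. indicator A z :: real)"
  shows "bdd_borel (\<lambda>z. indicator A z * (mean s f z)\<^sup>2)"
proof -
  have "(\<lambda>z. indicator A z * (mean s f z)\<^sup>2) =
      (\<lambda>z. (indicator A z * mean s f z) * (indicator A z * mean s f z))"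
    by (auto simp: fun_eq_iff indicator_def power2_eq_square)
  then show ?thesis using bdd_borel_mult[OF bdd_borel_mean(1)[OF f A] bdd_borel_mean(1)[OF f A]] by (simp only:)
qed

lemma nn_integral_mean_square:
  assumes f: "bdd_borel f" and A: "bdd_borel (\<lambda>z. indicator A z :: real)"
  shows "ennreal (LBINT z. indicator A z * (mean s f z)\<^sup>2) \<le> (\<integral>\<^sup>+z. (ennreal \<bar>mean s f z\<bar>)\<^sup>2 \<partial>lborel)"
proof -
  have "ennreal (LBINT z. indicator A z * (mean s f z)\<^sup>2) = (\<integral>\<^sup>+z. ennreal (indicator A z * (mean s f z)\<^sup>2) \<partial>lborel)"
    by (rule nn_integral_bdd_borel_nonneg[OF bdd_borel_mean_square[OF f A], symmetric]) simp
  also have "\<dots> \<le> (\<integral>\<^sup>+z. (ennreal \<bar>mean s f z\<bar>)\<^sup>2 \<partial>lborel)"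
    by (intro nn_integral_mono) (auto simp: indicator_def ennreal_power)
  finally show ?thesis .
qed

text \<open>The squared norm \<open>M \<sigma>\<close> of the mollification over \<open>A\<close> tends to that of \<open>u\<close> as \<open>\<sigma>\<close> tends to zero, and
the mean value theorem with the dissipation bound controls \<open>M \<sigma> - M s\<close> by \<open>s\<close> times the constant
\<open>L\<close>, uniformly in \<open>\<sigma>\<close>.\<close>

lemma smooth_dissipation_estimate:
  assumes u: "u \<in> kin_smooth D" and D: "D \<in> sets lebesgue" and N: "transport_dual_norm D u < \<infinity>"
    and A: "compact A" and s: "s > 0" and ED: "reach A K s \<subseteq> D"
  defines "f \<equiv> \<lambda>y. indicator (reach A K s) y * u y"
  shows "(LBINT z. indicator A z * (u z)\<^sup>2) \<le> (LBINT z. indicator A z * (mean s f z)\<^sup>2)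
     + s * (2 * dissipation_const * (enn2real (kin_seminorm_smooth D u) * L2_norm D u))"
proof -
  let ?Q = "hom_dim TYPE('d)"
  define E where "E = reach A K s"
  define L where "L = 2 * dissipation_const * (enn2real (kin_seminorm_smooth D u) * L2_norm D u)"
  have L_half: "L / 2 = dissipation_const * (enn2real (kin_seminorm_smooth D u) * L2_norm D u)"
    by (simp add: L_def)
  define M where "M \<sigma> = (LBINT z. indicator A z * (mean \<sigma> f z)\<^sup>2)" for \<sigma>
  define M' where "M' \<sigma> = (LBINT z. indicator A z * (2 * mean \<sigma> f z * mean_rate \<sigma> f z))" for \<sigma>
  have cE: "compact E" and ED': "E \<subseteq> D" using compact_reach[OF A compact_K] ED by (simp_all add: E_def)
  have AE: "A \<subseteq> E" unfolding E_def using s by (intro subset_reach K_nonempty) auto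
  have cu: "continuous_on E u" by (rule kin_smooth_continuous[OF u ED'])
  have f: "bdd_borel f" unfolding f_def E_def[symmetric] by (rule bdd_borel_indicator_continuous[OF cE cu])
  obtain R where R: "\<And>y. \<bar>f y\<bar> \<le> R" using f unfolding bdd_borel_def by blast
  have R0: "R \<ge> 0" using R[of undefined] by linarith
  note iA = bdd_borel_indicator[OF A]
  obtain S where S: "\<And>w. \<bar>scale_deriv w\<bar> \<le> S" "S \<ge> 0" using scale_deriv_bound by metis
  note b2 = bdd_borel_mean_square[OF f iA]
  have b3: "bdd_borel (\<lambda>z. indicator A z * (2 * mean \<sigma> f z * mean_rate \<sigma> f z))" for \<sigma>
  proof -
    have "(\<lambda>z. indicator A z * (2 * mean \<sigma> f z * mean_rate \<sigma> f z)) =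
        (\<lambda>z. (indicator A z * mean \<sigma> f z) * (indicator A z * mean_rate \<sigma> f z) * 2)"
      by (auto simp: fun_eq_iff indicator_def)
    then show ?thesis
      using bdd_borel_mult_continuous[OF bdd_borel_mult[OF bdd_borel_mean(1)[OF f iA] bdd_borel_mean(2)[OF f iA]], of "\<lambda>_. 2"]
      by (simp only: continuous_on_const)
  qed

  have derM: "(M has_real_derivative M' \<sigma>) (at \<sigma>)" if \<sigma>: "\<sigma> > 0" for \<sigma>
  proof -
    define W where "W = 2 * R * ((LBINT y. \<bar>f y\<bar> * S) / (\<sigma> / 2) ^ (?Q + 1))"
    have "((\<lambda>\<sigma>. \<integral>z. indicator A z * (mean \<sigma> f z)\<^sup>2 \<partial>lborel) has_derivative
       (\<lambda>e. \<integral>z. e * (indicator A z * (2 * mean \<sigma> f z * mean_rate \<sigma> f z)) \<partial>lborel)) (at \<sigma>)"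
    proof (rule has_derivative_integral_dominated[where r="\<sigma> / 2" and w="\<lambda>z. indicator A z * W"
        and f'="\<lambda>x z e. e * (indicator A z * (2 * mean x f z * mean_rate x f z))"])
      fix x z assume "x \<in> ball \<sigma> (\<sigma> / 2)"
      then have x2: "\<sigma> / 2 \<le> x" by (auto simp: dist_real_def abs_if split: if_splits)
      then have x0: "0 < x" using \<sigma> by linarith
      show "integrable lborel (\<lambda>z. indicator A z * (mean x f z)\<^sup>2)"
        by (rule bdd_borel_integrable[OF b2])
      have "((\<lambda>x. indicator A z * (mean x f z)\<^sup>2) has_real_derivative
          indicator A z * (2 * mean x f z * mean_rate x f z)) (at x)"
        using mean_has_real_derivative[OF f x0, of z] by (auto intro!: derivative_eq_intros)
      then show "((\<lambda>x. indicator A z * (mean x f z)\<^sup>2) has_derivative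
          (\<lambda>e. e * (indicator A z * (2 * mean x f z * mean_rate x f z)))) (at x)"
        unfolding has_field_derivative_def by (rule has_derivative_eq_rhs) (simp add: fun_eq_iff)
      have "\<bar>2 * mean x f z * mean_rate x f z\<bar> \<le> W"
        unfolding abs_mult W_def using abs_mean_le[where f=f and z=z, OF x0 R] abs_mean_rate_le[where z=z, OF f S(1) _ x2] \<sigma> R0
        by (intro mult_mono) auto
      then have "indicator A z * \<bar>2 * mean x f z * mean_rate x f z\<bar> * \<bar>e\<bar> \<le> indicator A z * W * \<bar>e\<bar>" for e
        by (intro mult_right_mono mult_left_mono) auto
      then show "\<bar>e * (indicator A z * (2 * mean x f z * mean_rate x f z))\<bar> \<le> indicator A z * W * norm e" for e
        by (simp add: abs_mult indicator_def mult_ac)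
    next
      show "integrable lborel (\<lambda>z. indicator A z * W)"
        using bdd_borel_integrable[OF iA] by simp
      show "(\<lambda>z. e * (indicator A z * (2 * mean \<sigma> f z * mean_rate \<sigma> f z))) \<in> borel_measurable lborel" for e
        using bdd_borel_measurable[OF b3[of \<sigma>]] by simp
    qed (use \<sigma> in simp)
    then show ?thesis
      unfolding has_field_derivative_def M_def[abs_def] M'_def
      by (rule has_derivative_eq_rhs) (simp add: fun_eq_iff mult.commute)
  qed

  have u2: "integrable (lebesgue_on D) (\<lambda>z. (norm (u z))\<^sup>2)"
    using u by (simp add: kin_smooth_def in_L2_def)
  have f2: "bdd_borel (\<lambda>y. (f y)\<^sup>2)" unfolding power2_eq_square by (intro bdd_borel_mult f)
  have f_le: "sqrt (LBINT y. (f y)\<^sup>2) \<le> L2_norm D u"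
    unfolding L2_norm_def
  proof (rule real_sqrt_le_mono)
    have "(LBINT y. (f y)\<^sup>2) = (\<integral>y. (f y)\<^sup>2 \<partial>lebesgue_on D)"
      by (rule integral_lebesgue_on_support[OF D bdd_borel_measurable[OF f2], symmetric])
         (use ED in \<open>auto simp: f_def indicator_def\<close>)
    also have "\<dots> \<le> (\<integral>y. (norm (u y))\<^sup>2 \<partial>lebesgue_on D)"
      by (rule Bochner_Integration.integral_mono'[OF u2]) (auto simp: f_def indicator_def)
    finally show "(LBINT y. (f y)\<^sup>2) \<le> (\<integral>y. (norm (u y))\<^sup>2 \<partial>lebesgue_on D)" .
  qed
  have M_le: "sqrt (M \<sigma>) \<le> L2_norm D u" if \<sigma>: "\<sigma> > 0" for \<sigma>
  proof -
    have "ennreal (M \<sigma>) \<le> (\<integral>\<^sup>+z. (ennreal \<bar>mean \<sigma> f z\<bar>)\<^sup>2 \<partial>lborel)"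
      unfolding M_def by (rule nn_integral_mean_square[OF f iA])
    also have "\<dots> \<le> (\<integral>\<^sup>+y. (ennreal \<bar>f y\<bar>)\<^sup>2 \<partial>lborel)"
      by (rule mean_L2_le[OF \<sigma> bdd_borel_measurable[OF f]])
    also have "\<dots> = ennreal (LBINT y. (f y)\<^sup>2)"
      using nn_integral_bdd_borel_nonneg[OF f2] by (simp add: ennreal_power)
    finally have "M \<sigma> \<le> (LBINT y. (f y)\<^sup>2)"
      by (simp add: ennreal_le_iff)
    then show ?thesis using f_le real_sqrt_le_mono order_trans by blast
  qed

  have M'_ge: "- M' \<sigma> \<le> L" if \<sigma>: "0 < \<sigma>" "\<sigma> \<le> s" for \<sigma>
  proof -
    define G where "G z = - (indicator A z * mean \<sigma> f z)" for z
    have G: "bdd_borel G"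
      using bdd_borel_mult_continuous[OF bdd_borel_mean(1)[OF f iA, of \<sigma>], of "\<lambda>_. -1"] by (simp add: G_def[abs_def])
    have G2: "(LBINT z. (G z)\<^sup>2) = M \<sigma>"
      unfolding M_def G_def by (intro Bochner_Integration.integral_cong) (auto simp: indicator_def)
    have "(LBINT z. G z * (LBINT y. f y * scale_deriv (rel_pos \<sigma> y z)))
       \<le> \<sigma> ^ (?Q + 1) * dissipation_const *
        (enn2real (kin_seminorm_smooth D u) * sqrt (LBINT z. (G z)\<^sup>2))"
      unfolding f_def E_def[symmetric]
    proof (rule dissipation_bound[OF u D N cE ED' \<sigma>(1) G])
      show "y \<in> E" if "G z \<noteq> 0" "rel_pos \<sigma> y z \<in> K" for y z
        unfolding E_def using that \<sigma> by (intro mem_reach[of z]) (auto simp: G_def indicator_def split: if_splits)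
    qed
    also have "\<dots> \<le> \<sigma> ^ (?Q + 1) * dissipation_const *
        (enn2real (kin_seminorm_smooth D u) * L2_norm D u)"
      unfolding G2 using M_le[OF \<sigma>(1)] \<sigma> dissipation_const_nonneg
      by (intro mult_left_mono) (auto simp: L2_norm_def)
    finally have "(LBINT z. G z * (LBINT y. f y * scale_deriv (rel_pos \<sigma> y z))) \<le> (L / 2) * \<sigma> ^ (?Q + 1)"
      unfolding L_half by (simp only: mult_ac)
    then have "(LBINT z. G z * (LBINT y. f y * scale_deriv (rel_pos \<sigma> y z))) / \<sigma> ^ (?Q + 1) \<le> L / 2"
      by (subst pos_divide_le_eq[OF zero_less_power[OF \<sigma>(1)]])
    moreover have "- M' \<sigma> = 2 * ((LBINT z. G z * (LBINT y. f y * scale_deriv (rel_pos \<sigma> y z))) / \<sigma> ^ (?Q + 1))"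
    proof -
      have "- M' \<sigma> = (LBINT z. (2 / \<sigma> ^ (?Q + 1)) * (G z * (LBINT y. f y * scale_deriv (rel_pos \<sigma> y z))))"
        unfolding M'_def Bochner_Integration.integral_minus[symmetric]
        by (intro Bochner_Integration.integral_cong refl) (simp add: G_def mean_rate_def)
      then show ?thesis by simp
    qed
    ultimately show ?thesis by linarith
  qed

  have step: "M \<sigma> \<le> M s + s * L" if \<sigma>: "0 < \<sigma>" "\<sigma> < s" for \<sigma>
  proof -
    obtain \<xi> where \<xi>: "\<sigma> < \<xi>" "\<xi> < s" "M s - M \<sigma> = (s - \<sigma>) * M' \<xi>"
      using MVT2[OF \<sigma>(2), of M M'] derM \<sigma>(1) by (metis order_less_le_trans)
    have L0: "L \<ge> 0"
      unfolding L_def using dissipation_const_nonneg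
      by (auto simp: L2_norm_def intro!: mult_nonneg_nonneg add_nonneg_nonneg)
    have "(s - \<sigma>) * (- M' \<xi>) \<le> (s - \<sigma>) * L"
      using M'_ge[of \<xi>] \<xi> \<sigma> by (intro mult_left_mono) auto
    also have "\<dots> \<le> s * L" using \<sigma> L0 by (intro mult_right_mono) auto
    finally show ?thesis using \<xi>(3) by simp
  qed

  \<comment> \<open>a sequence of scales strictly between \<open>0\<close> and \<open>s\<close> that tends to \<open>0\<close>\<close>
  define e where "e n = s / (real n + 2)" for n :: nat
  have e: "0 < e n" "e n < s" for n using s by (auto simp: e_def divide_less_eq)
  have e_lim: "filterlim e (at_right 0) sequentially"
  proof -
    have "e \<longlonglongrightarrow> 0"
      using LIMSEQ_ignore_initial_segment[OF lim_const_over_n[of s], of 2] by (simp add: e_def[abs_def] add.commute)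
    then show ?thesis using e by (intro tendsto_imp_filterlim_at_right) auto
  qed
  have "(\<lambda>n. M (e n)) \<longlonglongrightarrow> (LBINT z. indicator A z * (u z)\<^sup>2)"
    unfolding M_def
  proof (rule integral_dominated_convergence[where w="\<lambda>z. indicator A z * R\<^sup>2"])
    show "AE z in lborel. (\<lambda>n. indicator A z * (mean (e n) f z)\<^sup>2) \<longlonglongrightarrow> indicator A z * (u z)\<^sup>2"
    proof (intro always_eventually allI)
      fix z
      show "(\<lambda>n. indicator A z * (mean (e n) f z)\<^sup>2) \<longlonglongrightarrow> indicator A z * (u z)\<^sup>2"
      proof (cases "z \<in> A")
        case True
        have "continuous_on E f"
          by (rule continuous_on_eq[OF cu]) (simp add: f_def E_def)
        then have "((\<lambda>\<sigma>. mean \<sigma> f z) \<longlongrightarrow> f z) (at_right 0)"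
        proof (rule mean_tendsto[OF f _ _ s])
          show "z \<in> E" using True AE by blast
          show "y \<in> E" if "0 < \<sigma>" "\<sigma> \<le> s" "rel_pos \<sigma> y z \<in> K" for \<sigma> y
            unfolding E_def using True that by (rule mem_reach)
        qed
        from filterlim_compose[OF this e_lim] have "(\<lambda>n. mean (e n) f z) \<longlonglongrightarrow> u z"
          using True AE by (simp add: f_def E_def subsetD)
        then show ?thesis by (intro tendsto_intros)
      qed simp
    qed
    show "AE z in lborel. norm (indicator A z * (mean (e n) f z)\<^sup>2) \<le> indicator A z * R\<^sup>2" for n
    proof (intro always_eventually allI)
      fix z
      have "\<bar>mean (e n) f z\<bar>\<^sup>2 \<le> R\<^sup>2" by (intro power_mono abs_mean_le e R) simp
      then show "norm (indicator A z * (mean (e n) f z)\<^sup>2) \<le> indicator A z * R\<^sup>2"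
        by (simp add: indicator_def)
    qed
    show "(\<lambda>z. indicator A z * (u z)\<^sup>2) \<in> borel_measurable lborel"
      using bdd_borel_measurable[OF bdd_borel_indicator_continuous[OF A, of "\<lambda>z. (u z)\<^sup>2"]]
        continuous_on_subset[OF cu AE] by (auto intro: continuous_intros)
    show "integrable lborel (\<lambda>z. indicator A z * R\<^sup>2)"
      using bdd_borel_integrable[OF iA] by simp
    show "(\<lambda>z. indicator A z * (mean (e n) f z)\<^sup>2) \<in> borel_measurable lborel" for n
      using bdd_borel_measurable[OF b2] by simp
  qed
  then have "(LBINT z. indicator A z * (u z)\<^sup>2) \<le> M s + s * L"
    by (rule LIMSEQ_le_const2) (use step[OF e] in blast)
  then show ?thesis by (simp add: M_def L_def)
qed

end

section \<open>Passage to the limit\<close>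

lemma in_L2_subset:
  fixes g :: "'a::euclidean_space \<Rightarrow> real"
  assumes g: "in_L2 D g" and D: "D \<in> sets lebesgue" and A: "A \<in> sets lebesgue" "A \<subseteq> D"
  shows "in_L2 A g"
proof -
  have "integrable lebesgue (\<lambda>z. indicator D z *\<^sub>R (norm (g z))\<^sup>2)"
    using g D by (simp add: in_L2_def integrable_restrict_space)
  from integrable_mult_indicator[OF A(1) this]
  have "integrable lebesgue (\<lambda>z. indicator A z *\<^sub>R (norm (g z))\<^sup>2)"
    by (rule Bochner_Integration.integrable_cong[THEN iffD1, rotated 2]) (use A(2) in \<open>auto simp: indicator_def\<close>)
  then have "integrable (lebesgue_on A) (\<lambda>z. (norm (g z))\<^sup>2)"
    using A by (simp add: integrable_restrict_space)
  moreover have "g \<in> borel_measurable (lebesgue_on A)"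
    using g A(2) measurable_restrict_mono unfolding in_L2_def by blast
  ultimately show ?thesis by (simp add: in_L2_def)
qed

lemma ennreal_L2_norm_power2:
  fixes g :: "'a::euclidean_space \<Rightarrow> real"
  assumes "in_L2 D g" and D: "D \<in> sets lebesgue"
  shows "ennreal ((L2_norm D g)\<^sup>2) = (\<integral>\<^sup>+z. ennreal ((g z)\<^sup>2) * indicator D z \<partial>lebesgue)"
proof -
  have "ennreal ((L2_norm D g)\<^sup>2) = ennreal (\<integral>z. (norm (g z))\<^sup>2 \<partial>lebesgue_on D)"
    by (simp add: L2_norm_def)
  also have "\<dots> = (\<integral>\<^sup>+z. ennreal ((norm (g z))\<^sup>2) \<partial>lebesgue_on D)"
    using assms(1) by (intro nn_integral_eq_integral[symmetric]) (auto simp: in_L2_def)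
  also have "\<dots> = (\<integral>\<^sup>+z. ennreal ((g z)\<^sup>2) * indicator D z \<partial>lebesgue)"
    using D by (subst nn_integral_restrict_space) auto
  finally show ?thesis .
qed

lemma L2_norm_mono:
  fixes g :: "'a::euclidean_space \<Rightarrow> real"
  assumes g: "in_L2 D g" and D: "D \<in> sets lebesgue" and A: "A \<in> sets lebesgue" "A \<subseteq> D"
  shows "L2_norm A g \<le> L2_norm D g"
proof -
  have "ennreal ((L2_norm A g)\<^sup>2) \<le> ennreal ((L2_norm D g)\<^sup>2)"
    unfolding ennreal_L2_norm_power2[OF g D] ennreal_L2_norm_power2[OF in_L2_subset[OF assms] A(1)]
    using A(2) by (intro nn_integral_mono) (auto simp: indicator_def)
  then have "(L2_norm A g)\<^sup>2 \<le> (L2_norm D g)\<^sup>2" by (subst (asm) ennreal_le_iff) simp_all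
  then show ?thesis by (rule power2_le_imp_le[OF _ L2_norm_nonneg])
qed

lemma
  fixes f g :: "'a::euclidean_space \<Rightarrow> real"
  assumes f: "in_L2 D f" and g: "in_L2 D g"
  shows in_L2_diff: "in_L2 D (\<lambda>z. f z - g z)"
    and L2_norm_triangle: "\<bar>L2_norm D f - L2_norm D g\<bar> \<le> L2_norm D (\<lambda>z. f z - g z)"
proof -
  have add: "in_L2 D (\<lambda>z. f z + g z) \<and> L2_norm D (\<lambda>z. f z + g z) \<le> L2_norm D f + L2_norm D g"
    if f: "in_L2 D f" and g: "in_L2 D g" for f g :: "'a \<Rightarrow> real"
  proof -
    let ?M = "lebesgue_on D"
    have m[measurable]: "f \<in> borel_measurable ?M" "g \<in> borel_measurable ?M"
      and i: "integrable ?M (\<lambda>z. (f z)\<^sup>2)" "integrable ?M (\<lambda>z. (g z)\<^sup>2)"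
      using f g by (simp_all add: in_L2_def)
    have fg: "integrable ?M (\<lambda>z. f z * g z)"
    proof (rule Bochner_Integration.integrable_bound)
      show "integrable ?M (\<lambda>z. (f z)\<^sup>2 + (g z)\<^sup>2)" using i by simp
      have "\<bar>f z * g z\<bar> \<le> (f z)\<^sup>2 + (g z)\<^sup>2" for z
        using sum_squares_bound[of "\<bar>f z\<bar>" "\<bar>g z\<bar>"] mult_nonneg_nonneg[OF abs_ge_zero[of "f z"] abs_ge_zero[of "g z"]]
        unfolding abs_mult power2_abs mult.assoc by linarith
      then show "AE z in ?M. norm (f z * g z) \<le> norm ((f z)\<^sup>2 + (g z)\<^sup>2)"
        by (auto intro!: always_eventually)
    qed simp
    have sq: "(f z + g z)\<^sup>2 = ((f z)\<^sup>2 + (g z)\<^sup>2) + 2 * (f z * g z)" for z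
      by (simp add: power2_sum)
    have "(\<integral>z. (f z + g z)\<^sup>2 \<partial>?M) = (\<integral>z. (f z)\<^sup>2 \<partial>?M) + (\<integral>z. (g z)\<^sup>2 \<partial>?M) + 2 * (\<integral>z. f z * g z \<partial>?M)"
      unfolding sq using i fg by simp
    also have "\<dots> \<le> (\<integral>z. (f z)\<^sup>2 \<partial>?M) + (\<integral>z. (g z)\<^sup>2 \<partial>?M)
        + 2 * (sqrt (\<integral>z. (f z)\<^sup>2 \<partial>?M) * sqrt (\<integral>z. (g z)\<^sup>2 \<partial>?M))"
      by (intro add_left_mono mult_left_mono Cauchy_Schwarz_integral m i) simp
    also have "\<dots> = (L2_norm D f + L2_norm D g)\<^sup>2"
      by (simp add: L2_norm_def power2_sum)
    finally have "L2_norm D (\<lambda>z. f z + g z) \<le> L2_norm D f + L2_norm D g"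
      unfolding L2_norm_def real_norm_def power2_abs
      by (intro real_le_lsqrt add_nonneg_nonneg)
         auto
    moreover have "integrable ?M (\<lambda>z. (f z + g z)\<^sup>2)" unfolding sq using i fg by simp
    ultimately show ?thesis by (simp add: in_L2_def)
  qed
  have uminus: "in_L2 D (\<lambda>z. - f z)" "L2_norm D (\<lambda>z. - f z) = L2_norm D f"
    if "in_L2 D f" for f :: "'a \<Rightarrow> real"
    using that by (simp_all add: in_L2_def L2_norm_def)
  show diff: "in_L2 D (\<lambda>z. f z - g z)" using add[OF f uminus(1)[OF g]] by simp
  have "L2_norm D f \<le> L2_norm D (\<lambda>z. f z - g z) + L2_norm D g"
    using add[OF diff g] by simp
  moreover have "L2_norm D g \<le> L2_norm D (\<lambda>z. - (f z - g z)) + L2_norm D f"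
    using add[OF uminus(1)[OF diff] f] by simp
  ultimately show "\<bar>L2_norm D f - L2_norm D g\<bar> \<le> L2_norm D (\<lambda>z. f z - g z)"
    unfolding uminus(2)[OF diff] by linarith
qed

lemma L2_norm_tendsto:
  fixes g :: "'a::euclidean_space \<Rightarrow> real"
  assumes u: "\<And>n. in_L2 D (u n)" and g: "in_L2 D g"
    and lim: "(\<lambda>n. L2_norm D (\<lambda>z. u n z - g z)) \<longlonglongrightarrow> 0"
    and D: "D \<in> sets lebesgue" and A: "A \<in> sets lebesgue" "A \<subseteq> D"
  shows "(\<lambda>n. L2_norm A (u n)) \<longlonglongrightarrow> L2_norm A g"
proof -
  have "(\<lambda>n. L2_norm A (u n) - L2_norm A g) \<longlonglongrightarrow> 0"
  proof (rule Lim_null_comparison[OF always_eventually lim], rule allI)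
    fix n
    have "\<bar>L2_norm A (u n) - L2_norm A g\<bar> \<le> L2_norm A (\<lambda>z. u n z - g z)"
      by (intro L2_norm_triangle in_L2_subset[OF _ D A] u g)
    also have "\<dots> \<le> L2_norm D (\<lambda>z. u n z - g z)"
      by (intro L2_norm_mono[OF _ D A] in_L2_diff u g)
    finally show "norm (L2_norm A (u n) - L2_norm A g) \<le> L2_norm D (\<lambda>z. u n z - g z)" by simp
  qed
  then show ?thesis by (simp add: LIM_zero_iff)
qed

context mollifier
begin

text \<open>Split \<open>u\<close> into \<open>u - g\<close> and \<open>g\<close>. As \<open>g\<close> is only Lebesgue measurable, it is replaced by a Borel function
that agrees with it almost everywhere.\<close>

lemma mean_L2_le_dist_L1:
  assumes u: "u \<in> kin_smooth D" and g: "in_L2 D g" and D: "D \<in> sets lebesgue"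
    and E: "compact E" "E \<subseteq> D" and s: "s > 0" and S: "\<And>w. \<phi> w \<le> S"
  shows "(\<integral>\<^sup>+z. (ennreal \<bar>mean s (\<lambda>y. indicator E y * u y) z\<bar>)\<^sup>2 \<partial>lborel) \<le>
     2 * ennreal ((L2_norm D (\<lambda>z. u z - g z))\<^sup>2) + 2 * (ennreal (S / s ^ hom_dim TYPE('d)) * (L1_norm D g)\<^sup>2)"
proof -
  have Es: "E \<in> sets lebesgue" using E(1) by (simp add: borel_compact)
  have uL: "in_L2 D u" using u by (simp add: kin_smooth_def)
  have cu: "continuous_on E u" by (rule kin_smooth_continuous[OF u E(2)])
  have fm: "(\<lambda>y. indicator E y * u y) \<in> borel_measurable borel"
    by (rule bdd_borel_measurable[OF bdd_borel_indicator_continuous[OF E(1) cu]])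
  have "g \<in> borel_measurable (lebesgue_on E)"
    using in_L2_subset[OF g D Es E(2)] by (simp add: in_L2_def)
  then have "(\<lambda>y. indicator E y *\<^sub>R g y) \<in> borel_measurable lebesgue"
    using Es by (simp add: borel_measurable_restrict_space_iff)
  then obtain g' where g'[measurable]: "g' \<in> borel_measurable borel"
      and ae: "AE y in lborel. indicator E y * g y = g' y"
    using completion_ex_borel_measurable_real[of "\<lambda>y. indicator E y *\<^sub>R g y" lborel] by auto
  note [measurable] = fm
  have "(\<integral>\<^sup>+z. (ennreal \<bar>mean s (\<lambda>y. indicator E y * u y) z\<bar>)\<^sup>2 \<partial>lborel) \<le>
     2 * (\<integral>\<^sup>+y. (ennreal \<bar>indicator E y * u y - g' y\<bar>)\<^sup>2 \<partial>lborel)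
     + 2 * (ennreal (S / s ^ hom_dim TYPE('d)) * (\<integral>\<^sup>+y. ennreal \<bar>g' y\<bar> \<partial>lborel)\<^sup>2)"
    by (rule mean_L2_le_split[OF s fm])
       (auto simp: ennreal_plus[symmetric] simp del: ennreal_plus intro!: ennreal_leI S)
  also have "\<dots> \<le> 2 * ennreal ((L2_norm D (\<lambda>z. u z - g z))\<^sup>2) + 2 * (ennreal (S / s ^ hom_dim TYPE('d)) * (L1_norm D g)\<^sup>2)"
  proof (intro add_mono mult_left_mono power_mono)
    have "(\<integral>\<^sup>+y. (ennreal \<bar>indicator E y * u y - g' y\<bar>)\<^sup>2 \<partial>lborel)
        = (\<integral>\<^sup>+y. (ennreal \<bar>indicator E y * (u y - g y)\<bar>)\<^sup>2 \<partial>lborel)"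
      by (rule nn_integral_cong_AE) (use ae in eventually_elim, simp add: right_diff_distrib)
    also have "\<dots> = (\<integral>\<^sup>+y. (ennreal \<bar>indicator E y * (u y - g y)\<bar>)\<^sup>2 \<partial>lebesgue)"
      by (rule nn_integral_completion[symmetric])
    also have "\<dots> \<le> (\<integral>\<^sup>+y. ennreal ((u y - g y)\<^sup>2) * indicator D y \<partial>lebesgue)"
      using E(2) by (intro nn_integral_mono) (auto simp: indicator_def ennreal_power)
    finally show "(\<integral>\<^sup>+y. (ennreal \<bar>indicator E y * u y - g' y\<bar>)\<^sup>2 \<partial>lborel) \<le> ennreal ((L2_norm D (\<lambda>z. u z - g z))\<^sup>2)"
      by (simp add: ennreal_L2_norm_power2[OF in_L2_diff[OF uL g] D])
    have "(\<integral>\<^sup>+y. ennreal \<bar>g' y\<bar> \<partial>lborel) = (\<integral>\<^sup>+y. ennreal \<bar>indicator E y * g y\<bar> \<partial>lborel)"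
      by (rule nn_integral_cong_AE) (use ae in eventually_elim, simp)
    also have "\<dots> = (\<integral>\<^sup>+y. ennreal \<bar>indicator E y * g y\<bar> \<partial>lebesgue)"
      by (rule nn_integral_completion[symmetric])
    also have "\<dots> \<le> (\<integral>\<^sup>+y. ennreal \<bar>g y\<bar> * indicator D y \<partial>lebesgue)"
      using E(2) by (intro nn_integral_mono) (auto simp: indicator_def)
    also have "\<dots> = L1_norm D g"
      unfolding L1_norm_def using D by (subst nn_integral_restrict_space) auto
    finally show "(\<integral>\<^sup>+y. ennreal \<bar>g' y\<bar> \<partial>lborel) \<le> L1_norm D g" .
  qed simp_all
  finally show ?thesis .
qed

text \<open>The estimate for the smooth approximations \<open>u n\<close>, in the limit. The errors \<open>u n - g\<close> enter the
mollified term in \<open>L\<^sup>2\<close> only, where they disappear.\<close>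

lemma estimate_on_compact_along_approximation:
  assumes D: "D \<in> sets lebesgue" and A: "compact A" and s: "s > 0" and ED: "reach A K s \<subseteq> D"
    and S: "\<And>w. \<phi> w \<le> S" and g: "in_L2 D g" and u: "kin_approx D g u"
    and l: "(\<lambda>n. kin_seminorm_smooth D (u n)) \<longlonglongrightarrow> l" "l < \<infinity>"
    and G: "L1_norm D g = ennreal G" "G \<ge> 0"
  shows "(L2_norm A g)\<^sup>2 \<le> s * (2 * dissipation_const * (enn2real l * L2_norm D g))
     + 2 * (S / s ^ hom_dim TYPE('d) * G\<^sup>2)"
proof -
  let ?Q = "hom_dim TYPE('d)"
  define E where "E = reach A K s"
  have us: "u n \<in> kin_smooth D" for n using u by (simp add: kin_approx_def)
  then have uL: "in_L2 D (u n)" for n by (simp add: kin_smooth_def)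
  have lim: "(\<lambda>n. L2_norm D (\<lambda>z. u n z - g z)) \<longlonglongrightarrow> 0" using u by (simp add: kin_approx_def)
  have cE: "compact E" and ED': "E \<subseteq> D" using compact_reach[OF A compact_K] ED by (simp_all add: E_def)
  have AD: "A \<subseteq> D" using subset_reach[OF K_nonempty, of s A] s ED by auto
  have As: "A \<in> sets lebesgue" using A by (simp add: borel_compact)
  have S0: "S \<ge> 0" using nonneg S order_trans by blast
  have ev: "\<forall>\<^sub>F n in sequentially. (L2_norm A (u n))\<^sup>2 \<le>
     (2 * (L2_norm D (\<lambda>z. u n z - g z))\<^sup>2 + 2 * (S / s ^ ?Q * G\<^sup>2))
     + s * (2 * dissipation_const * (enn2real (kin_seminorm_smooth D (u n)) * L2_norm D (u n)))"
    using order_tendstoD(2)[OF l(1), of \<infinity>, OF l(2)]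
  proof eventually_elim
    case (elim n)
    let ?f = "\<lambda>y. indicator E y * u n y"
    have N: "transport_dual_norm D (u n) < \<infinity>"
      using elim unfolding kin_seminorm_smooth_def by (simp add: ennreal_add_less_top)
    have cu: "continuous_on E (u n)" by (rule kin_smooth_continuous[OF us ED'])
    have f: "bdd_borel ?f" by (rule bdd_borel_indicator_continuous[OF cE cu])
    have cA: "continuous_on A (u n)" by (rule kin_smooth_continuous[OF us AD])
    note iA = bdd_borel_indicator[OF A]
    have "(L2_norm A (u n))\<^sup>2 = (\<integral>z. (u n z)\<^sup>2 \<partial>lebesgue_on A)"
      by (simp add: L2_norm_def)
    also have "\<dots> = (\<integral>z. indicator A z * (u n z)\<^sup>2 \<partial>lebesgue_on A)"
      by (intro Bochner_Integration.integral_cong) (auto simp: indicator_def)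
    also have "\<dots> = (LBINT z. indicator A z * (u n z)\<^sup>2)"
      by (intro integral_lebesgue_on_support[OF As] bdd_borel_measurable bdd_borel_indicator_continuous A continuous_intros cA)
         simp
    also have "\<dots> \<le> (LBINT z. indicator A z * (mean s ?f z)\<^sup>2)
       + s * (2 * dissipation_const * (enn2real (kin_seminorm_smooth D (u n)) * L2_norm D (u n)))"
      unfolding E_def by (rule smooth_dissipation_estimate[OF us D N A s ED])
    also have "(LBINT z. indicator A z * (mean s ?f z)\<^sup>2)
       \<le> 2 * (L2_norm D (\<lambda>z. u n z - g z))\<^sup>2 + 2 * (S / s ^ ?Q * G\<^sup>2)"
    proof -
      have "ennreal (LBINT z. indicator A z * (mean s ?f z)\<^sup>2) \<le> (\<integral>\<^sup>+z. (ennreal \<bar>mean s ?f z\<bar>)\<^sup>2 \<partial>lborel)"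
        by (rule nn_integral_mean_square[OF f iA])
      also have "\<dots> \<le> 2 * ennreal ((L2_norm D (\<lambda>z. u n z - g z))\<^sup>2) + 2 * (ennreal (S / s ^ ?Q) * (L1_norm D g)\<^sup>2)"
        by (rule mean_L2_le_dist_L1[OF us g D cE ED' s S])
      also have "\<dots> = ennreal (2 * (L2_norm D (\<lambda>z. u n z - g z))\<^sup>2 + 2 * (S / s ^ ?Q * G\<^sup>2))"
      proof -
        define c where "c = S / s ^ ?Q"
        have "c \<ge> 0" using S0 s by (simp add: c_def)
        then show ?thesis
          unfolding c_def[symmetric] G(1) using G(2) by (simp add: ennreal_mult ennreal_power)
      qed
      finally show ?thesis
        using S0 s by (subst (asm) ennreal_le_iff) auto
    qed
    finally show ?case by simp
  qed
  have sl: "(\<lambda>n. enn2real (kin_seminorm_smooth D (u n))) \<longlonglongrightarrow> enn2real l"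
    by (rule tendsto_enn2real) (use l in \<open>simp_all add: less_top\<close>)
  have "(\<lambda>n. (2 * (L2_norm D (\<lambda>z. u n z - g z))\<^sup>2 + 2 * (S / s ^ ?Q * G\<^sup>2))
     + s * (2 * dissipation_const * (enn2real (kin_seminorm_smooth D (u n)) * L2_norm D (u n))))
    \<longlonglongrightarrow> (2 * 0\<^sup>2 + 2 * (S / s ^ ?Q * G\<^sup>2)) + s * (2 * dissipation_const * (enn2real l * L2_norm D g))"
    by (intro tendsto_intros lim L2_norm_tendsto[OF uL g lim D D] sl order_refl)
  moreover have "(\<lambda>n. (L2_norm A (u n))\<^sup>2) \<longlonglongrightarrow> (L2_norm A g)\<^sup>2"
    by (intro tendsto_intros L2_norm_tendsto[OF uL g lim D As AD])
  ultimately have "(L2_norm A g)\<^sup>2 \<le> (2 * 0\<^sup>2 + 2 * (S / s ^ ?Q * G\<^sup>2)) + s * (2 * dissipation_const * (enn2real l * L2_norm D g))"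
    using ev by (intro tendsto_le[OF trivial_limit_sequentially])
  then show ?thesis by simp
qed

text \<open>The seminorm is an infimum of limits along approximating sequences, so the bound holds with the
seminorm enlarged by an arbitrary \<open>\<epsilon> > 0\<close>. If the \<open>L\<^sup>1\<close> norm is infinite, so is the right-hand side.\<close>

lemma estimate_on_compact:
  assumes D: "D \<in> sets lebesgue" and A: "compact A" and s: "s > 0" and ED: "reach A K s \<subseteq> D"
    and S: "\<And>w. \<phi> w \<le> S" and g: "g \<in> H1_kin D"
    and C: "C \<ge> 2 * dissipation_const" "C \<ge> 2 * S" "C > 0"
  shows "ennreal ((L2_norm A g)\<^sup>2) \<le> ennreal C * (ennreal s * kin_seminorm D g * ennreal (L2_norm D g)
      + ennreal (1 / s ^ hom_dim TYPE('d)) * (L1_norm D g)\<^sup>2)"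
proof (cases "L1_norm D g")
  case (real G)
  let ?Q = "hom_dim TYPE('d)"
  have gL: "in_L2 D g" and fin: "kin_seminorm D g < \<infinity>"
    using g by (auto simp: H1_kin_def kin_norm_def)
  define \<Lambda> where "\<Lambda> = enn2real (kin_seminorm D g)"
  have \<Lambda>: "kin_seminorm D g = ennreal \<Lambda>" "\<Lambda> \<ge> 0" using fin by (simp_all add: \<Lambda>_def)
  have "(L2_norm A g)\<^sup>2 \<le> C * (s * (\<Lambda> + \<epsilon>) * L2_norm D g + 1 / s ^ ?Q * G\<^sup>2)" if \<epsilon>: "\<epsilon> > 0" for \<epsilon>
  proof -
    have "kin_seminorm D g < ennreal (\<Lambda> + \<epsilon>)"
      unfolding \<Lambda>(1) using \<Lambda>(2) \<epsilon> by (simp add: ennreal_less_iff)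
    then obtain l u where u: "kin_approx D g u" and l: "(\<lambda>n. kin_seminorm_smooth D (u n)) \<longlonglongrightarrow> l"
      and le: "l < ennreal (\<Lambda> + \<epsilon>)"
      unfolding kin_seminorm_def Inf_less_iff by blast
    have lfin: "l < \<infinity>" using le less_trans ennreal_less_top by (metis infinity_ennreal_def)
    have lr: "enn2real l \<le> \<Lambda> + \<epsilon>" using enn2real_mono[OF less_imp_le[OF le]] \<Lambda>(2) \<epsilon> by (simp del: ennreal_plus)
    have "(L2_norm A g)\<^sup>2 \<le> s * (2 * dissipation_const * (enn2real l * L2_norm D g)) + 2 * (S / s ^ ?Q * G\<^sup>2)"
      by (rule estimate_on_compact_along_approximation[OF D A s ED S gL u l lfin real(2) real(1)])
    also have "\<dots> \<le> s * (C * ((\<Lambda> + \<epsilon>) * L2_norm D g)) + C * (1 / s ^ ?Q * G\<^sup>2)"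
    proof (intro add_mono)
      show "s * (2 * dissipation_const * (enn2real l * L2_norm D g)) \<le> s * (C * ((\<Lambda> + \<epsilon>) * L2_norm D g))"
        using s C lr by (intro mult_left_mono mult_mono mult_right_mono) (auto simp: L2_norm_nonneg)
      have "(2 * S) * (1 / s ^ ?Q * G\<^sup>2) \<le> C * (1 / s ^ ?Q * G\<^sup>2)"
        using C s by (intro mult_right_mono) auto
      then show "2 * (S / s ^ ?Q * G\<^sup>2) \<le> C * (1 / s ^ ?Q * G\<^sup>2)" by simp
    qed
    finally show ?thesis by (simp add: algebra_simps)
  qed
  then have "(L2_norm A g)\<^sup>2 \<le> C * (s * (\<Lambda> + \<epsilon>) * L2_norm D g + 1 / s ^ ?Q * G\<^sup>2)" if "\<epsilon> > 0" for \<epsilon>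
    using that by blast
  moreover have "((\<lambda>\<epsilon>. C * (s * (\<Lambda> + \<epsilon>) * L2_norm D g + 1 / s ^ ?Q * G\<^sup>2)) \<longlongrightarrow>
      C * (s * (\<Lambda> + 0) * L2_norm D g + 1 / s ^ ?Q * G\<^sup>2)) (at_right 0)"
    by (intro tendsto_intros)
  ultimately have "(L2_norm A g)\<^sup>2 \<le> C * (s * (\<Lambda> + 0) * L2_norm D g + 1 / s ^ ?Q * G\<^sup>2)"
    by (intro tendsto_lowerbound[where F="at_right (0::real)"]) (auto simp: eventually_at_right_field intro!: exI[of _ 1])
  then have "ennreal ((L2_norm A g)\<^sup>2) \<le> ennreal (C * (s * \<Lambda> * L2_norm D g + 1 / s ^ ?Q * G\<^sup>2))"
    by (intro ennreal_leI) simp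
  also have "\<dots> = ennreal C * (ennreal s * kin_seminorm D g * ennreal (L2_norm D g)
      + ennreal (1 / s ^ ?Q) * (L1_norm D g)\<^sup>2)"
  proof -
    define c where "c = 1 / s ^ ?Q"
    have "c \<ge> 0" using s by (simp add: c_def)
    then show ?thesis
      unfolding c_def[symmetric] \<Lambda>(1) real(2) using C s \<Lambda>(2) real(1)
      by (simp add: ennreal_mult ennreal_power L2_norm_nonneg)
  qed
  finally show ?thesis .
next
  case top
  have "ennreal (1 / s ^ hom_dim TYPE('d)) * (L1_norm D g)\<^sup>2 = \<infinity>"
    using s by (simp add: top power2_eq_square ennreal_mult_top ennreal_mult_eq_top_iff)
  then have "ennreal C * (ennreal s * kin_seminorm D g * ennreal (L2_norm D g)
      + ennreal (1 / s ^ hom_dim TYPE('d)) * (L1_norm D g)\<^sup>2) = \<infinity>"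
    using C(3) by (simp add: ennreal_mult_top)
  then show ?thesis by (simp del: ennreal_mult_eq_top_iff)
qed

end

text \<open>A Lebesgue set is an increasing union of compact sets up to a null set.\<close>

lemma L2_norm_le_of_compact:
  fixes g :: "'a::euclidean_space \<Rightarrow> real"
  assumes g: "in_L2 W g" and W: "W \<in> sets lebesgue"
    and le: "\<And>A. compact A \<Longrightarrow> A \<subseteq> W \<Longrightarrow> ennreal ((L2_norm A g)\<^sup>2) \<le> R"
  shows "ennreal ((L2_norm W g)\<^sup>2) \<le> R"
proof -
  obtain C T where C: "fsigma C" "T \<in> null_sets lebesgue" "C \<union> T = W"
    using lebesgue_set_almost_fsigma[OF W] by metis
  then obtain F :: "nat \<Rightarrow> 'a set" where "range F \<subseteq> Collect compact" "C = (\<Union>n. F n)"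
    unfolding fsigma_Union_compact by blast
  then have F: "\<And>n. compact (F n)" "C = (\<Union>n. F n)" by auto
  define A where "A n = (\<Union>i\<le>n. F i)" for n
  have A: "compact (A n)" "A n \<subseteq> W" for n
    using F C(3) by (auto simp: A_def)
  have As: "A n \<in> sets lebesgue" for n using A(1) by (simp add: borel_compact)
  have gm: "(\<lambda>z. ennreal ((g z)\<^sup>2) * indicator (A n) z) \<in> borel_measurable lebesgue" for n
  proof -
    have "(\<lambda>z. indicator (A n) z *\<^sub>R g z) \<in> borel_measurable lebesgue"
      using in_L2_subset[OF g W As A(2)] As
      by (simp add: in_L2_def borel_measurable_restrict_space_iff)
    then have "(\<lambda>z. ennreal ((indicator (A n) z *\<^sub>R g z)\<^sup>2)) \<in> borel_measurable lebesgue" by measurable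
    then show ?thesis by (rule measurable_cong[THEN iffD1, rotated]) (auto simp: indicator_def)
  qed
  have "ennreal ((L2_norm W g)\<^sup>2) = (\<integral>\<^sup>+z. ennreal ((g z)\<^sup>2) * indicator W z \<partial>lebesgue)"
    by (rule ennreal_L2_norm_power2[OF g W])
  also have "\<dots> = (\<integral>\<^sup>+z. (SUP n. ennreal ((g z)\<^sup>2) * indicator (A n) z) \<partial>lebesgue)"
  proof (rule nn_integral_cong_AE)
    have "AE z in lebesgue. z \<notin> T" using C(2) by (rule AE_not_in)
    then show "AE z in lebesgue. ennreal ((g z)\<^sup>2) * indicator W z = (SUP n. ennreal ((g z)\<^sup>2) * indicator (A n) z)"
    proof eventually_elim
      case (elim z)
      show ?case
      proof (cases "z \<in> C")
        case True
        then obtain n where n: "z \<in> A n" using F(2) by (auto simp: A_def)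
        have "(SUP n. ennreal ((g z)\<^sup>2) * indicator (A n) z) = ennreal ((g z)\<^sup>2)"
        proof (rule antisym)
          show "(SUP n. ennreal ((g z)\<^sup>2) * indicator (A n) z) \<le> ennreal ((g z)\<^sup>2)"
            by (intro SUP_least) (auto simp: indicator_def)
          show "ennreal ((g z)\<^sup>2) \<le> (SUP n. ennreal ((g z)\<^sup>2) * indicator (A n) z)"
            using n by (intro SUP_upper2[of n]) auto
        qed
        then show ?thesis using True C(3) by auto
      next
        case False
        then have "z \<notin> A n" for n using F(2) by (auto simp: A_def)
        then show ?thesis using False elim C(3) by auto
      qed
    qed
  qed
  also have "\<dots> = (SUP n. \<integral>\<^sup>+z. ennreal ((g z)\<^sup>2) * indicator (A n) z \<partial>lebesgue)"
  proof (rule nn_integral_monotone_convergence_SUP[OF _ gm])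
    show "incseq (\<lambda>n z. ennreal ((g z)\<^sup>2) * indicator (A n) z)"
      by (intro incseq_SucI le_funI mult_left_mono) (auto simp: A_def indicator_def le_SucI)
  qed
  also have "\<dots> \<le> R"
  proof (rule SUP_least)
    fix n
    show "(\<integral>\<^sup>+z. ennreal ((g z)\<^sup>2) * indicator (A n) z \<partial>lebesgue) \<le> R"
      using le[OF A, of n] ennreal_L2_norm_power2[OF in_L2_subset[OF g W As A(2)] As, of n] by simp
  qed
  finally show ?thesis .
qed

theorem theorem1p2:
  fixes B :: "'d::finite kpoint set"
  assumes "open B" and "bounded B" and "B \<noteq> {}"
  shows "\<exists>C::real. C > 0 \<and>
    (\<forall>(s0::real) (\<Omega>1::'d kpoint set) (\<Omega>2::'d kpoint set).
       s0 > 0 \<longrightarrow>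
       \<Omega>1 \<in> sets lebesgue \<longrightarrow> \<Omega>2 \<in> sets lebesgue \<longrightarrow>
       \<Omega>1 \<subseteq> {0<..} \<times> UNIV \<longrightarrow> \<Omega>2 \<subseteq> {0<..} \<times> UNIV \<longrightarrow>
       (\<forall>s\<in>{0..s0}. set_comp \<Omega>1 (kin_inv ` (dilation s ` B)) \<subseteq> \<Omega>2) \<longrightarrow>
       (\<forall>g\<in>H1_kin \<Omega>2. \<forall>s\<in>{0<..s0}.
          ennreal ((L2_norm \<Omega>1 g) ^ 2) \<le>
            ennreal C *
              (ennreal s * kin_seminorm \<Omega>2 g * ennreal (L2_norm \<Omega>2 g)
               + ennreal (1 / s ^ (4 * CARD('d) + 2)) * (L1_norm \<Omega>2 g) ^ 2)))"
proof -
  obtain \<phi> :: "'d kpoint \<Rightarrow> real" and K where \<phi>: "elem_smooth \<phi>" "compact K" "K \<subseteq> B" "\<And>w. w \<notin> K \<Longrightarrow> \<phi> w = 0"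
    "\<And>w. 0 \<le> \<phi> w" "(\<integral>\<^sup>+w. ennreal (\<phi> w) \<partial>lborel) = 1"
    using exists_bump[OF assms(1,3)] by metis
  interpret mollifier \<phi> K
    by unfold_locales (use \<phi> in auto)
  obtain S where S: "\<And>w. \<bar>\<phi> w\<bar> \<le> S" using bdd_borel_bump unfolding bdd_borel_def by blast
  have S0: "S \<ge> 0" using S[of undefined] by linarith
  define C where "C = 2 * dissipation_const + 2 * S + 1"
  have C: "C \<ge> 2 * dissipation_const" "C \<ge> 2 * S" "C > 0"
    using S0 dissipation_const_nonneg by (auto simp: C_def)
  show ?thesis
  proof (intro exI[of _ C] conjI allI impI ballI)
    fix s0 :: real and \<Omega>1 \<Omega>2 :: "'d kpoint set" and g s
    assume \<Omega>: "\<Omega>1 \<in> sets lebesgue" "\<Omega>2 \<in> sets lebesgue"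
      and sub: "\<forall>s\<in>{0..s0}. set_comp \<Omega>1 (kin_inv ` (dilation s ` B)) \<subseteq> \<Omega>2"
      and g: "g \<in> H1_kin \<Omega>2" and s: "s \<in> {0<..s0}"
    have reach: "reach A K s \<subseteq> \<Omega>2" if "A \<subseteq> \<Omega>1" for A
    proof (rule reach_subset[OF _ \<phi>(3)])
      fix \<sigma> assume "\<sigma> \<in> {0..s}"
      then have "set_comp \<Omega>1 (kin_inv ` (dilation \<sigma> ` B)) \<subseteq> \<Omega>2" using sub s by auto
      then show "set_comp A (kin_inv ` (dilation \<sigma> ` B)) \<subseteq> \<Omega>2"
        using that unfolding set_comp_def by blast
    qed
    have "\<Omega>1 \<subseteq> \<Omega>2" using subset_reach[OF K_nonempty, of s \<Omega>1] reach[of \<Omega>1] s by auto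
    moreover have "in_L2 \<Omega>2 g" using g by (simp add: H1_kin_def)
    ultimately have g1: "in_L2 \<Omega>1 g"
      using \<Omega> in_L2_subset by blast
    show "ennreal ((L2_norm \<Omega>1 g) ^ 2) \<le> ennreal C *
              (ennreal s * kin_seminorm \<Omega>2 g * ennreal (L2_norm \<Omega>2 g)
               + ennreal (1 / s ^ (4 * CARD('d) + 2)) * (L1_norm \<Omega>2 g) ^ 2)"
    proof (rule L2_norm_le_of_compact[OF g1 \<Omega>(1)])
      fix A assume A: "compact A" "A \<subseteq> \<Omega>1"
      have bound: "\<phi> w \<le> S" for w using S[of w] by linarith
      have s': "0 < s" using s by simp
      have "ennreal ((L2_norm A g)\<^sup>2) \<le> ennreal C *
              (ennreal s * kin_seminorm \<Omega>2 g * ennreal (L2_norm \<Omega>2 g)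
               + ennreal (1 / s ^ hom_dim TYPE('d)) * (L1_norm \<Omega>2 g) ^ 2)"
        by (rule estimate_on_compact[OF \<Omega>(2) A(1) s' reach[OF A(2)] bound g C])
      then show "ennreal ((L2_norm A g)\<^sup>2) \<le> ennreal C *
              (ennreal s * kin_seminorm \<Omega>2 g * ennreal (L2_norm \<Omega>2 g)
               + ennreal (1 / s ^ (4 * CARD('d) + 2)) * (L1_norm \<Omega>2 g) ^ 2)"
        by (simp only: hom_dim_def)
    qed
  qed (rule C(3))
qed

end
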